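(* Let $\alpha\in\mathbb{C}$ and let $\mathfrak{A}^\alpha$, $(\mathfrak{A}^\alpha)^+_\nu$, $Q$, $Q^+$, $\langle\cdot,\cdot\rangle_\alpha$, $\langle\cdot,\cdot\rangle^+_\nu$ and $f_{k,\nu}$ be as in the context. (0) For $\nu\in Q^+$, $(\mathfrak{A}^\alpha)^+_\nu=\mathbb{C}[E_{33}]\,u_\nu$, where $u_\nu$ is determined uniquely up to a constant factor. (1) $\langle(\mathfrak{A}^\alpha)^+_\nu,(\mathfrak{A}^\alpha)^+_\mu\rangle_\alpha=0$ for $\nu\ne\mu$. (2) The polynomials $f_{k,\nu}(E_{33})$ are orthogonal relative to $\langle\cdot,\cdot\rangle^+_\nu$. (3) The polynomials $f=f_{k,\nu}(E_{33})$ satisfy the difference equation $$(E_{33}-\nu(E_{33})+1)(E_{33}+\nu(E_{11})-\alpha)\,\Delta f-E_{33}(E_{33}+\nu(E_{22})-\alpha-2)\,\nabla f=k\big(k+2\nu(E_{11})+2\big)f\quad\text{if }\nu(E_{33})<0,$$ $$(E_{33}+1)(E_{33}+\nu(E_{11})-\alpha)\,\Delta f-(E_{33}-\nu(E_{33}))(E_{33}+\nu(E_{22})-\alpha-2)\,\nabla f=k\big(k-2\nu(E_{11})+2\big)f\quad\text{if }\nu(E_{33})\ge0.$$ (4) Explicitly, for $\nu=k_1\varepsilon_1+k_2\varepsilon_2+k_3\varepsilon_3\in Q^+$, $f_{k,\nu}(E_{33})$ is of the form $$f_{k,\nu}(E_{33})=\mathrm{const}\times{}_3F_2\left(\begin{matrix}-k,\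 k+2k_1+2,\ -E_{33}\\ 1-k_3,\ k_1-\alpha\end{matrix}\ \Big|\ 1\right),$$ where $${}_3F_2\left(\begin{matrix}\alpha_1,\alpha_2,\alpha_3\\ \beta_1,\beta_2\end{matrix}\ \Big|\ z\right)=\sum_{i=0}^\infty\frac{(\alpha_1)_i(\alpha_2)_i(\alpha_3)_i}{(\beta_1)_i(\beta_2)_i}\,\frac{z^i}{i!}$$ is a generalized hypergeometric function, $(\alpha)_0=1$ and $(\alpha)_i=\alpha(\alpha+1)\cdots(\alpha+i-1)$ for $i>0$.
   Context: $\mathfrak{g}=\mathfrak{gl}(3)$ over $\mathbb{C}$ with matrix units $E_{ij}$; $\mathfrak{h}=\operatorname{Span}(E_{11},E_{22},E_{33})$ is the Cartan subalgebra, $\varepsilon_1,\varepsilon_2,\varepsilon_3$ is the dual basis of $\mathfrak{h}^*$, and $Q=\{\sum k_i\varepsilon_i:\sum k_i=0\}$ (integer $k_i$) is the root lattice. For $\alpha\in\mathbb{C}$, $S^\alpha(V)$ is the irreducible $\mathfrak{g}$-module with highest weight $(\alpha,0,0)$. It is realized as the span of the monomials $x_1^{k_1}x_2^{k_2}x_3^{k_3}$ with $k_1+k_2+k_3=\alpha$, where $k_1,k_2,k_3\in\mathbb{Z}_{\ge0}$ if $\alpha\in\mathbb{Z}_{\ge0}$, and only $k_2,k_3\in\mathbb{Z}_{\ge0}$ is required if $\alpha\notin\mathbb{Z}_{\ge0}$ (then $x_1^{k}$ is a formal power with $\partial x_1^k/\partial x_1=kx_1^{k-1}$); $E_{ij}$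 acts as $x_i\,\partial/\partial x_j$. $J^\alpha$ is the kernel of the corresponding representation of $U(\mathfrak{g})$, and $\mathfrak{A}^\alpha=U(\mathfrak{g})/J^\alpha$. Elements of $\mathfrak g$ are identified with their images in $\mathfrak{A}^\alpha$. $U(\mathfrak{g})$ acts on $\mathfrak{A}^\alpha$ by the extension $\operatorname{ad}$ of the adjoint action, $\operatorname{ad}(xy)=\operatorname{ad}(x)\operatorname{ad}(y)$, $\operatorname{ad}(x)(u)=[x,u]$ for $x\in\mathfrak{g}$. Form: $U(\mathfrak{g})=Z(\mathfrak{g})\oplus[U(\mathfrak{g}),U(\mathfrak{g})]$, where $Z(\mathfrak{g})$ is the center of $U(\mathfrak g)$, and $u\mapsto u^\sharp$ is the projection onto $Z(\mathfrak{g})$; $\varphi$ is the Harish-Chandra homomorphism; $\omega$ is the Chevalley involution, i.e. the antiautomorphism of $U(\mathfrak{g})$ with $\omega(E_{ij})=E_{ji}$. $\langle u,v\rangle_\alpha=\varphi((u\,\omega(v))^\sharp)(\alpha,0,0)$, considered as a form on $\mathfrak{A}^\alpha$. $(\mathfrak{A}^\alpha)^+=\{u\in\mathfrak{A}^\alpha:[E_{12},u]=0\}$; for $\nu\in Q$, $(\mathfrak{A}^\alpha)^+_\nu=\{u\in(\mathfrak{A}^\alpha)^+:[h,u]=\nu(h)u\text{ for all }h\in\mathfrak{h}\}$; $Q^+=\{\nu\in Q:(\mathfrak{A}^\alpha)^+_\nu\ne0\}$. For $\nu\in Q^+$, $u_\nu$ is the generator of part (0). For $f,g\in\mathbb{C}[E_{33}]$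 and $\nu\in Q^+$, $\langle f,g\rangle^+_\nu=\langle fu_\nu,gu_\nu\rangle_\alpha$. Put $z_{31}=(E_{11}-E_{22}+2)E_{31}+E_{21}E_{32}$ and $z_{23}=(E_{11}-E_{22}+2)E_{23}-E_{21}E_{13}$. For $k\ge0$ and $\nu\in Q^+$, $f_{k,\nu}$ is defined by $$f_{k,\nu}(E_{33})u_\nu=\begin{cases}(\operatorname{ad}z_{31})^k\big(u_{\nu+k(\varepsilon_1-\varepsilon_3)}\big)&\text{for }\nu(E_{33})\le0,\\(\operatorname{ad}z_{23})^k\big(u_{\nu+k(\varepsilon_3-\varepsilon_2)}\big)&\text{for }\nu(E_{33})\ge0.\end{cases}$$ $\Delta f(E_{33})=f(E_{33}+1)-f(E_{33})$ and $\nabla f(E_{33})=f(E_{33})-f(E_{33}-1)$.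
   Formalization: For α∈Z≥0, u_ν and f_{k,ν} are taken of least degree, f_{k,ν} only if the shifted weight is in Q^+; (3), ν(E33)≥0: the eigenvalue is k(k-2ν(E22)+2); (4), ν(E33)>0: the formula is 3F2(-k, k-2k_2+2, k_3-E33; 1+k_3, -k_2-α | 1). *)

theory Defs
  imports
    "HOL-Analysis.Analysis"
    "HOL-Library.Poly_Mapping"
    "HOL-Algebra.QuotRing"
    "HOL-Algebra.Algebraic_Closure_Type"
begin


section \<open>The universal enveloping algebra of \<open>gl(3)\<close>\<close>

text \<open>
  The free associative unital algebra on symbols \<open>gen i j\<close> is the monoid algebra of the free
  monoid (words under concatenation), so that the ring structure is the convolution product
  of \<^theory>\<open>HOL-Library.Poly_Mapping\<close>. Indices live in the type \<open>3\<close>,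
  in which the numeral \<open>3\<close> equals \<open>0\<close>; its order is not used anywhere.
\<close>

datatype 'a fword = FWord (letters: "'a list")

instantiation fword :: (type) monoid_add
begin

definition zero_fword :: "'a fword" where
  "zero_fword = FWord []"

definition plus_fword :: "'a fword \<Rightarrow> 'a fword \<Rightarrow> 'a fword" where
  "plus_fword v w = FWord (letters v @ letters w)"

instance
  by standard (auto simp: zero_fword_def plus_fword_def)

end

lemma letters_plus [simp]: "letters (v + w) = letters v @ letters w"
  by (simp add: plus_fword_def)

lemma letters_zero [simp]: "letters 0 = []"
  by (simp add: zero_fword_def)

type_synonym falg = "(3 \<times> 3) fword \<Rightarrow>\<^sub>0 complex"

definition gen :: "3 \<Rightarrow> 3 \<Rightarrow> falg" where
  "gen i j = Poly_Mapping.single (FWord [(i, j)]) 1"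

definition gl3_rel :: "3 \<Rightarrow> 3 \<Rightarrow> 3 \<Rightarrow> 3 \<Rightarrow> falg" where
  "gl3_rel i j k l = gen i j * gen k l - gen k l * gen i j
     - ((if j = k then gen i l else 0) - (if l = i then gen k j else 0))"

inductive_set gl3_ideal :: "falg set" where
  zero: "0 \<in> gl3_ideal"
| step: "p \<in> gl3_ideal \<Longrightarrow> a * gl3_rel i j k l * b + p \<in> gl3_ideal"

lemma gl3_ideal_add: "p \<in> gl3_ideal \<Longrightarrow> q \<in> gl3_ideal \<Longrightarrow> p + q \<in> gl3_ideal"
  by (induction rule: gl3_ideal.induct) (auto simp: add.assoc intro: gl3_ideal.step)

lemma gl3_ideal_lmult: "p \<in> gl3_ideal \<Longrightarrow> c * p \<in> gl3_ideal"
proof (induction rule: gl3_ideal.induct)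
  case (step p a i j k l b)
  then show ?case
    using gl3_ideal.step[of "c * p" "c * a" i j k l b] by (simp add: algebra_simps)
qed (simp add: gl3_ideal.zero)

lemma gl3_ideal_rmult: "p \<in> gl3_ideal \<Longrightarrow> p * c \<in> gl3_ideal"
proof (induction rule: gl3_ideal.induct)
  case (step p a i j k l b)
  then show ?case
    using gl3_ideal.step[of "p * c" a i j k l "b * c"] by (simp add: algebra_simps)
qed (simp add: gl3_ideal.zero)

lemma gl3_ideal_uminus: "p \<in> gl3_ideal \<Longrightarrow> - p \<in> gl3_ideal"
  using gl3_ideal_lmult[of p "-1"] by simp

lemma gl3_ideal_diff: "p \<in> gl3_ideal \<Longrightarrow> q \<in> gl3_ideal \<Longrightarrow> p - q \<in> gl3_ideal"
  using gl3_ideal_add[of p "- q"] gl3_ideal_uminus[of q] by simp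

lemma gl3_rel_in_ideal: "gl3_rel i j k l \<in> gl3_ideal"
  using gl3_ideal.step[OF gl3_ideal.zero, of 1 i j k l 1] by simp

definition ueq :: "falg \<Rightarrow> falg \<Rightarrow> bool" where
  "ueq p q \<longleftrightarrow> p - q \<in> gl3_ideal"

lemma equivp_ueq: "equivp ueq"
proof (rule equivpI)
  show "reflp ueq"
    by (simp add: reflp_def ueq_def gl3_ideal.zero)
  show "symp ueq"
    unfolding symp_def ueq_def using gl3_ideal_uminus by fastforce
  show "transp ueq"
    unfolding transp_def ueq_def using gl3_ideal_add by fastforce
qed

quotient_type ugl3 = falg / ueq
  by (rule equivp_ueq)

instantiation ugl3 :: ring_1
begin

lift_definition zero_ugl3 :: ugl3 is 0 .

lift_definition one_ugl3 :: ugl3 is 1 .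

lift_definition plus_ugl3 :: "ugl3 \<Rightarrow> ugl3 \<Rightarrow> ugl3" is "(+)"
  unfolding ueq_def using gl3_ideal_add by (fastforce simp: algebra_simps)

lift_definition minus_ugl3 :: "ugl3 \<Rightarrow> ugl3 \<Rightarrow> ugl3" is "(-)"
  unfolding ueq_def using gl3_ideal_diff by (fastforce simp: algebra_simps)

lift_definition uminus_ugl3 :: "ugl3 \<Rightarrow> ugl3" is uminus
  unfolding ueq_def using gl3_ideal_uminus by fastforce

lift_definition times_ugl3 :: "ugl3 \<Rightarrow> ugl3 \<Rightarrow> ugl3" is "(*)"
proof -
  fix p p' q q' :: falg
  assume "ueq p p'" "ueq q q'"
  then have "(p - p') * q + p' * (q - q') \<in> gl3_ideal"
    unfolding ueq_def by (intro gl3_ideal_add gl3_ideal_lmult gl3_ideal_rmult)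
  then show "ueq (p * q) (p' * q')"
    by (simp add: ueq_def algebra_simps)
qed

text \<open>\<open>0 \<noteq> 1\<close> is witnessed by the trivial representation, i.e. by the constant coefficient.\<close>

lemma lookup_gl3_ideal_zero:
  assumes "p \<in> gl3_ideal" shows "Poly_Mapping.lookup p 0 = 0"
proof -
  have nz: "FWord [x] \<noteq> 0" for x :: "3 \<times> 3"
    by (simp add: zero_fword_def)
  have mult0: "Poly_Mapping.lookup (p * q) 0 = Poly_Mapping.lookup p 0 * Poly_Mapping.lookup q 0" for p q :: falg
  proof -
    have split: "(0 = k + l) = (k = 0 \<and> l = 0)" for k l :: "(3 \<times> 3) fword"
      by (auto simp: zero_fword_def plus_fword_def fword.expand)
    have eq: "(Sum_any (\<lambda>l. Poly_Mapping.lookup q l when (0::(3 \<times> 3) fword) = k + l)) = (Poly_Mapping.lookup q 0 when k = 0)" for k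
      by (cases "k = 0") (simp_all add: split)
    show ?thesis
      by (simp only: lookup_mult eq mult_when Sum_any_when_equal)
  qed
  show ?thesis
    using assms
    by induction (auto simp: lookup_add lookup_minus mult0 gl3_rel_def gen_def lookup_single nz)
qed

instance
proof
  show "(0::ugl3) \<noteq> 1"
  proof transfer
    show "\<not> ueq 0 1"
      using lookup_gl3_ideal_zero[of "0 - 1"] by (auto simp: ueq_def lookup_minus)
  qed
qed (transfer; simp add: ueq_def gl3_ideal.zero algebra_simps)+

end

lift_definition E :: "3 \<Rightarrow> 3 \<Rightarrow> ugl3" is gen .

lift_definition scaleU :: "complex \<Rightarrow> ugl3 \<Rightarrow> ugl3"
  is "\<lambda>c p. Poly_Mapping.single 0 c * p"
  unfolding ueq_def using gl3_ideal_lmult by (fastforce simp: algebra_simps)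

interpretation ugl3: vector_space scaleU
proof
  show "scaleU a (x + y) = scaleU a x + scaleU a y" for a x y
    by transfer (simp add: ueq_def gl3_ideal.zero algebra_simps)
  show "scaleU (a + b) x = scaleU a x + scaleU b x" for a b x
    by transfer (simp add: ueq_def gl3_ideal.zero algebra_simps single_add)
  show "scaleU a (scaleU b x) = scaleU (a * b) x" for a b x
    by transfer (simp add: ueq_def gl3_ideal.zero mult_single flip: mult.assoc)
  show "scaleU 1 x = x" for x
    by transfer (simp add: ueq_def gl3_ideal.zero)
qed

lemma E_bracket:
  "E i j * E k l - E k l * E i j = (if j = k then E i l else 0) - (if l = i then E k j else 0)"
proof -
  have "E i j * E k l - E k l * E i j
      - ((if j = k then E i l else 0) - (if l = i then E k j else 0)) = 0"
    using gl3_rel_in_ideal[of i j k l]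
    by (cases "j = k"; cases "l = i"; simp; transfer) (auto simp: gl3_rel_def ueq_def)
  then show ?thesis
    by simp
qed


section \<open>Modules over \<open>gl(3)\<close> and their extension to the enveloping algebra\<close>

definition falg_act :: "(complex \<Rightarrow> 'v \<Rightarrow> 'v) \<Rightarrow> (3 \<times> 3 \<Rightarrow> 'v \<Rightarrow> 'v) \<Rightarrow> falg \<Rightarrow> 'v \<Rightarrow> 'v::ab_group_add" where
  "falg_act s D p v =
     (\<Sum>w\<in>Poly_Mapping.keys p. s (Poly_Mapping.lookup p w) (foldr D (letters w) v))"

lemma poly_mapping_single_induct:
  fixes p :: "'a \<Rightarrow>\<^sub>0 'b::monoid_add"
  assumes "P 0" and "\<And>w c p. P p \<Longrightarrow> P (Poly_Mapping.single w c + p)"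
  shows "P p"
proof (induction p rule: update_induct)
  case (update f a b)
  have "Poly_Mapping.update a b f = Poly_Mapping.single a b + f"
    using update(1) by (intro poly_mapping_eqI)
      (auto simp: lookup_update lookup_add lookup_single in_keys_iff)
  with update assms(2) show ?case
    by simp
qed (rule assms(1))

locale gl3_module = vector_space s
  for s :: "complex \<Rightarrow> 'v \<Rightarrow> 'v::ab_group_add" +
  fixes D :: "3 \<times> 3 \<Rightarrow> 'v \<Rightarrow> 'v"
  assumes D_add: "D x (v + w) = D x v + D x w"
    and D_scale: "D x (s c v) = s c (D x v)"
    and D_bracket: "D (i, j) (D (k, l) v) - D (k, l) (D (i, j) v)
       = (if j = k then D (i, l) v else 0) - (if l = i then D (k, j) v else 0)"
begin

abbreviation act :: "falg \<Rightarrow> 'v \<Rightarrow> 'v" where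
  "act \<equiv> falg_act s D"

lemma act_superset:
  assumes "finite A" "Poly_Mapping.keys p \<subseteq> A"
  shows "act p v = (\<Sum>w\<in>A. s (Poly_Mapping.lookup p w) (foldr D (letters w) v))"
  unfolding falg_act_def using assms
  by (intro sum.mono_neutral_left) (auto simp: in_keys_iff)

lemma act_zero [simp]: "act 0 v = 0"
  by (simp add: falg_act_def)

lemma act_add: "act (p + q) v = act p v + act q v"
proof -
  let ?A = "Poly_Mapping.keys p \<union> Poly_Mapping.keys q"
  have "Poly_Mapping.keys (p + q) \<subseteq> ?A"
    by (rule keys_add)
  then show ?thesis
    by (simp add: act_superset[of ?A] lookup_add scale_left_distrib sum.distrib)
qed

lemma act_diff: "act (p - q) v = act p v - act q v"
  using act_add[of "p - q" q v] by simp

lemma act_single: "act (Poly_Mapping.single w c) v = s c (foldr D (letters w) v)"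
  by (cases "c = 0") (simp_all add: falg_act_def)

lemma foldr_add: "foldr D xs (v + w) = foldr D xs v + foldr D xs w"
  by (induction xs) (simp_all add: D_add)

lemma foldr_scale: "foldr D xs (s c v) = s c (foldr D xs v)"
  by (induction xs) (simp_all add: D_scale)

lemma act_arg_add: "act p (v + w) = act p v + act p w"
  by (simp add: falg_act_def foldr_add scale_right_distrib sum.distrib)

lemma act_arg_scale: "act p (s c v) = s c (act p v)"
  by (simp add: falg_act_def foldr_scale scale_sum_right mult.commute)

lemma act_arg_zero [simp]: "act p 0 = 0"
  using act_arg_scale[of p 0 0] by simp

lemma act_mult: "act (p * q) v = act p (act q v)"
proof (induction p rule: poly_mapping_single_induct)
  case (2 w c p)
  have "act (Poly_Mapping.single w c * q) v = act (Poly_Mapping.single w c) (act q v)"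
  proof (induction q rule: poly_mapping_single_induct)
    case (2 w' c' q)
    then show ?case
      by (simp add: distrib_left act_add act_arg_add mult_single act_single foldr_scale)
  qed simp
  with 2 show ?case
    by (simp add: distrib_right act_add)
qed simp

lemma act_gen: "act (gen i j) v = D (i, j) v"
  by (simp add: gen_def act_single)

lemma act_gl3_rel: "act (gl3_rel i j k l) v = 0"
  using D_bracket[of i j k l v]
  by (simp add: gl3_rel_def act_diff act_mult act_gen split: if_splits)

lemma act_ideal: "p \<in> gl3_ideal \<Longrightarrow> act p v = 0"
  by (induction rule: gl3_ideal.induct) (simp_all add: act_add act_mult act_gl3_rel)

lemma act_respects: "ueq p q \<Longrightarrow> act p = act q"
  using act_ideal[of "p - q"] by (auto simp: ueq_def act_diff)

end

subsection \<open>The adjoint representation of the enveloping algebra on itself\<close>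

lemma falg_scalar_commute: "Poly_Mapping.single 0 c * p = p * Poly_Mapping.single 0 c" for p :: falg
  by (induction p rule: poly_mapping_single_induct)
     (simp_all add: distrib_left distrib_right mult_single mult.commute)

lemma scaleU_mult_left: "scaleU c u * v = scaleU c (u * v)"
  by transfer (simp add: ueq_def gl3_ideal.zero mult.assoc)

lemma scaleU_mult_right: "u * scaleU c v = scaleU c (u * v)"
  by transfer (simp add: ueq_def gl3_ideal.zero falg_scalar_commute mult.assoc)

definition adE :: "3 \<times> 3 \<Rightarrow> ugl3 \<Rightarrow> ugl3" where
  "adE = (\<lambda>(i, j) u. E i j * u - u * E i j)"

interpretation ad: gl3_module scaleU adE
proof
  fix i j k l and v :: ugl3
  have "adE (i, j) (adE (k, l) v) - adE (k, l) (adE (i, j) v)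
      = (E i j * E k l - E k l * E i j) * v - v * (E i j * E k l - E k l * E i j)"
    by (simp add: adE_def algebra_simps)
  also have "\<dots> = (if j = k then adE (i, l) v else 0) - (if l = i then adE (k, j) v else 0)"
    by (simp add: E_bracket adE_def algebra_simps)
  finally show "adE (i, j) (adE (k, l) v) - adE (k, l) (adE (i, j) v)
      = (if j = k then adE (i, l) v else 0) - (if l = i then adE (k, j) v else 0)" .
qed (auto simp: adE_def algebra_simps scaleU_mult_left scaleU_mult_right ugl3.scale_right_diff_distrib)

lift_definition adU :: "ugl3 \<Rightarrow> ugl3 \<Rightarrow> ugl3" is "falg_act scaleU adE"
  by (rule ad.act_respects)

subsection \<open>The module \<open>S\<^sup>\<alpha>(V)\<close>\<close>

text \<open>
  A formal monomial with complex exponents is given by its exponent vector \<open>k :: complex ^ 3\<close>;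
  linear combinations of monomials are finitely supported functions of \<open>k\<close>.
\<close>

type_synonym monspace = "(complex ^ 3) \<Rightarrow>\<^sub>0 complex"

definition scaleS :: "complex \<Rightarrow> monspace \<Rightarrow> monspace" where
  "scaleS c v = Poly_Mapping.map ((*) c) v"

text \<open>The operator \<open>x\<^sub>i \<partial>/\<partial>x\<^sub>j\<close>.\<close>

definition xd :: "3 \<Rightarrow> 3 \<Rightarrow> monspace \<Rightarrow> monspace" where
  "xd i j v = (\<Sum>k\<in>Poly_Mapping.keys v.
     Poly_Mapping.single (k - axis j 1 + axis i 1) (Poly_Mapping.lookup v k * k $ j))"

lemma scaleS_conv_mult: "scaleS c v = Poly_Mapping.single 0 c * v"
  by (simp add: scaleS_def mult_map_scale_conv_mult)

lemma xd_superset: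
  assumes "finite A" "Poly_Mapping.keys v \<subseteq> A"
  shows "xd i j v = (\<Sum>k\<in>A.
     Poly_Mapping.single (k - axis j 1 + axis i 1) (Poly_Mapping.lookup v k * k $ j))"
  unfolding xd_def using assms
  by (intro sum.mono_neutral_left) (auto simp: in_keys_iff)

lemma xd_add: "xd i j (v + w) = xd i j v + xd i j w"
proof -
  let ?A = "Poly_Mapping.keys v \<union> Poly_Mapping.keys w"
  have "Poly_Mapping.keys (v + w) \<subseteq> ?A"
    by (rule keys_add)
  then show ?thesis
    by (simp add: xd_superset[of ?A] lookup_add single_add distrib_right sum.distrib)
qed

lemma xd_zero [simp]: "xd i j 0 = 0"
  by (simp add: xd_def)

lemma xd_single:
  "xd i j (Poly_Mapping.single k c) = Poly_Mapping.single (k - axis j 1 + axis i 1) (c * k $ j)"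
  by (cases "c = 0") (simp_all add: xd_def)

lemma xd_scale: "xd i j (scaleS c v) = scaleS c (xd i j v)"
  by (induction v rule: poly_mapping_single_induct)
     (simp_all add: scaleS_conv_mult distrib_left xd_add xd_single mult_single mult.assoc)

lemma xd_bracket:
  "xd i j (xd k l v) - xd k l (xd i j v)
     = (if j = k then xd i l v else 0) - (if l = i then xd k j v else 0)"
proof (induction v rule: poly_mapping_single_induct)
  case (2 m c p)
  have key: "m - axis l 1 + axis k 1 - axis j 1 + axis i 1 = m - axis j 1 + axis i 1 - axis l 1 + axis k 1"
    by simp
  have "xd i j (xd k l (Poly_Mapping.single m c)) - xd k l (xd i j (Poly_Mapping.single m c))
     = (if j = k then xd i l (Poly_Mapping.single m c) else 0)
       - (if l = i then xd k j (Poly_Mapping.single m c) else 0)"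
    unfolding xd_single key single_diff[symmetric]
    by (cases "j = k"; cases "l = i"; cases "j = l"; cases "k = i")
       (auto simp: axis_def algebra_simps single_uminus simp flip: single_diff single_add)
  then have "xd i j (xd k l (Poly_Mapping.single m c + p)) - xd k l (xd i j (Poly_Mapping.single m c + p))
     = ((if j = k then xd i l (Poly_Mapping.single m c) else 0)
         - (if l = i then xd k j (Poly_Mapping.single m c) else 0))
       + ((if j = k then xd i l p else 0) - (if l = i then xd k j p else 0))"
    unfolding 2[symmetric] by (simp add: xd_add algebra_simps)
  also have "\<dots> = (if j = k then xd i l (Poly_Mapping.single m c + p) else 0)
       - (if l = i then xd k j (Poly_Mapping.single m c + p) else 0)"
    by (cases "j = k"; cases "l = i") (simp_all add: xd_add algebra_simps)
  finally show ?case .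
qed simp

interpretation mon: gl3_module scaleS "\<lambda>(i, j). xd i j"
proof
  show "scaleS a (scaleS b x) = scaleS (a * b) x" for a b x
    by (simp add: scaleS_conv_mult mult_single flip: mult.assoc)
  show "(case x of (i, j) \<Rightarrow> xd i j) (scaleS c v) = scaleS c ((case x of (i, j) \<Rightarrow> xd i j) v)" for x c v
    by (simp add: xd_scale split: prod.split)
qed (auto simp: scaleS_conv_mult distrib_left distrib_right single_add xd_add xd_bracket)

lift_definition rep :: "ugl3 \<Rightarrow> monspace \<Rightarrow> monspace" is "falg_act scaleS (\<lambda>(i, j). xd i j)"
  by (rule mon.act_respects)

definition S_exponents :: "complex \<Rightarrow> (complex ^ 3) set" where
  "S_exponents \<alpha> = {k. k $ 1 + k $ 2 + k $ 3 = \<alpha> \<and> k $ 2 \<in> \<nat> \<and> k $ 3 \<in> \<nat> \<and> (\<alpha> \<in> \<nat> \<longrightarrow> k $ 1 \<in> \<nat>)}"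

definition S_mod :: "complex \<Rightarrow> monspace set" where
  "S_mod \<alpha> = {v. Poly_Mapping.keys v \<subseteq> S_exponents \<alpha>}"

subsection \<open>The quotient algebra\<close>

definition J_ideal :: "complex \<Rightarrow> ugl3 set" where
  "J_ideal \<alpha> = {u. \<forall>v\<in>S_mod \<alpha>. rep u v = 0}"

abbreviation U_ring :: "ugl3 ring" where
  "U_ring \<equiv> ring_of_type_algebra"

definition \<AA> :: "complex \<Rightarrow> ugl3 set ring" where
  "\<AA> \<alpha> = U_ring Quot J_ideal \<alpha>"

definition img :: "complex \<Rightarrow> ugl3 \<Rightarrow> ugl3 set" where
  "img \<alpha> u = J_ideal \<alpha> +>\<^bsub>U_ring\<^esub> u"

definition scaleA :: "complex \<Rightarrow> complex \<Rightarrow> ugl3 set \<Rightarrow> ugl3 set" where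
  "scaleA \<alpha> c u = img \<alpha> (scaleU c 1) \<otimes>\<^bsub>\<AA> \<alpha>\<^esub> u"

definition bracketA :: "complex \<Rightarrow> ugl3 set \<Rightarrow> ugl3 set \<Rightarrow> ugl3 set" where
  "bracketA \<alpha> u v = u \<otimes>\<^bsub>\<AA> \<alpha>\<^esub> v \<ominus>\<^bsub>\<AA> \<alpha>\<^esub> v \<otimes>\<^bsub>\<AA> \<alpha>\<^esub> u"

text \<open>The action induced by \<^const>\<open>adU\<close> on cosets (\<open>J_ideal \<alpha>\<close> is stable under \<open>adU z\<close>).\<close>

definition adA :: "complex \<Rightarrow> ugl3 \<Rightarrow> ugl3 set \<Rightarrow> ugl3 set" where
  "adA \<alpha> z u = (\<Union>a\<in>u. img \<alpha> (adU z a))"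

definition poly_E33 :: "complex poly \<Rightarrow> ugl3" where
  "poly_E33 f = (\<Sum>i\<le>Polynomial.degree f. scaleU (poly.coeff f i) (E 3 3 ^ i))"

definition poly_mult :: "complex \<Rightarrow> complex poly \<Rightarrow> ugl3 set \<Rightarrow> ugl3 set" where
  "poly_mult \<alpha> f u = img \<alpha> (poly_E33 f) \<otimes>\<^bsub>\<AA> \<alpha>\<^esub> u"

section \<open>Highest weight vectors\<close>

definition cartan :: "complex ^ 3 \<Rightarrow> ugl3" where
  "cartan h = (\<Sum>i\<in>UNIV. scaleU (h $ i) (E i i))"

text \<open>A weight \<open>\<nu> = \<Sum> k\<^sub>i \<epsilon>\<^sub>i\<close> is the vector of its integer coefficients \<open>\<nu> $ i = k\<^sub>i = \<nu>(E\<^sub>i\<^sub>i)\<close>.\<close>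

definition root_lattice :: "(int ^ 3) set" where
  "root_lattice = {\<nu>. (\<Sum>i\<in>UNIV. \<nu> $ i) = 0}"

definition A_plus :: "complex \<Rightarrow> ugl3 set set" where
  "A_plus \<alpha> = {u \<in> carrier (\<AA> \<alpha>). bracketA \<alpha> (img \<alpha> (E 1 2)) u = \<zero>\<^bsub>\<AA> \<alpha>\<^esub>}"

definition A_plus_wt :: "complex \<Rightarrow> int ^ 3 \<Rightarrow> ugl3 set set" where
  "A_plus_wt \<alpha> \<nu> = {u \<in> A_plus \<alpha>. \<forall>h. bracketA \<alpha> (img \<alpha> (cartan h)) u
     = scaleA \<alpha> (\<Sum>i\<in>UNIV. h $ i * of_int (\<nu> $ i)) u}"

definition Q_plus :: "complex \<Rightarrow> (int ^ 3) set" where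
  "Q_plus \<alpha> = {\<nu> \<in> root_lattice. A_plus_wt \<alpha> \<nu> \<noteq> {\<zero>\<^bsub>\<AA> \<alpha>\<^esub>}}"

text \<open>The image in the quotient of the span of all products of at most \<open>d\<close> elements of \<open>gl(3)\<close>.\<close>

definition A_filtration :: "complex \<Rightarrow> nat \<Rightarrow> ugl3 set set" where
  "A_filtration \<alpha> d =
     img \<alpha> ` ugl3.span {prod_list (map (\<lambda>(i, j). E i j) xs) |xs. length xs \<le> d}"

text \<open>
  The generator \<open>u\<^sub>\<nu>\<close>. If \<open>\<alpha>\<close> is a non-negative integer, \<open>E\<^sub>3\<^sub>3\<close> satisfies a polynomial equation on
  the weight space and a generator can be multiplied by any polynomial without common roots with
  it; the generator meant is then the one of least degree in the standard filtration. If \<open>\<alpha>\<close> is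
  not a non-negative integer, there is no condition besides being a generator.
\<close>

definition is_generator :: "complex \<Rightarrow> int ^ 3 \<Rightarrow> ugl3 set \<Rightarrow> bool" where
  "is_generator \<alpha> \<nu> u \<longleftrightarrow> u \<in> A_plus_wt \<alpha> \<nu> \<and> A_plus_wt \<alpha> \<nu> = range (\<lambda>f. poly_mult \<alpha> f u) \<and>
     (\<alpha> \<in> \<nat> \<longrightarrow> (\<exists>d. u \<in> A_filtration \<alpha> d \<and>
        (\<forall>d'<d. A_plus_wt \<alpha> \<nu> \<inter> A_filtration \<alpha> d' \<subseteq> {\<zero>\<^bsub>\<AA> \<alpha>\<^esub>})))"

section \<open>The invariant form\<close>

definition centre :: "ugl3 set" where
  "centre = {z. \<forall>u. z * u = u * z}"

definition commutator_space :: "ugl3 set" where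
  "commutator_space = ugl3.span {u * v - v * u |u v. True}"

definition sharp :: "ugl3 \<Rightarrow> ugl3" where
  "sharp u = (THE z. z \<in> centre \<and> u - z \<in> commutator_space)"

text \<open>
  The Harish-Chandra homomorphism, without \<open>\<rho>\<close>-shift: the projection of the centre to
  \<open>U(h) = S(h)\<close> along \<open>n\<^sub>- U + U n\<^sub>+\<close>. An element of \<open>S(h)\<close> is given by the coefficients of the
  monomials \<open>E\<^sub>1\<^sub>1\<^sup>a E\<^sub>2\<^sub>2\<^sup>b E\<^sub>3\<^sub>3\<^sup>c\<close>, and is evaluated as a polynomial function on the dual of \<open>h\<close>.
\<close>

type_synonym sym_h = "(nat \<times> nat \<times> nat) \<Rightarrow>\<^sub>0 complex"

definition sym_h_to_U :: "sym_h \<Rightarrow> ugl3" where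
  "sym_h_to_U P = (\<Sum>(a, b, c)\<in>Poly_Mapping.keys P.
     scaleU (Poly_Mapping.lookup P (a, b, c)) (E 1 1 ^ a * E 2 2 ^ b * E 3 3 ^ c))"

definition sym_h_eval :: "sym_h \<Rightarrow> complex ^ 3 \<Rightarrow> complex" where
  "sym_h_eval P h = (\<Sum>(a, b, c)\<in>Poly_Mapping.keys P.
     Poly_Mapping.lookup P (a, b, c) * (h $ 1 ^ a * h $ 2 ^ b * h $ 3 ^ c))"

definition harish_chandra :: "ugl3 \<Rightarrow> sym_h" where
  "harish_chandra z = (THE P. z - sym_h_to_U P \<in> ugl3.span
     ({y * u |y u. y \<in> {E 2 1, E 3 1, E 3 2}} \<union> {u * x |u x. x \<in> {E 1 2, E 1 3, E 2 3}}))"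

definition word_transpose :: "(3 \<times> 3) fword \<Rightarrow> (3 \<times> 3) fword" where
  "word_transpose w = FWord (rev (map prod.swap (letters w)))"

definition falg_transpose :: "falg \<Rightarrow> falg" where
  "falg_transpose p = (\<Sum>w\<in>Poly_Mapping.keys p.
     Poly_Mapping.single (word_transpose w) (Poly_Mapping.lookup p w))"

lemma falg_transpose_superset:
  assumes "finite A" "Poly_Mapping.keys p \<subseteq> A"
  shows "falg_transpose p = (\<Sum>w\<in>A.
     Poly_Mapping.single (word_transpose w) (Poly_Mapping.lookup p w))"
  unfolding falg_transpose_def using assms
  by (intro sum.mono_neutral_left) (auto simp: in_keys_iff)

lemma falg_transpose_zero [simp]: "falg_transpose 0 = 0"
  by (simp add: falg_transpose_def)

lemma falg_transpose_add: "falg_transpose (p + q) = falg_transpose p + falg_transpose q"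
proof -
  let ?A = "Poly_Mapping.keys p \<union> Poly_Mapping.keys q"
  have "Poly_Mapping.keys (p + q) \<subseteq> ?A"
    by (rule keys_add)
  then show ?thesis
    by (simp add: falg_transpose_superset[of ?A] lookup_add single_add sum.distrib)
qed

lemma falg_transpose_diff: "falg_transpose (p - q) = falg_transpose p - falg_transpose q"
  using falg_transpose_add[of "p - q" q] by simp

lemma falg_transpose_single:
  "falg_transpose (Poly_Mapping.single w c) = Poly_Mapping.single (word_transpose w) c"
  by (cases "c = 0") (simp_all add: falg_transpose_def)

lemma falg_transpose_mult: "falg_transpose (p * q) = falg_transpose q * falg_transpose p"
proof (induction p rule: poly_mapping_single_induct)
  case (2 w c p)
  have "falg_transpose (Poly_Mapping.single w c * q)
      = falg_transpose q * falg_transpose (Poly_Mapping.single w c)"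
  proof (induction q rule: poly_mapping_single_induct)
    case (2 w' c' q)
    have "word_transpose (w + w') = word_transpose w' + word_transpose w"
      by (simp add: word_transpose_def plus_fword_def)
    with 2 show ?case
      by (simp add: distrib_left distrib_right falg_transpose_add falg_transpose_single
          mult_single mult.commute[of c])
  qed simp
  with 2 show ?case
    by (simp add: distrib_left distrib_right falg_transpose_add)
qed simp

lemma falg_transpose_gen: "falg_transpose (gen i j) = gen j i"
  by (simp add: gen_def falg_transpose_single word_transpose_def)

lemma falg_transpose_gl3_rel: "falg_transpose (gl3_rel i j k l) = gl3_rel l k j i"
  by (simp add: gl3_rel_def falg_transpose_diff falg_transpose_mult falg_transpose_gen)

lemma falg_transpose_ideal: "p \<in> gl3_ideal \<Longrightarrow> falg_transpose p \<in> gl3_ideal"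
proof (induction rule: gl3_ideal.induct)
  case (step p a i j k l b)
  then show ?case
    using gl3_ideal.step[of "falg_transpose p" "falg_transpose b" l k j i "falg_transpose a"]
    by (simp add: falg_transpose_add falg_transpose_mult falg_transpose_gl3_rel mult.assoc)
qed (simp add: gl3_ideal.zero)

text \<open>The Chevalley involution: the linear antiautomorphism exchanging \<open>E i j\<close> and \<open>E j i\<close>.\<close>

lift_definition chevalley :: "ugl3 \<Rightarrow> ugl3" is falg_transpose
  unfolding ueq_def using falg_transpose_ideal by (fastforce simp: falg_transpose_diff)

definition formU :: "complex \<Rightarrow> ugl3 \<Rightarrow> ugl3 \<Rightarrow> complex" where
  "formU \<alpha> u v = sym_h_eval (harish_chandra (sharp (u * chevalley v))) (vector [\<alpha>, 0, 0])"

definition formA :: "complex \<Rightarrow> ugl3 set \<Rightarrow> ugl3 set \<Rightarrow> complex" where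
  "formA \<alpha> u v = (THE c. \<forall>a\<in>u. \<forall>b\<in>v. formU \<alpha> a b = c)"

definition form_plus :: "complex \<Rightarrow> ugl3 set \<Rightarrow> complex poly \<Rightarrow> complex poly \<Rightarrow> complex" where
  "form_plus \<alpha> u f g = formA \<alpha> (poly_mult \<alpha> f u) (poly_mult \<alpha> g u)"

section \<open>The polynomials\<close>

definition z31 :: ugl3 where
  "z31 = (E 1 1 - E 2 2 + 2) * E 3 1 + E 2 1 * E 3 2"

definition z23 :: ugl3 where
  "z23 = (E 1 1 - E 2 2 + 2) * E 2 3 - E 2 1 * E 1 3"

text \<open>
  The elements \<open>f\<^bsub>k,\<nu>\<^esub>(E\<^sub>3\<^sub>3) u\<^sub>\<nu>\<close>, for a family \<open>u\<close> of generators. For \<open>\<nu>(E\<^sub>3\<^sub>3) = 0\<close> both cases of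
  the definition apply; they agree only up to a constant factor that depends on the choice of
  \<open>u\<close>, so both elements are taken. The set is empty if \<open>u\<close> is not defined at the shifted weight,
  which happens only for non-negative integers \<open>\<alpha>\<close>.
\<close>

definition f_elements :: "complex \<Rightarrow> (int ^ 3 \<Rightarrow> ugl3 set) \<Rightarrow> nat \<Rightarrow> int ^ 3 \<Rightarrow> ugl3 set set" where
  "f_elements \<alpha> u k \<nu> =
     {(adA \<alpha> z31 ^^ k) (u \<mu>) |\<mu>. \<mu> = \<nu> + int k *s (axis 1 1 - axis 3 1) \<and> \<mu> \<in> Q_plus \<alpha> \<and> \<nu> $ 3 \<le> 0} \<union>
     {(adA \<alpha> z23 ^^ k) (u \<mu>) |\<mu>. \<mu> = \<nu> + int k *s (axis 3 1 - axis 2 1) \<and> \<mu> \<in> Q_plus \<alpha> \<and> \<nu> $ 3 \<ge> 0}"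

text \<open>
  If \<open>\<alpha>\<close> is a non-negative integer, the polynomial is determined by its product with \<open>u\<^sub>\<nu>\<close> only
  modulo the annihilator of \<open>u\<^sub>\<nu>\<close>; the representative of least degree is meant.
\<close>

definition represents :: "complex \<Rightarrow> ugl3 set \<Rightarrow> ugl3 set \<Rightarrow> complex poly \<Rightarrow> bool" where
  "represents \<alpha> u w f \<longleftrightarrow> poly_mult \<alpha> f u = w \<and>
     (\<alpha> \<in> \<nat> \<longrightarrow> (\<forall>g. poly_mult \<alpha> g u = w \<longrightarrow> Polynomial.degree f \<le> Polynomial.degree g))"

definition f_polys :: "complex \<Rightarrow> (int ^ 3 \<Rightarrow> ugl3 set) \<Rightarrow> nat \<Rightarrow> int ^ 3 \<Rightarrow> complex poly set" where
  "f_polys \<alpha> u k \<nu> = {f. \<exists>w\<in>f_elements \<alpha> u k \<nu>. represents \<alpha> (u \<nu>) w f}"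

definition fdiff :: "complex poly \<Rightarrow> complex \<Rightarrow> complex" where
  "fdiff f t = poly f (t + 1) - poly f t"

definition bdiff :: "complex poly \<Rightarrow> complex \<Rightarrow> complex" where
  "bdiff f t = poly f t - poly f (t - 1)"

definition F32 :: "complex \<Rightarrow> complex \<Rightarrow> complex \<Rightarrow> complex \<Rightarrow> complex \<Rightarrow> complex \<Rightarrow> complex" where
  "F32 a1 a2 a3 b1 b2 z = suminf (\<lambda>i. pochhammer a1 i * pochhammer a2 i * pochhammer a3 i
     / (pochhammer b1 i * pochhammer b2 i) * (z ^ i / fact i))"

end

theory Submission
  imports Defs "HOL-Library.Function_Algebras"
begin

text \<open>
  \<^bold>\<open>Operators.\<close> An element of \<open>U(gl(3))\<close> of weight \<open>\<nu>\<close> acts on \<open>S\<^sup>\<alpha>(V)\<close> by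
  \<open>x\<^sup>k \<mapsto> c(k) x\<^bsup>k+\<nu>\<^esup>\<close>, and the function \<open>c\<close> determines its image in the quotient algebra. A product of
  matrix units gives a product of affine functions of \<open>k\<close>, so \<open>c\<close> is polynomial, and it is divisible by
  a falling factorial in \<open>k\<^sub>i\<close> whenever the operator lowers the exponent of \<open>x\<^sub>i\<close>. Commuting with
  \<open>E\<^sub>1\<^sub>2\<close> is a first order recursion for \<open>c\<close> in \<open>k\<^sub>2\<close>; its solutions are the multiples by polynomials in
  \<open>E\<^sub>3\<^sub>3\<close> of one explicit vector \<open>std \<nu>\<close>, a product of powers of two commuting root vectors
  (\<open>hw_classification\<close>). If \<open>\<alpha>\<close> is a non-negative integer, only finitely many values of the polynomial
  are visible, and total degrees along the line \<open>k\<^sub>1 = 0\<close> recover the standard filtration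
  (\<open>filtration_degree\<close>). This gives existence and uniqueness of the generators (\<open>is_generator_iff\<close>).

  \<^bold>\<open>The Casimir element.\<close> The vector \<open>std \<mu>\<close> lies in the irreducible constituent of the adjoint
  representation with highest weight \<open>(d, 0, -d)\<close>, \<open>d = max \<mu>\<^sub>1 (-\<mu>\<^sub>2)\<close>, where the adjoint action of the
  Casimir element is the scalar \<open>2d(d + 2)\<close>. That action commutes with those of \<open>z\<^sub>3\<^sub>1\<close> and \<open>z\<^sub>2\<^sub>3\<close>, so the
  elements \<open>f\<^bsub>k,\<nu>\<^esub>(E\<^sub>3\<^sub>3)u\<^sub>\<nu>\<close> are eigenvectors, with eigenvalues that differ for different \<open>k\<close>. On
  \<open>f(E\<^sub>3\<^sub>3) std \<nu>\<close> it is a second order difference operator in \<open>f\<close> (\<open>acts_casimir\<close>), and its eigenvalue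
  equation is the difference equation of the theorem. In the Newton basis of rising factorials
  the operator is bidiagonal, so the equation becomes a two-term recursion for the coefficients, whose
  solution is the hypergeometric sum (\<open>hypergeometric_solution\<close>). The constant is not zero because the
  ladder operators never annihilate the value at the first visible point (\<open>z31_step\<close>, \<open>z23_step\<close>).

  \<^bold>\<open>The form.\<close> It is \<open>\<langle>u, v\<rangle> = \<tau>(u \<omega>(v))\<close> for a linear functional \<open>\<tau>\<close> which vanishes on commutators and on
  \<open>J\<^sup>\<alpha>\<close> and is invariant under \<open>\<omega>\<close>. Hence \<open>ad E\<^sub>i\<^sub>j\<close> and \<open>ad E\<^sub>j\<^sub>i\<close> are adjoint to each other; \<open>ad E\<^sub>i\<^sub>i\<close> and
  the Casimir operator are self-adjoint, and eigenvectors with different eigenvalues are orthogonal.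
  The first operators separate weights, the last one separates the polynomials.
  For \<open>\<tau>\<close> to exist, \<open>U(gl(3))\<close> must be the direct sum of its centre and its commutator space. This is
  complete reducibility, obtained here without representation theory: the span of the words of
  length \<open>n\<close> in the matrix units has a Hermitian form for which \<open>ad E\<^sub>i\<^sub>j\<close> and \<open>ad E\<^sub>j\<^sub>i\<close> are adjoint, so the
  Casimir operator there is a sum of operators \<open>A A\<^sup>*\<close>, its kernel is the space of invariants, and a
  polynomial in it projects every element to an invariant (\<open>central_reduction_exists\<close>). Such a
  polynomial also preserves every ideal.
\<close>

unbundle no Formal_Power_Series.fps_syntax

section \<open>The representation on monomials\<close>

lemma rep_add: "rep (u + v) x = rep u x + rep v x"
  by transfer (rule mon.act_add)
lemma rep_diff: "rep (u - v) x = rep u x - rep v x"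
  by transfer (rule mon.act_diff)
lemma rep_zero [simp]: "rep 0 x = 0"
  by transfer (rule mon.act_zero)
lemma rep_mult: "rep (u * v) x = rep u (rep v x)"
  by transfer (rule mon.act_mult)
lemma rep_E: "rep (E i j) x = xd i j x"
  by transfer (simp add: mon.act_gen)
lemma rep_arg_add: "rep u (x + y) = rep u x + rep u y"
  by transfer (rule mon.act_arg_add)
lemma rep_arg_scale: "rep u (scaleS c x) = scaleS c (rep u x)"
  by transfer (rule mon.act_arg_scale)
lemma rep_arg_zero [simp]: "rep u 0 = 0"
  by transfer (rule mon.act_arg_zero)
lemma rep_scaleU: "rep (scaleU c u) x = scaleS c (rep u x)"
  by transfer (simp add: mon.act_mult mon.act_single)
lemma rep_one [simp]: "rep 1 x = x"
  by transfer (simp add: mon.act_single flip: single_one)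

lemma adU_add: "adU (u + v) x = adU u x + adU v x"
  by transfer (rule ad.act_add)
lemma adU_diff: "adU (u - v) x = adU u x - adU v x"
  by transfer (rule ad.act_diff)
lemma adU_mult: "adU (u * v) x = adU u (adU v x)"
  by transfer (rule ad.act_mult)
lemma adU_E: "adU (E i j) x = adE (i, j) x"
  by transfer (simp add: ad.act_gen)
lemma adU_arg_add: "adU u (x + y) = adU u x + adU u y"
  by transfer (rule ad.act_arg_add)
lemma adU_arg_scale: "adU u (scaleU c x) = scaleU c (adU u x)"
  by transfer (rule ad.act_arg_scale)
lemma adU_arg_zero [simp]: "adU u 0 = 0"
  by transfer (rule ad.act_arg_zero)
lemma adU_scaleU: "adU (scaleU c u) x = scaleU c (adU u x)"
  by transfer (simp add: ad.act_mult ad.act_single)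
lemma adU_one [simp]: "adU 1 x = x"
  by transfer (simp add: ad.act_single flip: single_one)
lemma adU_zero [simp]: "adU 0 x = 0"
  by transfer (rule ad.act_zero)

definition word :: "(3 \<times> 3) list \<Rightarrow> ugl3" where
  "word w = prod_list (map (\<lambda>(i, j). E i j) w)"

lemma word_simps [simp]: "word [] = 1" "word ((i, j) # w) = E i j * word w" "word (v @ w) = word v * word w"
  by (simp_all add: word_def)

text \<open>
  Words in the free algebra and products of matrix units correspond, so every statement about the
  quotient type can be proved by induction over sums of words.
\<close>

lemma gen_word: "abs_ugl3 (Poly_Mapping.single (FWord w) c) = scaleU c (word w)"
proof (induction w)
  case Nil
  have "scaleU c 1 = abs_ugl3 (Poly_Mapping.single 0 c * 1)"
    unfolding one_ugl3_def by (simp add: scaleU.abs_eq)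
  then show ?case by (simp add: zero_fword_def)
next
  case (Cons x w)
  obtain i j where x: "x = (i, j)" by fastforce
  have "Poly_Mapping.single (FWord (x # w)) c = gen i j * Poly_Mapping.single (FWord w) c"
    by (simp add: gen_def mult_single x plus_fword_def)
  then have "abs_ugl3 (Poly_Mapping.single (FWord (x # w)) c)
     = E i j * abs_ugl3 (Poly_Mapping.single (FWord w) c)"
    by (simp add: E.abs_eq times_ugl3.abs_eq)
  with Cons x show ?case by (simp add: scaleU_mult_right)
qed

lemma ugl3_induct [case_names zero add]:
  assumes "P 0" "\<And>w c u. P u \<Longrightarrow> P (scaleU c (word w) + u)"
  shows "P u"
proof -
  have "P (abs_ugl3 p)" for p
  proof (induction p rule: poly_mapping_single_induct)
    case 1 then show ?case using assms(1) by (simp add: zero_ugl3_def)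
  next
    case (2 w c p)
    obtain v where "w = FWord v" by (cases w)
    with 2 assms(2)[of "abs_ugl3 p" c v] show ?case
      by (simp add: gen_word[symmetric] plus_ugl3.abs_eq)
  qed
  then show ?thesis by (metis Quotient_abs_rep Quotient_ugl3)
qed

lemma span_words: "ugl3.span (range word) = UNIV"
proof -
  have "u \<in> ugl3.span (range word)" for u
    by (induction u rule: ugl3_induct)
       (simp_all add: ugl3.span_add ugl3.span_scale ugl3.span_base ugl3.span_zero)
  then show ?thesis by auto
qed

lemma ugl3_word_expansion: "\<exists>W a. finite W \<and> u = (\<Sum>w\<in>W. scaleU (a w) (word w))"
proof -
  have "u \<in> ugl3.span (range word)" by (simp add: span_words)
  then obtain S r where S: "finite S" "S \<subseteq> range word" "u = (\<Sum>x\<in>S. scaleU (r x) x)"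
    unfolding ugl3.span_explicit by blast
  then obtain g where g: "\<And>x. x \<in> S \<Longrightarrow> word (g x) = x" by (metis f_inv_into_f subset_eq)
  have inj: "inj_on g S" by (metis g inj_onI)
  have "u = (\<Sum>w\<in>g ` S. scaleU (r (word w)) (word w))"
    unfolding S(3) by (subst sum.reindex[OF inj]) (simp add: g)
  then show ?thesis using S(1) by (intro exI[of _ "g ` S"] exI) auto
qed

subsection \<open>The quotient algebra as classes of elements\<close>

text \<open>
  An exponent that would leave the grid belongs to a term whose coefficient
  \<open>k\<^sub>j\<close> is zero; this is what makes the truncated monomial space a submodule.
\<close>

lemma xd_S_mod: assumes "v \<in> S_mod \<alpha>" shows "xd i j v \<in> S_mod \<alpha>"
proof -
  have *: "Poly_Mapping.keys (Poly_Mapping.single (k - axis j 1 + axis i 1) (c * k $ j)) \<subseteq> S_exponents \<alpha>"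
    if k: "k \<in> S_exponents \<alpha>" for k c
  proof (cases "k $ j = 0 \<or> i = j")
    case True then show ?thesis using k by auto
  next
    case False
    have dec: "x - 1 \<in> \<nat>" if "x \<in> \<nat>" "x \<noteq> 0" for x :: complex
      using that by (metis Nats_cases Nats_1 Nats_diff of_nat_0 of_nat_1 of_nat_in_Nats One_nat_def Suc_leI gr0I of_nat_diff)
    have "k - axis j 1 + axis i 1 \<in> S_exponents \<alpha>"
      using k False unfolding S_exponents_def
      using exhaust_3[of i] exhaust_3[of j]
      by (auto simp: axis_def algebra_simps dec)
    then show ?thesis by auto
  qed
  have "Poly_Mapping.keys (xd i j v) \<subseteq> (\<Union>k\<in>Poly_Mapping.keys v. Poly_Mapping.keys (Poly_Mapping.single (k - axis j 1 + axis i 1) (Poly_Mapping.lookup v k * k $ j)))"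
    unfolding xd_def by (rule keys_sum)
  also have "\<dots> \<subseteq> S_exponents \<alpha>" using * assms unfolding S_mod_def by blast
  finally show ?thesis by (simp add: S_mod_def)
qed

lemma S_mod_zero [simp]: "0 \<in> S_mod \<alpha>" by (simp add: S_mod_def)
lemma S_mod_add: "v \<in> S_mod \<alpha> \<Longrightarrow> w \<in> S_mod \<alpha> \<Longrightarrow> v + w \<in> S_mod \<alpha>"
  using keys_add[of v w] by (auto simp: S_mod_def)
lemma S_mod_scale: "v \<in> S_mod \<alpha> \<Longrightarrow> scaleS c v \<in> S_mod \<alpha>"
  by (auto simp: S_mod_def scaleS_def in_keys_iff map.rep_eq when_def subset_eq split: if_splits)
lemma S_mod_single: "Poly_Mapping.single k c \<in> S_mod \<alpha> \<longleftrightarrow> c = 0 \<or> k \<in> S_exponents \<alpha>"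
  by (auto simp: S_mod_def)

lemma rep_S_mod: "v \<in> S_mod \<alpha> \<Longrightarrow> rep u v \<in> S_mod \<alpha>"
proof (induction u rule: ugl3_induct)
  case (add w c u)
  have "rep (word w) v \<in> S_mod \<alpha>"
    using add.prems by (induction w) (auto simp: rep_mult rep_E xd_S_mod)
  with add show ?case by (simp add: rep_add rep_scaleU S_mod_add S_mod_scale)
qed simp

lemma J_iff: "u \<in> J_ideal \<alpha> \<longleftrightarrow> (\<forall>k\<in>S_exponents \<alpha>. rep u (Poly_Mapping.single k 1) = 0)"
proof
  assume h: "\<forall>k\<in>S_exponents \<alpha>. rep u (Poly_Mapping.single k 1) = 0"
  have "Poly_Mapping.keys v \<subseteq> S_exponents \<alpha> \<Longrightarrow> rep u v = 0" for v
  proof (induction v rule: update_induct)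
    case (update f a b)
    have e: "Poly_Mapping.update a b f = scaleS b (Poly_Mapping.single a 1) + f"
      using update(1) by (intro poly_mapping_eqI)
        (auto simp: scaleS_conv_mult mult_single lookup_update lookup_add lookup_single in_keys_iff)
    have "Poly_Mapping.keys (Poly_Mapping.update a b f) = insert a (Poly_Mapping.keys f)"
      using update by (auto simp: in_keys_iff lookup_update split: if_splits)
    with update h show ?case by (simp add: e rep_arg_add rep_arg_scale)
  qed simp
  then show "u \<in> J_ideal \<alpha>" by (simp add: J_ideal_def S_mod_def)
qed (auto simp: J_ideal_def S_mod_single)

lemma J_zero [simp]: "0 \<in> J_ideal \<alpha>" by (simp add: J_ideal_def)
lemma J_add: "u \<in> J_ideal \<alpha> \<Longrightarrow> v \<in> J_ideal \<alpha> \<Longrightarrow> u + v \<in> J_ideal \<alpha>"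
  by (simp add: J_ideal_def rep_add)
lemma J_diff: "u \<in> J_ideal \<alpha> \<Longrightarrow> v \<in> J_ideal \<alpha> \<Longrightarrow> u - v \<in> J_ideal \<alpha>"
  by (simp add: J_ideal_def rep_diff)
lemma J_uminus: "u \<in> J_ideal \<alpha> \<Longrightarrow> - u \<in> J_ideal \<alpha>"
  using J_diff[of 0 \<alpha> u] by simp
lemma J_lmult: "u \<in> J_ideal \<alpha> \<Longrightarrow> v * u \<in> J_ideal \<alpha>"
  by (simp add: J_ideal_def rep_mult)
lemma J_rmult: "u \<in> J_ideal \<alpha> \<Longrightarrow> u * v \<in> J_ideal \<alpha>"
  by (simp add: J_ideal_def rep_mult rep_S_mod)
lemma J_scale: "u \<in> J_ideal \<alpha> \<Longrightarrow> scaleU c u \<in> J_ideal \<alpha>"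
  by (simp add: J_ideal_def rep_scaleU)

lemma adE_J: "u \<in> J_ideal \<alpha> \<Longrightarrow> adE x u \<in> J_ideal \<alpha>"
  by (cases x) (simp add: adE_def J_diff J_lmult J_rmult)

lemma adU_word_in:
  assumes "\<And>x v. v \<in> S \<Longrightarrow> adE x v \<in> S" "u \<in> S"
  shows "adU (word w) u \<in> S"
  using assms by (induction w) (auto simp: adU_mult adU_E)

lemma adU_J: "u \<in> J_ideal \<alpha> \<Longrightarrow> adU z u \<in> J_ideal \<alpha>"
proof (induction z rule: ugl3_induct)
  case (add w c z)
  then show ?case using adU_word_in[of "J_ideal \<alpha>" u w] by (simp add: adU_add adU_scaleU J_add J_scale adE_J)
qed simp

lemma U_ring_simps [simp]:
  "carrier (U_ring :: ugl3 ring) = UNIV" "x \<oplus>\<^bsub>U_ring\<^esub> y = x + y" "x \<otimes>\<^bsub>U_ring\<^esub> y = x * (y::ugl3)"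
  "\<zero>\<^bsub>U_ring\<^esub> = (0::ugl3)" "\<one>\<^bsub>U_ring\<^esub> = (1::ugl3)"
  by (simp_all add: ring_of_type_algebra_def)

lemma U_ring_is_ring: "ring (U_ring :: ugl3 ring)"
proof -
  have "\<exists>y. x + y = 0" for x :: ugl3 using add.right_inverse by blast
  then show ?thesis
    unfolding ring_of_type_algebra_def using add.right_inverse
    by unfold_locales (auto simp:algebra_simps Units_def)
qed

lemma J_ideal_ideal: "ideal (J_ideal \<alpha>) U_ring"
proof -
  interpret ring "U_ring :: ugl3 ring" by (rule U_ring_is_ring)
  have m: "\<ominus>\<^bsub>U_ring\<^esub> x = - x" for x :: ugl3
    by (rule minus_equality) auto
  show ?thesis
  proof (rule idealI[OF U_ring_is_ring])
    show "subgroup (J_ideal \<alpha>) (add_monoid U_ring)"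
      by (rule add.subgroupI) (auto simp: J_add m J_uminus simp flip: a_inv_def intro: J_zero)
  qed (auto simp: J_lmult J_rmult)
qed

lemma img_conv: "img \<alpha> u = {v. v - u \<in> J_ideal \<alpha>}"
proof -
  have "v \<in> img \<alpha> u \<longleftrightarrow> v - u \<in> J_ideal \<alpha>" for v
    unfolding img_def a_r_coset_def' by (auto intro: bexI[of _ "v - u"])
  then show ?thesis by auto
qed

lemma in_img: "v \<in> img \<alpha> u \<longleftrightarrow> v - u \<in> J_ideal \<alpha>"
  by (simp add: img_conv)

lemma img_eq_iff: "img \<alpha> u = img \<alpha> v \<longleftrightarrow> u - v \<in> J_ideal \<alpha>"
proof
  assume "img \<alpha> u = img \<alpha> v"
  moreover have "u \<in> img \<alpha> u" by (simp add: in_img)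
  ultimately show "u - v \<in> J_ideal \<alpha>" by (simp add: in_img)
next
  assume h: "u - v \<in> J_ideal \<alpha>"
  have "x - v \<in> J_ideal \<alpha> \<longleftrightarrow> x - u \<in> J_ideal \<alpha>" for x
    using J_add[OF h, of "x - u"] J_diff[OF _ h, of "x - v"] by auto
  then show "img \<alpha> u = img \<alpha> v" by (auto simp: img_conv)
qed

lemma carrier_A: "carrier (\<AA> \<alpha>) = range (img \<alpha>)"
  by (auto simp: \<AA>_def FactRing_def A_RCOSETS_def' img_def)

lemma A_mult: "img \<alpha> u \<otimes>\<^bsub>\<AA> \<alpha>\<^esub> img \<alpha> v = img \<alpha> (u * v)"
  using ideal.rcoset_mult_add[OF J_ideal_ideal, of u v \<alpha>] by (simp add: \<AA>_def FactRing_def img_def)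

lemma A_add: "img \<alpha> u \<oplus>\<^bsub>\<AA> \<alpha>\<^esub> img \<alpha> v = img \<alpha> (u + v)"
proof -
  interpret ideal "J_ideal \<alpha>" U_ring by (rule J_ideal_ideal)
  show ?thesis using a_rcos_sum[of u v] by (simp add: \<AA>_def FactRing_def img_def)
qed

lemma A_zero: "\<zero>\<^bsub>\<AA> \<alpha>\<^esub> = img \<alpha> 0"
  by (simp add: \<AA>_def FactRing_def img_conv)

lemma A_minus: "img \<alpha> u \<ominus>\<^bsub>\<AA> \<alpha>\<^esub> img \<alpha> v = img \<alpha> (u - v)"
proof -
  interpret A: ring "\<AA> \<alpha>"
    unfolding \<AA>_def by (rule ideal.quotient_is_ring[OF J_ideal_ideal])
  have "\<ominus>\<^bsub>\<AA> \<alpha>\<^esub> img \<alpha> v = img \<alpha> (- v)"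
    by (rule A.minus_equality) (auto simp: A_add A_zero carrier_A)
  then show ?thesis by (simp add: a_minus_def A_add)
qed

lemma scaleA_img: "scaleA \<alpha> c (img \<alpha> u) = img \<alpha> (scaleU c u)"
  by (simp add: scaleA_def A_mult scaleU_mult_left)

lemma bracketA_img: "bracketA \<alpha> (img \<alpha> u) (img \<alpha> v) = img \<alpha> (u * v - v * u)"
  by (simp add: bracketA_def A_mult A_minus)

lemma poly_mult_img: "poly_mult \<alpha> f (img \<alpha> u) = img \<alpha> (poly_E33 f * u)"
  by (simp add: poly_mult_def A_mult)

text \<open>
  The union in the definition runs over all representatives; it collapses to one class because the
  annihilator is stable under the adjoint action.
\<close>

lemma adA_img: "adA \<alpha> z (img \<alpha> u) = img \<alpha> (adU z u)"
proof -
  have "img \<alpha> (adU z a) = img \<alpha> (adU z u)" if "a \<in> img \<alpha> u" for a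
  proof -
    have "adU z (a - u) \<in> J_ideal \<alpha>" using that by (simp add: in_img adU_J)
    moreover have "adU z a = adU z (a - u) + adU z u" by (simp flip: adU_arg_add)
    ultimately show ?thesis by (simp add: img_eq_iff)
  qed
  moreover have "u \<in> img \<alpha> u" by (simp add: in_img)
  ultimately show ?thesis unfolding adA_def by blast
qed

lemma adA_pow_img: "(adA \<alpha> z ^^ k) (img \<alpha> u) = img \<alpha> ((adU z ^^ k) u)"
  by (induction k) (simp_all add: adA_img)

section \<open>Splitting off the centre\<close>

subsection \<open>Fitting decomposition of a positive operator\<close>

lemma function_vector_space: "vector_space (\<lambda>c (g :: 'i \<Rightarrow> complex) x. c * g x)"
  by unfold_locales (auto simp: fun_eq_iff algebra_simps)

lemma sum_fun_apply: "sum f A x = (\<Sum>a\<in>A. f a x :: complex)"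
  by (induction A rule: infinite_finite_induct) auto

text \<open>
  The iterates \<open>g, T g, T\<^sup>2 g, \<dots>\<close> lie in the span of the finitely many
  indicator functions of points of \<open>I\<close>.
\<close>

lemma orbit_dependent:
  fixes T :: "('i \<Rightarrow> complex) \<Rightarrow> 'i \<Rightarrow> complex"
  assumes I: "finite I" and supp: "\<And>n v. v \<notin> I \<Longrightarrow> (T ^^ n) g v = 0"
  shows "\<exists>a N. (\<exists>i\<le>N. a i \<noteq> 0) \<and> (\<forall>v. (\<Sum>i\<le>N. a i * (T ^^ i) g v) = 0)"
proof -
  interpret vs: vector_space "\<lambda>c (g :: 'i \<Rightarrow> complex) x. c * g x"
    by (rule function_vector_space)
  define N where "N = card I"
  define e :: "'i \<Rightarrow> 'i \<Rightarrow> complex" where "e v w = (if v = w then 1 else 0)" for v w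
  let ?P = "\<lambda>n. (T ^^ n) g"
  show ?thesis
  proof (cases "inj_on ?P {..N}")
    case True
    have "?P n \<in> vs.span (e ` I)" for n
    proof -
      have "?P n = (\<Sum>v\<in>I. (\<lambda>w. ?P n v * e v w))"
        using supp[of _ n] I by (auto simp: fun_eq_iff e_def sum_fun_apply if_distrib sum.delta cong: if_cong)
      also have "\<dots> \<in> vs.span (e ` I)"
        by (intro vs.span_sum vs.span_scale vs.span_base) auto
      finally show ?thesis .
    qed
    then have sub: "?P ` {..N} \<subseteq> vs.span (e ` I)" by auto
    have "card (?P ` {..N}) = Suc N" using True by (simp add: card_image)
    moreover have "card (e ` I) \<le> N" unfolding N_def by (rule card_image_le[OF I])
    ultimately have "vs.dependent (?P ` {..N})"
      using vs.independent_span_bound[of "e ` I" "?P ` {..N}"] sub I by fastforce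
    then obtain t u where t: "finite t" "t \<subseteq> ?P ` {..N}" "(\<Sum>v\<in>t. (\<lambda>x. u v * v x)) = 0"
      "\<exists>v\<in>t. u v \<noteq> 0"
      unfolding vs.dependent_explicit by blast
    define a where "a i = (if ?P i \<in> t then u (?P i) else 0)" for i
    have "(\<Sum>i\<le>N. a i * ?P i x) = 0" for x
    proof -
      have "(\<Sum>i\<le>N. a i * ?P i x) = (\<Sum>v\<in>?P ` {..N}. (if v \<in> t then u v else 0) * v x)"
        by (subst sum.reindex[OF True]) (simp add: a_def)
      also have "\<dots> = (\<Sum>v\<in>t. u v * v x)"
        using t(2) by (intro sum.mono_neutral_cong_right) auto
      also have "\<dots> = 0" using fun_cong[OF t(3), of x] by (simp add: sum_fun_apply)
      finally show ?thesis .
    qed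
    moreover have "\<exists>i\<le>N. a i \<noteq> 0" using t(2,4) by (fastforce simp: a_def)
    ultimately show ?thesis by blast
  next
    case False
    then obtain i j where ij: "i \<le> N" "j \<le> N" "i \<noteq> j" "?P i = ?P j"
      by (auto simp: inj_on_def)
    define a :: "nat \<Rightarrow> complex" where "a n = (if n = i then 1 else 0) - (if n = j then 1 else 0)" for n
    have "(\<Sum>n\<le>N. a n * ?P n x) = 0" for x
    proof -
      have "(\<Sum>n\<le>N. a n * ?P n x) = (\<Sum>n\<le>N. (if n = i then ?P n x else 0)) - (\<Sum>n\<le>N. (if n = j then ?P n x else 0))"
        unfolding a_def sum_subtractf[symmetric] by (intro sum.cong) auto
      also have "\<dots> = 0" using ij by simp
      finally show ?thesis .
    qed
    moreover have "a i \<noteq> 0" using ij by (simp add: a_def)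
    ultimately show ?thesis using ij by blast
  qed
qed

text \<open>
  Values outside the index set are cut off, so that iterates stay in a finite-dimensional space of
  functions.
\<close>

definition matop :: "'i set \<Rightarrow> ('i \<Rightarrow> 'i \<Rightarrow> complex) \<Rightarrow> ('i \<Rightarrow> complex) \<Rightarrow> 'i \<Rightarrow> complex" where
  "matop I m g v = (if v \<in> I then \<Sum>w\<in>I. m v w * g w else 0)"

lemma matop_sum: "matop I m (\<lambda>v. \<Sum>i\<in>A. a i * f i v) = (\<lambda>v. \<Sum>i\<in>A. a i * matop I m (f i) v)"
proof
  fix v
  have "(\<Sum>w\<in>I. m v w * (\<Sum>i\<in>A. a i * f i w)) = (\<Sum>i\<in>A. a i * (\<Sum>w\<in>I. m v w * f i w))"
    by (simp add: sum_distrib_left mult.left_commute) (rule sum.swap)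
  then show "matop I m (\<lambda>v. \<Sum>i\<in>A. a i * f i v) v = (\<Sum>i\<in>A. a i * matop I m (f i) v)"
    by (simp add: matop_def)
qed

lemma matop_pow_sum: "(matop I m ^^ n) (\<lambda>v. \<Sum>i\<in>A. a i * f i v) = (\<lambda>v. \<Sum>i\<in>A. a i * (matop I m ^^ n) (f i) v)"
  by (induction n) (simp_all add: matop_sum)

lemma sum_norm_eq_0:
  assumes "finite I" "(\<Sum>v\<in>I. f v * cnj (f v)) = 0" "v \<in> I"
  shows "f v = (0 :: complex)"
proof -
  have "of_real (\<Sum>v\<in>I. (norm (f v))^2) = (\<Sum>v\<in>I. f v * cnj (f v))"
    by (simp add: complex_norm_square[symmetric] flip: of_real_power)
  then have "(\<Sum>v\<in>I. (norm (f v))^2) = 0" using assms(2) by (metis of_real_eq_0_iff)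
  then have "(norm (f v))^2 = 0" using assms(1,3) by (subst (asm) sum_nonneg_eq_0_iff) auto
  then show ?thesis by simp
qed

text \<open>
  For a Hermitian \<open>T\<close>, \<open>\<parallel>T\<^sup>n h\<parallel>\<^sup>2 =
  \<langle>T\<^bsup>n+1\<^esup> h, T\<^bsup>n-1\<^esup> h\<rangle>\<close>, so the exponent in
  \<open>T\<^sup>n h = 0\<close> can be lowered to one.
\<close>

lemma hermitian_pow_kernel:
  assumes I: "finite I" and herm: "\<And>v w. v \<in> I \<Longrightarrow> w \<in> I \<Longrightarrow> m w v = cnj (m v w)"
    and z: "(matop I m ^^ n) h = (\<lambda>_. 0)" "n > 0"
  shows "matop I m h = (\<lambda>_. 0)"
  using z
proof (induction n)
  case (Suc n)
  let ?T = "matop I m"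
  show ?case
  proof (cases n)
    case 0 with Suc show ?thesis by simp
  next
    case (Suc l)
    let ?f = "(?T ^^ l) h" and ?g = "(?T ^^ n) h"
    have g: "?g v = (\<Sum>w\<in>I. m v w * ?f w)" if "v \<in> I" for v
      using that by (simp add: Suc matop_def)
    have "(\<Sum>v\<in>I. ?g v * cnj (?g v)) = (\<Sum>v\<in>I. \<Sum>w\<in>I. ?g v * cnj (m v w) * cnj (?f w))"
      by (intro sum.cong refl) (simp add: g sum_distrib_left cnj_sum mult.assoc)
    also have "\<dots> = (\<Sum>w\<in>I. \<Sum>v\<in>I. ?g v * cnj (m v w) * cnj (?f w))" by (rule sum.swap)
    also have "\<dots> = (\<Sum>w\<in>I. ?T ?g w * cnj (?f w))"
    proof (intro sum.cong refl)
      fix w assume w: "w \<in> I"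
      have "?T ?g w = (\<Sum>v\<in>I. m w v * ?g v)" using w by (simp add: matop_def)
      also have "\<dots> = (\<Sum>v\<in>I. ?g v * cnj (m v w))"
        by (intro sum.cong refl) (simp add: herm[OF _ w])
      finally show "(\<Sum>v\<in>I. ?g v * cnj (m v w) * cnj (?f w)) = ?T ?g w * cnj (?f w)"
        by (simp only: sum_distrib_right)
    qed
    also have "\<dots> = 0" using Suc.prems by simp
    finally have "?g v = 0" if "v \<in> I" for v using sum_norm_eq_0[OF I] that by blast
    moreover have "?g v = 0" if "v \<notin> I" for v using that by (simp add: Suc matop_def)
    ultimately have "?g = (\<lambda>_. 0)" by blast
    then show ?thesis using Suc.IH Suc by simp
  qed
qed simp

text \<open>
  A polynomial relation \<open>p(T) g = 0\<close> factors as \<open>p = t\<^sup>k r\<close> with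
  \<open>r(0) \<noteq> 0\<close>; then \<open>T\<^sup>k\<close> kills \<open>r(T) g\<close>, and
  so does \<open>T\<close> by \<open>hermitian_pow_kernel\<close>. Dividing by \<open>r(0)\<close>
  gives a polynomial with constant term one which moves \<open>g\<close> into the kernel.
\<close>

lemma hermitian_fitting:
  assumes I: "finite I" and herm: "\<And>v w. v \<in> I \<Longrightarrow> w \<in> I \<Longrightarrow> m w v = cnj (m v w)"
    and g: "\<And>v. v \<notin> I \<Longrightarrow> g v = 0"
  shows "\<exists>c N. c 0 = 1 \<and> matop I m (\<lambda>v. \<Sum>i\<le>N. c i * (matop I m ^^ i) g v) = (\<lambda>_. 0)"
proof -
  let ?T = "matop I m"
  have supp: "(?T ^^ n) g v = 0" if "v \<notin> I" for n v
    using that g by (cases n) (auto simp: matop_def)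
  obtain a N where a: "\<exists>i\<le>N. a i \<noteq> 0" "\<And>v. (\<Sum>i\<le>N. a i * (?T ^^ i) g v) = 0"
    using orbit_dependent[OF I supp] by blast
  \<comment> \<open>The multiplicity of the root zero of the relation.\<close>
  define k where "k = (LEAST i. a i \<noteq> 0)"
  have k: "a k \<noteq> 0" "k \<le> N" and small: "\<And>i. i < k \<Longrightarrow> a i = 0"
    using a(1) LeastI[of "\<lambda>i. a i \<noteq> 0"] not_less_Least[of _ "\<lambda>i. a i \<noteq> 0"] Least_le[of "\<lambda>i. a i \<noteq> 0"]
    unfolding k_def by (blast, meson order_trans, blast)
  define c where "c i = a (k + i) / a k" for i
  define h where "h v = (\<Sum>i\<le>N - k. c i * (?T ^^ i) g v)" for v
  have "(?T ^^ k) h v = 0" for v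
  proof -
    have "(?T ^^ k) h v = (\<Sum>i\<le>N - k. c i * (?T ^^ (k + i)) g v)"
      unfolding h_def matop_pow_sum by (simp add: funpow_add)
    also have "\<dots> = (\<Sum>i\<in>{k..N}. a i * (?T ^^ i) g v) / a k"
      unfolding c_def sum_divide_distrib
      by (rule sum.reindex_bij_witness[of _ "\<lambda>i. i - k" "\<lambda>i. k + i"]) (use k in auto)
    also have "(\<Sum>i\<in>{k..N}. a i * (?T ^^ i) g v) = (\<Sum>i\<le>N. a i * (?T ^^ i) g v)"
      by (intro sum.mono_neutral_left) (auto simp: small not_le)
    finally show ?thesis by (simp add: a(2))
  qed
  then have hz: "(?T ^^ k) h = (\<lambda>_. 0)" by blast
  have "?T h = (\<lambda>_. 0)"
  proof (cases "k = 0")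
    case True
    then have "h = (\<lambda>_. 0)" using hz by simp
    then show ?thesis by (simp add: matop_def fun_eq_iff)
  next
    case False
    then show ?thesis using hermitian_pow_kernel[OF I herm hz] by simp
  qed
  moreover have "c 0 = 1" using k by (simp add: c_def)
  ultimately show ?thesis unfolding h_def by blast
qed

subsection \<open>The adjoint action on words\<close>

text \<open>
  The matrix of \<open>ad E\<^sub>x\<close> on \<open>gl(3)\<close> in the basis of matrix units:
  the coefficient of \<open>E\<^sub>p\<close> in \<open>[E\<^sub>x, E\<^sub>y]\<close>.
\<close>

definition letter_coeff :: "3 \<times> 3 \<Rightarrow> 3 \<times> 3 \<Rightarrow> 3 \<times> 3 \<Rightarrow> complex" where
  "letter_coeff x p y = (if snd x = fst y \<and> p = (fst x, snd y) then 1 else 0)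
     - (if snd y = fst x \<and> p = (fst y, snd x) then 1 else 0)"

text \<open>
  The matrix of the derivation extending \<open>ad E\<^sub>x\<close> to words of a fixed length:
  exactly one letter is changed.
\<close>

fun word_coeff :: "3 \<times> 3 \<Rightarrow> (3 \<times> 3) list \<Rightarrow> (3 \<times> 3) list \<Rightarrow> complex" where
  "word_coeff x (a # v) (b # w) =
     (if v = w then letter_coeff x a b else 0) + (if a = b then word_coeff x v w else 0)"
| "word_coeff x _ _ = 0"

lemma letter_coeff_adjoint: "letter_coeff (prod.swap x) b a = cnj (letter_coeff x a b)"
proof -
  have "(fst x = fst a \<and> b = (snd x, snd a)) = (snd x = fst b \<and> a = (fst x, snd b))"
    "(snd a = snd x \<and> b = (fst a, fst x)) = (snd b = fst x \<and> a = (fst b, snd x))"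
    by (cases a; cases b; auto)+
  then show ?thesis by (simp only: letter_coeff_def fst_swap snd_swap) simp
qed

text \<open>
  With the words as an orthonormal basis, transposition of matrix units is the Hermitian adjoint:
  \<open>gl(3)\<close> acts on tensors as a unitary representation of \<open>U(3)\<close>. The
  positivity below rests on this.
\<close>

lemma word_coeff_adjoint: "word_coeff (prod.swap x) w v = cnj (word_coeff x v w)"
  by (induction x v w rule: word_coeff.induct) (auto simp: letter_coeff_adjoint)

definition words :: "nat \<Rightarrow> (3 \<times> 3) list set" where
  "words n = {w. length w = n}"

lemma finite_words [simp]: "finite (words n)"
  using finite_lists_length_eq[of "UNIV :: (3 \<times> 3) set" n] by (simp add: words_def)

lemma words_0 [simp]: "words 0 = {[]}" by (auto simp: words_def)

lemma sum_words_Suc: "sum f (words (Suc n)) = (\<Sum>a\<in>UNIV. \<Sum>v\<in>words n. f (a # v))"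
proof -
  have "(\<Sum>a\<in>UNIV. \<Sum>v\<in>words n. f (a # v)) = (\<Sum>(a, v)\<in>UNIV \<times> words n. f (a # v))"
    by (simp add: sum.cartesian_product)
  also have "\<dots> = sum f (words (Suc n))"
    by (rule sum.reindex_bij_witness[of _ "\<lambda>w. (hd w, tl w)" "\<lambda>(a, v). a # v"])
       (auto simp: words_def length_Suc_conv)
  finally show ?thesis by simp
qed

lemma adE_mult: "adE x (u * v) = adE x u * v + u * adE x v"
  by (cases x) (simp add: adE_def algebra_simps)
lemma adE_zero [simp]: "adE x 0 = 0" by (cases x) (simp add: adE_def)
lemma adE_add: "adE x (u + v) = adE x u + adE x v" by (rule ad.D_add)
lemma adE_diff: "adE x (u - v) = adE x u - adE x v" by (cases x) (simp add: adE_def algebra_simps)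
lemma adE_scale: "adE x (scaleU c u) = scaleU c (adE x u)" by (rule ad.D_scale)
lemma adE_sum: "adE x (sum f A) = (\<Sum>a\<in>A. adE x (f a))"
  by (induction A rule: infinite_finite_induct) (auto simp: adE_add)
lemma adE_one [simp]: "adE x 1 = 0" by (cases x) (simp add: adE_def)

lemma adE_letter: "adE x (E (fst y) (snd y)) = (\<Sum>p\<in>UNIV. scaleU (letter_coeff x p y) (E (fst p) (snd p)))"
proof -
  have d: "(\<Sum>p\<in>UNIV. scaleU (if P \<and> p = q then 1 else 0) (E (fst p) (snd p))) = (if P then E (fst q) (snd q) else 0)"
    for P and q :: "3 \<times> 3"
  proof -
    have "(\<Sum>p\<in>UNIV. scaleU (if P \<and> p = q then 1 else 0) (E (fst p) (snd p)))
      = (\<Sum>p\<in>UNIV. if q = p then (if P then E (fst p) (snd p) else 0) else 0)"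
      by (rule sum.cong) simp_all
    then show ?thesis by simp
  qed
  have "adE x (E (fst y) (snd y)) = (if snd x = fst y then E (fst x) (snd y) else 0) - (if snd y = fst x then E (fst y) (snd x) else 0)"
    using E_bracket[of "fst x" "snd x" "fst y" "snd y"] by (cases x) (simp add: adE_def)
  also have "\<dots> = (\<Sum>p\<in>UNIV. scaleU (letter_coeff x p y) (E (fst p) (snd p)))"
    unfolding letter_coeff_def ugl3.scale_left_diff_distrib sum_subtractf d by simp
  finally show ?thesis .
qed

lemma adE_word: "adE x (word w) = (\<Sum>v\<in>words (length w). scaleU (word_coeff x v w) (word v))"
proof (induction w)
  case (Cons y w)
  have E: "word (a # v) = E (fst a) (snd a) * word v" for a v by (cases a) simp
  have "adE x (word (y # w)) = (\<Sum>a\<in>UNIV. scaleU (letter_coeff x a y) (E (fst a) (snd a))) * word w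
      + E (fst y) (snd y) * (\<Sum>v\<in>words (length w). scaleU (word_coeff x v w) (word v))"
    by (simp add: E adE_mult adE_letter Cons)
  also have "(\<Sum>a\<in>UNIV. scaleU (letter_coeff x a y) (E (fst a) (snd a))) * word w
     = (\<Sum>a\<in>UNIV. \<Sum>v\<in>words (length w). if w = v then scaleU (letter_coeff x a y) (word (a # v)) else 0)"
    by (simp add: sum_distrib_right scaleU_mult_left E) (simp add: E words_def)
  also have "E (fst y) (snd y) * (\<Sum>v\<in>words (length w). scaleU (word_coeff x v w) (word v))
     = (\<Sum>a\<in>UNIV. if y = a then (\<Sum>v\<in>words (length w). scaleU (word_coeff x v w) (word (a # v))) else 0)"
    by (simp add: sum_distrib_left scaleU_mult_right E)
  also have "\<dots> = (\<Sum>a\<in>UNIV. \<Sum>v\<in>words (length w). if y = a then scaleU (word_coeff x v w) (word (a # v)) else 0)"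
    by (intro sum.cong refl) auto
  finally have "adE x (word (y # w)) = (\<Sum>a\<in>UNIV. \<Sum>v\<in>words (length w).
     (if w = v then scaleU (letter_coeff x a y) (word (a # v)) else 0) +
     (if y = a then scaleU (word_coeff x v w) (word (a # v)) else 0))"
    by (simp only: sum.distrib)
  also have "\<dots> = (\<Sum>a\<in>UNIV. \<Sum>v\<in>words (length w). scaleU (word_coeff x (a # v) (y # w)) (word (a # v)))"
    by (intro sum.cong refl) (auto simp: ugl3.scale_left_distrib)
  finally show ?case by (simp add: sum_words_Suc del: word_coeff.simps)
qed simp

definition casimir :: ugl3 where
  "casimir = (\<Sum>x\<in>UNIV. E (fst x) (snd x) * E (snd x) (fst x))"

lemma adU_sum: "adU (sum f A) u = (\<Sum>a\<in>A. adU (f a) u)"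
  by (induction A rule: infinite_finite_induct) (auto simp: adU_add)

lemma adU_casimir: "adU casimir u = (\<Sum>x\<in>UNIV. adE x (adE (prod.swap x) u))"
  by (simp add: casimir_def adU_sum adU_mult adU_E prod.swap_def)

lemma prod_UNIV_3: "(\<Sum>x\<in>UNIV. f x) = (\<Sum>i\<in>(UNIV :: 3 set). \<Sum>j\<in>(UNIV :: 3 set). f (i, j))"
proof -
  have "(\<Sum>i\<in>(UNIV :: 3 set). \<Sum>j\<in>(UNIV :: 3 set). f (i, j)) = (\<Sum>(i, j)\<in>(UNIV :: 3 set) \<times> (UNIV :: 3 set). f (i, j))"
    by (rule sum.cartesian_product)
  then show ?thesis by simp
qed

text \<open>
  In the sum of the commutators the four families of quadratic terms cancel in pairs.
\<close>

lemma adE_casimir: "adE (i, j) casimir = 0"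
proof -
  have "adE (i, j) casimir = (\<Sum>k\<in>UNIV. \<Sum>l\<in>UNIV.
      adE (i, j) (E k l) * E l k + E k l * adE (i, j) (E l k))"
    by (simp add: casimir_def adE_sum adE_mult prod_UNIV_3)
  also have "\<dots> = (\<Sum>k\<in>UNIV. \<Sum>l\<in>UNIV.
      ((if j = k then E i l * E l k else 0) - (if i = l then E k j * E l k else 0))
      + ((if j = l then E k l * E i k else 0) - (if i = k then E k l * E l j else 0)))"
  proof (intro sum.cong refl)
    fix k l
    show "adE (i, j) (E k l) * E l k + E k l * adE (i, j) (E l k) =
      ((if j = k then E i l * E l k else 0) - (if i = l then E k j * E l k else 0))
      + ((if j = l then E k l * E i k else 0) - (if i = k then E k l * E l j else 0))"
      by (simp add: adE_def E_bracket algebra_simps)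
  qed
  also have "\<dots> = 0"
  proof -
    have d1: "(\<Sum>k\<in>UNIV. \<Sum>l\<in>UNIV. if m = k then f k l else 0) = (\<Sum>l\<in>UNIV. f m l)"
      for m :: 3 and f :: "3 \<Rightarrow> 3 \<Rightarrow> ugl3"
      by (subst sum.swap) simp
    have d2: "(\<Sum>k\<in>UNIV. \<Sum>l\<in>UNIV. if m = l then f k l else 0) = (\<Sum>k\<in>UNIV. f k m)"
      for m :: 3 and f :: "3 \<Rightarrow> 3 \<Rightarrow> ugl3"
      by simp
    show ?thesis unfolding sum.distrib sum_subtractf d1 d2 by simp
  qed
  finally show ?thesis .
qed


lemma adE_zero_imp_centre:
  assumes "\<And>x. adE x z = 0" shows "z \<in> centre"
proof -
  have E: "E i j * z = z * E i j" for i j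
    using assms[of "(i, j)"] by (simp add: adE_def)
  have "word w * z = z * word w" for w
  proof (induction w)
    case (Cons x w)
    obtain i j where x: "x = (i, j)" by fastforce
    have "word (x # w) * z = E i j * (word w * z)" by (simp add: x mult.assoc)
    also have "\<dots> = (E i j * z) * word w" by (simp add: Cons mult.assoc)
    also have "\<dots> = z * word (x # w)" by (simp only: E) (simp add: x mult.assoc)
    finally show ?case .
  qed simp
  then have "z * u = u * z" for u
    by (induction u rule: ugl3_induct)
       (simp_all add: distrib_left distrib_right scaleU_mult_left scaleU_mult_right)
  then show ?thesis by (simp add: centre_def)
qed

lemma centre_iff: "z \<in> centre \<longleftrightarrow> (\<forall>x. adE x z = 0)"
  using adE_zero_imp_centre by (auto simp: centre_def adE_def)

lemma centre_add: "z \<in> centre \<Longrightarrow> z' \<in> centre \<Longrightarrow> z + z' \<in> centre"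
  by (simp add: centre_iff adE_add)
lemma centre_diff: "z \<in> centre \<Longrightarrow> z' \<in> centre \<Longrightarrow> z - z' \<in> centre"
  by (simp add: centre_iff adE_diff)
lemma centre_scale: "z \<in> centre \<Longrightarrow> scaleU c z \<in> centre"
  by (simp add: centre_iff adE_scale)
lemma centre_zero [simp]: "0 \<in> centre"
  by (simp add: centre_iff)

lemma casimir_centre: "casimir \<in> centre"
  unfolding centre_iff using adE_casimir by (metis surj_pair)

lemma adU_casimir_commute: "adU casimir (adU z u) = adU z (adU casimir u)"
  using casimir_centre by (simp add: centre_def flip: adU_mult)

lemma adU_casimir_adE: "adU casimir (adE x u) = adE x (adU casimir u)"
  using adU_casimir_commute[of "E (fst x) (snd x)" u] by (simp add: adU_E)

lemma commutator_spaceI: "u * v - v * u \<in> commutator_space"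
  unfolding commutator_space_def by (intro ugl3.span_base) blast
lemma commutator_space_add: "u \<in> commutator_space \<Longrightarrow> v \<in> commutator_space \<Longrightarrow> u + v \<in> commutator_space"
  unfolding commutator_space_def by (rule ugl3.span_add)
lemma commutator_space_diff: "u \<in> commutator_space \<Longrightarrow> v \<in> commutator_space \<Longrightarrow> u - v \<in> commutator_space"
  unfolding commutator_space_def by (rule ugl3.span_diff)
lemma commutator_space_scale: "u \<in> commutator_space \<Longrightarrow> scaleU c u \<in> commutator_space"
  unfolding commutator_space_def by (rule ugl3.span_scale)
lemma commutator_space_zero [simp]: "0 \<in> commutator_space"
  unfolding commutator_space_def by (rule ugl3.span_zero)
lemma commutator_space_sum: "(\<And>i. i \<in> A \<Longrightarrow> f i \<in> commutator_space) \<Longrightarrow> sum f A \<in> commutator_space"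
  unfolding commutator_space_def by (rule ugl3.span_sum)

lemma adE_commutator_space: "adE x u \<in> commutator_space"
  by (cases x) (simp add: adE_def commutator_spaceI)

lemma adU_casimir_commutator_space: "adU casimir u \<in> commutator_space"
  by (simp add: adU_casimir commutator_space_sum adE_commutator_space)

subsection \<open>Projections to the centre\<close>

definition ad_stable :: "ugl3 set \<Rightarrow> bool" where
  "ad_stable V \<longleftrightarrow> 0 \<in> V \<and> (\<forall>u\<in>V. \<forall>v\<in>V. u + v \<in> V) \<and> (\<forall>c. \<forall>u\<in>V. scaleU c u \<in> V)
     \<and> (\<forall>x. \<forall>u\<in>V. adE x u \<in> V)"

lemma ad_stable_sum:
  assumes "ad_stable V" "\<And>i. i \<in> A \<Longrightarrow> f i \<in> V" shows "sum f A \<in> V"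
  using assms(2)
  by (induction A rule: infinite_finite_induct) (use assms(1) in \<open>auto simp: ad_stable_def\<close>)

lemma ad_stable_J: "ad_stable (J_ideal \<alpha>)"
  by (simp add: ad_stable_def J_add J_scale adE_J)

text \<open>
  The properties of an operator \<open>p(ad C)\<close>, with \<open>C\<close> the Casimir element
  and \<open>p(0) = 1\<close>, that survive composition and are needed below. Applied to an
  element which it makes central, such an operator computes the projection to the centre.
\<close>

definition central_reduction :: "(ugl3 \<Rightarrow> ugl3) \<Rightarrow> bool" where
  "central_reduction q \<longleftrightarrow>
     (\<forall>u v. q (u + v) = q u + q v) \<and> (\<forall>c u. q (scaleU c u) = scaleU c (q u)) \<and>
     (\<forall>x u. q (adE x u) = adE x (q u)) \<and>
     (\<forall>z\<in>centre. q z = z) \<and>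
     (\<forall>u. u - q u \<in> commutator_space) \<and>
     (\<forall>V. ad_stable V \<longrightarrow> (\<forall>u\<in>V. q u \<in> V))"

lemma central_reductionD:
  assumes "central_reduction q"
  shows "q (u + v) = q u + q v" "q (scaleU c u) = scaleU c (q u)" "q (adE x u) = adE x (q u)"
    "z \<in> centre \<Longrightarrow> q z = z" "u - q u \<in> commutator_space" "ad_stable V \<Longrightarrow> u \<in> V \<Longrightarrow> q u \<in> V" "q 0 = 0"
proof -
  show "q 0 = 0" using assms unfolding central_reduction_def by simp
qed (use assms in \<open>auto simp: central_reduction_def simp del: split_paired_All\<close>)

lemma central_reduction_id: "central_reduction (\<lambda>u. u)"
  by (simp add: central_reduction_def)

lemma central_reduction_comp:
  assumes p: "central_reduction p" and q: "central_reduction q"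
  shows "central_reduction (\<lambda>u. p (q u))"
proof -
  have "u - p (q u) \<in> commutator_space" for u
    using commutator_space_add[OF central_reductionD(5)[OF q, of u] central_reductionD(5)[OF p, of "q u"]] by simp
  then show ?thesis unfolding central_reduction_def
    by (simp add: central_reductionD[OF p] central_reductionD[OF q])
qed

text \<open>
  The term of degree zero is the identity, and all others are images under the Casimir operator:
  these are sums of commutators, and they vanish on the centre.
\<close>

lemma central_reduction_casimir_poly:
  assumes "c 0 = 1"
  shows "central_reduction (\<lambda>u. \<Sum>i\<le>N. scaleU (c i) ((adU casimir ^^ i) u))"
proof -
  let ?C = "adU casimir"
  have add: "(?C ^^ i) (u + v) = (?C ^^ i) u + (?C ^^ i) v" for i u v
    by (induction i) (simp_all add: adU_arg_add)
  have scale: "(?C ^^ i) (scaleU d u) = scaleU d ((?C ^^ i) u)" for i u d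
    by (induction i) (simp_all add: adU_arg_scale)
  have adE: "(?C ^^ i) (adE x u) = adE x ((?C ^^ i) u)" for i u x
    by (induction i) (simp_all add: adU_casimir_adE)
  have centre: "?C z = 0" if "z \<in> centre" for z
    using that by (simp add: adU_casimir centre_iff del: split_paired_All)
  have centre': "(?C ^^ i) z = (if i = 0 then z else 0)" if "z \<in> centre" for i z
    by (induction i) (simp_all add: centre[OF that])
  have zero: "(\<Sum>i\<le>N. f i) = f 0 + (\<Sum>i\<in>{1..N}. f i)" for f :: "nat \<Rightarrow> ugl3"
  proof -
    have "{..N} = insert 0 {1..N}" by auto
    then show ?thesis by simp
  qed
  have stable: "(?C ^^ i) u \<in> V" if "ad_stable V" "u \<in> V" for i u V
  proof (induction i)
    case (Suc i)
    then show ?case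
      using that by (auto simp: adU_casimir intro!: ad_stable_sum) (auto simp: ad_stable_def)
  qed (use that in auto)
  have comm: "u - (\<Sum>i\<le>N. scaleU (c i) ((?C ^^ i) u)) \<in> commutator_space" for u
  proof -
    have "(\<Sum>i\<in>{1..N}. scaleU (c i) ((?C ^^ i) u)) \<in> commutator_space"
    proof (intro commutator_space_sum commutator_space_scale)
      fix i assume "i \<in> {1..N}"
      then obtain l where "i = Suc l" by (cases i) auto
      then show "(?C ^^ i) u \<in> commutator_space" by (simp add: adU_casimir_commutator_space)
    qed
    then have "0 - (\<Sum>i\<in>{1..N}. scaleU (c i) ((?C ^^ i) u)) \<in> commutator_space"
      by (intro commutator_space_diff) auto
    then show ?thesis unfolding zero using assms by simp
  qed
  show ?thesis
    unfolding central_reduction_def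
  proof (intro conjI allI impI ballI)
    fix z assume "z \<in> centre"
    then show "(\<Sum>i\<le>N. scaleU (c i) ((?C ^^ i) z)) = z"
      unfolding zero using assms by (simp add: centre')
  next
    show "(\<Sum>i\<le>N. scaleU (c i) ((?C ^^ i) (scaleU d u))) = scaleU d (\<Sum>i\<le>N. scaleU (c i) ((?C ^^ i) u))" for d u
      by (simp add: scale ugl3.scale_sum_right mult.commute)
  next
    fix V u assume "ad_stable V" "u \<in> V"
    then show "(\<Sum>i\<le>N. scaleU (c i) ((?C ^^ i) u)) \<in> V"
      by (intro ad_stable_sum) (use stable in \<open>auto simp: ad_stable_def\<close>)
  qed (simp_all add: add adE comm ugl3.scale_right_distrib sum.distrib adE_sum adE_scale)
qed

text \<open>
  The map from tensors of degree \<open>n\<close> to the enveloping algebra, which intertwines the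
  two adjoint actions.
\<close>

definition word_sum :: "nat \<Rightarrow> ((3 \<times> 3) list \<Rightarrow> complex) \<Rightarrow> ugl3" where
  "word_sum n g = (\<Sum>w\<in>words n. scaleU (g w) (word w))"

lemma adE_word_sum: "adE x (word_sum n g) = word_sum n (matop (words n) (word_coeff x) g)"
proof -
  have "adE x (word_sum n g) = (\<Sum>w\<in>words n. \<Sum>v\<in>words n. scaleU (word_coeff x v w * g w) (word v))"
    unfolding word_sum_def adE_sum
  proof (intro sum.cong refl)
    fix w assume "w \<in> words n"
    then have n: "length w = n" by (simp add: words_def)
    show "adE x (scaleU (g w) (word w)) = (\<Sum>v\<in>words n. scaleU (word_coeff x v w * g w) (word v))"
      by (simp add: adE_scale adE_word n ugl3.scale_sum_right mult.commute)
  qed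
  also have "\<dots> = (\<Sum>v\<in>words n. \<Sum>w\<in>words n. scaleU (word_coeff x v w * g w) (word v))"
    by (rule sum.swap)
  also have "\<dots> = word_sum n (matop (words n) (word_coeff x) g)"
    by (simp add: word_sum_def matop_def ugl3.scale_sum_left)
  finally show ?thesis .
qed

text \<open>
  The matrix of the Casimir operator on words, \<open>\<Sum>\<^sub>x A\<^sub>x
  A\<^sub>x\<^sup>*\<close> for the matrices \<open>A\<^sub>x\<close> of \<open>ad
  E\<^sub>x\<close>.
\<close>

definition laplace_coeff :: "nat \<Rightarrow> (3 \<times> 3) list \<Rightarrow> (3 \<times> 3) list \<Rightarrow> complex" where
  "laplace_coeff n v w = (\<Sum>x\<in>UNIV. \<Sum>y\<in>words n. word_coeff x v y * word_coeff (prod.swap x) y w)"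

lemma laplace_coeff_herm: "laplace_coeff n w v = cnj (laplace_coeff n v w)"
proof -
  have "laplace_coeff n w v = (\<Sum>x\<in>UNIV. \<Sum>y\<in>words n. cnj (word_coeff (prod.swap x) y w) * cnj (word_coeff x v y))"
    unfolding laplace_coeff_def
  proof (intro sum.cong refl)
    fix x y
    show "word_coeff x w y * word_coeff (prod.swap x) y v = cnj (word_coeff (prod.swap x) y w) * cnj (word_coeff x v y)"
      using word_coeff_adjoint[of "prod.swap x" w y] word_coeff_adjoint[of x y v] by simp
  qed
  then show ?thesis by (simp add: laplace_coeff_def cnj_sum mult.commute)
qed

lemma matop_laplace:
  "matop (words n) (laplace_coeff n) g v
    = (\<Sum>x\<in>UNIV. matop (words n) (word_coeff x) (matop (words n) (word_coeff (prod.swap x)) g) v)"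
proof (cases "v \<in> words n")
  case True
  have "(\<Sum>w\<in>words n. laplace_coeff n v w * g w)
    = (\<Sum>w\<in>words n. \<Sum>x\<in>UNIV. \<Sum>y\<in>words n. word_coeff x v y * word_coeff (prod.swap x) y w * g w)"
    by (simp add: laplace_coeff_def sum_distrib_right)
  also have "\<dots> = (\<Sum>x\<in>UNIV. \<Sum>w\<in>words n. \<Sum>y\<in>words n. word_coeff x v y * word_coeff (prod.swap x) y w * g w)"
    by (rule sum.swap)
  also have "\<dots> = (\<Sum>x\<in>UNIV. \<Sum>y\<in>words n. \<Sum>w\<in>words n. word_coeff x v y * word_coeff (prod.swap x) y w * g w)"
    by (intro sum.cong refl sum.swap)
  also have "\<dots> = (\<Sum>x\<in>UNIV. matop (words n) (word_coeff x) (matop (words n) (word_coeff (prod.swap x)) g) v)"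
    using True by (simp add: matop_def sum_distrib_left mult.assoc)
  finally show ?thesis using True by (simp add: matop_def)
qed (simp add: matop_def)

lemma word_sum_sum: "word_sum n (\<lambda>v. \<Sum>i\<in>A. c i * f i v) = (\<Sum>i\<in>A. scaleU (c i) (word_sum n (f i)))"
proof -
  have "word_sum n (\<lambda>v. \<Sum>i\<in>A. c i * f i v) = (\<Sum>w\<in>words n. \<Sum>i\<in>A. scaleU (c i * f i w) (word w))"
    by (simp add: word_sum_def ugl3.scale_sum_left)
  also have "\<dots> = (\<Sum>i\<in>A. \<Sum>w\<in>words n. scaleU (c i * f i w) (word w))"
    by (rule sum.swap)
  finally show ?thesis by (simp add: word_sum_def ugl3.scale_sum_right)
qed

lemma adU_casimir_word_sum:
  "adU casimir (word_sum n g) = word_sum n (matop (words n) (laplace_coeff n) g)"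
proof -
  have "matop (words n) (laplace_coeff n) g = (\<lambda>v. \<Sum>x\<in>UNIV. 1 * matop (words n) (word_coeff x) (matop (words n) (word_coeff (prod.swap x)) g) v)"
    by (simp add: matop_laplace fun_eq_iff)
  then show ?thesis
    by (simp only: word_sum_sum) (simp add: adU_casimir adE_word_sum)
qed

lemma adU_casimir_pow_word_sum:
  "(adU casimir ^^ i) (word_sum n g) = word_sum n ((matop (words n) (laplace_coeff n) ^^ i) g)"
  by (induction i) (simp_all add: adU_casimir_word_sum)

text \<open>
  If \<open>\<Sum>\<^sub>x A\<^sub>x A\<^sub>x\<^sup>* h = 0\<close>, pairing with
  \<open>h\<close> gives \<open>\<Sum>\<^sub>x \<parallel>A\<^sub>x\<^sup>* h\<parallel>\<^sup>2 =
  0\<close>. So the kernel of the Casimir operator consists of invariants.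
\<close>

lemma laplace_kernel:
  assumes h: "matop (words n) (laplace_coeff n) h = (\<lambda>_. 0)"
  shows "matop (words n) (word_coeff x) h = (\<lambda>_. 0)"
proof -
  let ?M = "\<lambda>x. matop (words n) (word_coeff x)"
  have inner: "(\<Sum>v\<in>words n. ?M x g v * cnj (h v)) = (\<Sum>v\<in>words n. g v * cnj (?M (prod.swap x) h v))" for x g
  proof -
    have "(\<Sum>v\<in>words n. ?M x g v * cnj (h v)) = (\<Sum>v\<in>words n. \<Sum>w\<in>words n. word_coeff x v w * g w * cnj (h v))"
      by (simp add: matop_def sum_distrib_right)
    also have "\<dots> = (\<Sum>w\<in>words n. \<Sum>v\<in>words n. word_coeff x v w * g w * cnj (h v))"
      by (rule sum.swap)
    also have "\<dots> = (\<Sum>w\<in>words n. g w * cnj (?M (prod.swap x) h w))"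
      proof (intro sum.cong refl)
      fix w assume w: "w \<in> words n"
      have "cnj (?M (prod.swap x) h w) = (\<Sum>v\<in>words n. word_coeff x v w * cnj (h v))"
        using w by (simp add: matop_def cnj_sum word_coeff_adjoint)
      then show "(\<Sum>v\<in>words n. word_coeff x v w * g w * cnj (h v)) = g w * cnj (?M (prod.swap x) h w)"
        by (simp add: sum_distrib_left mult_ac)
    qed
    finally show ?thesis .
  qed
  define f where "f x v = ?M (prod.swap x) h v" for x v
  have "0 = (\<Sum>v\<in>words n. matop (words n) (laplace_coeff n) h v * cnj (h v))"
    by (simp add: h)
  also have "\<dots> = (\<Sum>x\<in>UNIV. \<Sum>v\<in>words n. ?M x (f x) v * cnj (h v))"
    unfolding matop_laplace sum_distrib_right f_def by (rule sum.swap)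
  also have "\<dots> = (\<Sum>x\<in>UNIV. \<Sum>v\<in>words n. f x v * cnj (f x v))"
    unfolding inner by (simp add: f_def)
  also have "\<dots> = (\<Sum>p\<in>UNIV \<times> words n. f (fst p) (snd p) * cnj (f (fst p) (snd p)))"
    by (simp add: sum.cartesian_product case_prod_unfold)
  finally have z: "(\<Sum>p\<in>UNIV \<times> words n. f (fst p) (snd p) * cnj (f (fst p) (snd p))) = 0" by simp
  have "f y v = 0" if "v \<in> words n" for y v
    using sum_norm_eq_0[OF _ z, of "(y, v)"] that by simp
  then have "?M x h v = 0" for v
    by (cases "v \<in> words n") (use f_def[of "prod.swap x" v] in \<open>simp_all add: matop_def\<close>)
  then show ?thesis by blast
qed

lemma central_reduction_word: "\<exists>q. central_reduction q \<and> q (word w) \<in> centre"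
proof -
  define n where "n = length w"
  define g :: "(3 \<times> 3) list \<Rightarrow> complex" where "g v = (if v = w then 1 else 0)" for v
  have w: "w \<in> words n" by (simp add: n_def words_def)
  have g: "word_sum n g = word w"
  proof -
    have "word_sum n g = (\<Sum>v\<in>words n. if w = v then word v else 0)"
      unfolding word_sum_def g_def by (rule sum.cong) auto
    then show ?thesis using w by simp
  qed
  obtain c N where c: "c 0 = 1"
    and k: "matop (words n) (laplace_coeff n) (\<lambda>v. \<Sum>i\<le>N. c i * (matop (words n) (laplace_coeff n) ^^ i) g v) = (\<lambda>_. 0)"
  proof -
    have "\<exists>c N. c 0 = 1 \<and> matop (words n) (laplace_coeff n) (\<lambda>v. \<Sum>i\<le>N. c i * (matop (words n) (laplace_coeff n) ^^ i) g v) = (\<lambda>_. 0)"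
    proof (rule hermitian_fitting)
      show "g v = 0" if "v \<notin> words n" for v using that w by (auto simp: g_def)
    qed (rule finite_words, rule laplace_coeff_herm)
    then show ?thesis using that by blast
  qed
  define q where "q u = (\<Sum>i\<le>N. scaleU (c i) ((adU casimir ^^ i) u))" for u
  have "q (word w) = word_sum n (\<lambda>v. \<Sum>i\<le>N. c i * (matop (words n) (laplace_coeff n) ^^ i) g v)"
    by (simp add: q_def word_sum_sum adU_casimir_pow_word_sum flip: g)
  then have "adE x (q (word w)) = 0" for x
    by (simp add: adE_word_sum laplace_kernel[OF k]) (simp add: word_sum_def)
  then have "q (word w) \<in> centre" by (simp add: centre_iff)
  moreover have "central_reduction q"
    unfolding q_def using central_reduction_casimir_poly[of c N] c by simp
  ultimately show ?thesis by blast
qed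

text \<open>
  Reductions for different words can be composed: the set of elements that \<open>q\<close> makes
  central is stable under the adjoint action, hence preserved by any further reduction.
\<close>

lemma central_reduction_words:
  assumes "finite W"
  shows "\<exists>q. central_reduction q \<and> (\<forall>w\<in>W. q (word w) \<in> centre)"
  using assms
proof induction
  case empty show ?case using central_reduction_id by blast
next
  case (insert w W)
  then obtain q where q: "central_reduction q" "\<And>w. w \<in> W \<Longrightarrow> q (word w) \<in> centre" by blast
  obtain p where p: "central_reduction p" "p (word w) \<in> centre" using central_reduction_word by blast
  have st: "ad_stable {u. q u \<in> centre}"
    unfolding ad_stable_def
    by (auto simp: central_reductionD[OF q(1)] centre_add centre_scale) (simp add: centre_iff)
  have "q (p (word v)) \<in> centre" if "v \<in> insert w W" for v
    using that p q(2) central_reductionD(6)[OF p(1) st] by (auto simp: central_reductionD(4)[OF q(1)])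
  then show ?case using central_reduction_comp[OF q(1) p(1)] by blast
qed

lemma central_reduction_exists:
  assumes "finite F"
  shows "\<exists>q. central_reduction q \<and> (\<forall>u\<in>F. q u \<in> centre)"
proof -
  obtain W a where W: "\<And>u. finite (W u) \<and> u = (\<Sum>w\<in>W u. scaleU (a u w) (word w))"
    using ugl3_word_expansion by metis
  obtain q where q: "central_reduction q" "\<And>w. w \<in> (\<Union>u\<in>F. W u) \<Longrightarrow> q (word w) \<in> centre"
    using central_reduction_words[of "\<Union>u\<in>F. W u"] assms W by blast
  have st: "ad_stable {u. q u \<in> centre}"
    unfolding ad_stable_def
    by (auto simp: central_reductionD[OF q(1)] centre_add centre_scale) (simp add: centre_iff)
  have "q u \<in> centre" if "u \<in> F" for u
  proof -
    have "(\<Sum>w\<in>W u. scaleU (a u w) (word w)) \<in> {u. q u \<in> centre}"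
      by (intro ad_stable_sum[OF st]) (use that q in \<open>auto simp: central_reductionD(2)[OF q(1)] intro: centre_scale\<close>)
    then show ?thesis using W[of u] by simp
  qed
  with q(1) show ?thesis by blast
qed

text \<open>
  From \<open>[ab, v] = [a, bv] + [b, va]\<close>, by induction on the length of a word:
  commutators with arbitrary elements reduce to commutators with matrix units.
\<close>

lemma commutator_ad_sum: "\<exists>g. u * v - v * u = (\<Sum>x\<in>UNIV. adE x (g x))"
proof (induction u rule: ugl3_induct)
  case zero show ?case by (intro exI[of _ "\<lambda>_. 0"]) simp
next
  case (add w c u)
  have "\<exists>g. word w * v - v * word w = (\<Sum>x\<in>UNIV. adE x (g x))" for v
  proof (induction w arbitrary: v)
    case Nil show ?case by (intro exI[of _ "\<lambda>_. 0"]) simp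
  next
    case (Cons y w)
    obtain i j where y: "y = (i, j)" by fastforce
    obtain g where g: "word w * (v * E i j) - v * E i j * word w = (\<Sum>x\<in>UNIV. adE x (g x))"
      using Cons by blast
    have "word (y # w) * v - v * word (y # w) = adE y (word w * v) + (\<Sum>x\<in>UNIV. adE x (g x))"
      unfolding g[symmetric] by (simp add: y adE_def algebra_simps)
    also have "adE y (word w * v) = (\<Sum>x\<in>UNIV. if y = x then adE x (word w * v) else 0)" by simp
    finally have "word (y # w) * v - v * word (y # w) = (\<Sum>x\<in>UNIV. adE x ((if y = x then word w * v else 0) + g x))"
      by (simp add: adE_add sum.distrib if_distrib[of "adE _"] cong: if_cong)
    then show ?case by (rule exI[of _ "\<lambda>x. (if y = x then word w * v else 0) + g x"])
  qed
  then obtain g where g: "word w * v - v * word w = (\<Sum>x\<in>UNIV. adE x (g x))" by blast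
  obtain h where h: "u * v - v * u = (\<Sum>x\<in>UNIV. adE x (h x))" using add by blast
  have "(scaleU c (word w) + u) * v - v * (scaleU c (word w) + u) = scaleU c (word w * v - v * word w) + (u * v - v * u)"
    by (simp add: algebra_simps scaleU_mult_left scaleU_mult_right ugl3.scale_right_diff_distrib)
  also have "\<dots> = (\<Sum>x\<in>UNIV. adE x (scaleU c (g x) + h x))"
    by (simp add: g h adE_add adE_scale sum.distrib ugl3.scale_sum_right)
  finally show ?case by (rule exI[of _ "\<lambda>x. scaleU c (g x) + h x"])
qed

text \<open>
  If \<open>z = \<Sum>\<^sub>x [E\<^sub>x, g\<^sub>x]\<close> is central, a reduction
  \<open>q\<close> that makes all \<open>g\<^sub>x\<close> central fixes \<open>z\<close> and
  commutes with the brackets, so \<open>z = \<Sum>\<^sub>x [E\<^sub>x, q g\<^sub>x] = 0\<close>.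
\<close>

lemma centre_inter_commutator_space:
  assumes "z \<in> centre" "z \<in> commutator_space"
  shows "z = 0"
proof -
  have "\<exists>g. z = (\<Sum>x\<in>UNIV. adE x (g x))"
    using assms(2) unfolding commutator_space_def
  proof (induction rule: ugl3.span_induct_alt)
    case base show ?case by (intro exI[of _ "\<lambda>_. 0"]) simp
  next
    case (step c y z)
    then obtain g h where "y = (\<Sum>x\<in>UNIV. adE x (g x))" "z = (\<Sum>x\<in>UNIV. adE x (h x))"
      using commutator_ad_sum by blast
    then have "scaleU c y + z = (\<Sum>x\<in>UNIV. adE x (scaleU c (g x) + h x))"
      by (simp add: adE_add adE_scale sum.distrib ugl3.scale_sum_right)
    then show ?case by (rule exI[of _ "\<lambda>x. scaleU c (g x) + h x"])
  qed
  then obtain g where g: "z = (\<Sum>x\<in>UNIV. adE x (g x))" by blast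
  obtain q where q: "central_reduction q" "\<And>x. q (g x) \<in> centre"
    using central_reduction_exists[of "range g"] by auto
  have qsum: "q (sum f A) = (\<Sum>x\<in>A. q (f x))" for f and A :: "(3 \<times> 3) set"
    by (induction A rule: infinite_finite_induct) (simp_all add: central_reductionD[OF q(1)])
  have "z = q z" using assms(1) by (simp add: central_reductionD(4)[OF q(1)])
  also have "\<dots> = (\<Sum>x\<in>UNIV. adE x (q (g x)))"
    by (simp add: g qsum central_reductionD(3)[OF q(1)])
  also have "\<dots> = 0" using q(2) by (simp add: centre_iff del: split_paired_All)
  finally show ?thesis .
qed

lemma sharp_unique: "z \<in> centre \<Longrightarrow> u - z \<in> commutator_space \<Longrightarrow> sharp u = z"
  unfolding sharp_def
proof (rule the_equality)
  fix y assume z: "z \<in> centre" "u - z \<in> commutator_space" and y: "y \<in> centre \<and> u - y \<in> commutator_space"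
  have "y - z \<in> commutator_space"
    using commutator_space_diff[of "u - z" "u - y"] z y by simp
  then show "y = z" using centre_inter_commutator_space[of "y - z"] z y by (simp add: centre_diff)
qed auto

lemma sharp_central_reduction:
  assumes "central_reduction q" "q u \<in> centre" shows "sharp u = q u"
  using assms by (intro sharp_unique) (auto simp: central_reductionD)

lemma sharp_props: "sharp u \<in> centre" "u - sharp u \<in> commutator_space"
proof -
  obtain q where q: "central_reduction q" "q u \<in> centre" using central_reduction_exists[of "{u}"] by auto
  show "sharp u \<in> centre" "u - sharp u \<in> commutator_space"
    using q by (simp_all add: sharp_central_reduction central_reductionD)
qed

text \<open>
  A reduction preserves every subspace that is stable under the adjoint action, in particular the
  annihilator.
\<close>

lemma sharp_J: assumes "u \<in> J_ideal \<alpha>" shows "sharp u \<in> J_ideal \<alpha>"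
proof -
  obtain q where q: "central_reduction q" "q u \<in> centre" using central_reduction_exists[of "{u}"] by auto
  show ?thesis
    using q assms by (simp add: sharp_central_reduction central_reductionD(6)[OF _ ad_stable_J])
qed

lemma sharp_add: "sharp (u + v) = sharp u + sharp v"
proof (rule sharp_unique)
  show "u + v - (sharp u + sharp v) \<in> commutator_space"
    using commutator_space_add[OF sharp_props(2)[of u] sharp_props(2)[of v]] by (simp add: algebra_simps)
qed (simp add: centre_add sharp_props)

lemma sharp_scale: "sharp (scaleU c u) = scaleU c (sharp u)"
proof (rule sharp_unique)
  show "scaleU c u - scaleU c (sharp u) \<in> commutator_space"
    using commutator_space_scale[OF sharp_props(2)[of u], of c] by (simp add: ugl3.scale_right_diff_distrib)
qed (simp add: centre_scale sharp_props)

lemma sharp_commutator: "sharp (u * v - v * u) = 0"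
  by (rule sharp_unique) (simp_all add: commutator_spaceI)

section \<open>The invariant form\<close>

subsection \<open>The Harish-Chandra projection\<close>

text \<open>
  The space \<open>n\<^sub>- U + U n\<^sub>+\<close> of the triangular decomposition.
\<close>

definition triangular_complement :: "ugl3 set" where
  "triangular_complement = ugl3.span
     ({y * u |y u. y \<in> {E 2 1, E 3 1, E 3 2}} \<union> {u * x |u x. x \<in> {E 1 2, E 1 3, E 2 3}})"

lemma triangular_complement_lower: "y \<in> {E 2 1, E 3 1, E 3 2} \<Longrightarrow> y * u \<in> triangular_complement"
  and triangular_complement_upper: "x \<in> {E 1 2, E 1 3, E 2 3} \<Longrightarrow> u * x \<in> triangular_complement"
  unfolding triangular_complement_def by (rule ugl3.span_base, blast)+

lemma triangular_complement_subspace: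
  "0 \<in> triangular_complement"
  "u \<in> triangular_complement \<Longrightarrow> v \<in> triangular_complement \<Longrightarrow> u + v \<in> triangular_complement"
  "u \<in> triangular_complement \<Longrightarrow> v \<in> triangular_complement \<Longrightarrow> u - v \<in> triangular_complement"
  "u \<in> triangular_complement \<Longrightarrow> scaleU c u \<in> triangular_complement"
  unfolding triangular_complement_def
  by (simp_all add: ugl3.span_zero ugl3.span_add ugl3.span_diff ugl3.span_scale)

lemma triangular_complement_induct [consumes 1, case_names zero lower upper]:
  assumes "u \<in> triangular_complement" "P 0"
    "\<And>c y u v. y \<in> {E 2 1, E 3 1, E 3 2} \<Longrightarrow> P v \<Longrightarrow> P (scaleU c (y * u) + v)"
    "\<And>c x u v. x \<in> {E 1 2, E 1 3, E 2 3} \<Longrightarrow> P v \<Longrightarrow> P (scaleU c (u * x) + v)"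
  shows "P u"
  using assms(1) unfolding triangular_complement_def
proof (induction rule: ugl3.span_induct_alt)
  case (step c a v)
  then show ?case using assms(3,4) by blast
qed (rule assms(2))

abbreviation cartan_monomial :: "nat \<times> nat \<times> nat \<Rightarrow> ugl3" where
  "cartan_monomial m \<equiv> E 1 1 ^ fst m * E 2 2 ^ fst (snd m) * E 3 3 ^ snd (snd m)"

lemma sym_h_to_U_superset:
  assumes "finite A" "Poly_Mapping.keys P \<subseteq> A"
  shows "sym_h_to_U P = (\<Sum>m\<in>A. scaleU (Poly_Mapping.lookup P m) (cartan_monomial m))"
proof -
  have "sym_h_to_U P = (\<Sum>m\<in>Poly_Mapping.keys P. scaleU (Poly_Mapping.lookup P m) (cartan_monomial m))"
    unfolding sym_h_to_U_def by (rule sum.cong) auto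
  also have "\<dots> = (\<Sum>m\<in>A. scaleU (Poly_Mapping.lookup P m) (cartan_monomial m))"
    using assms by (intro sum.mono_neutral_left) (auto simp: in_keys_iff)
  finally show ?thesis .
qed

lemma sym_h_to_U_add: "sym_h_to_U (P + Q) = sym_h_to_U P + sym_h_to_U Q"
proof -
  let ?A = "Poly_Mapping.keys P \<union> Poly_Mapping.keys Q"
  have "Poly_Mapping.keys (P + Q) \<subseteq> ?A" by (rule keys_add)
  then show ?thesis
    by (simp add: sym_h_to_U_superset[of ?A] lookup_add ugl3.scale_left_distrib sum.distrib)
qed

lemma sym_h_to_U_single: "sym_h_to_U (Poly_Mapping.single m c) = scaleU c (cartan_monomial m)"
  using sym_h_to_U_superset[of "{m}" "Poly_Mapping.single m c"] by simp

lemma sym_h_to_U_zero [simp]: "sym_h_to_U 0 = 0"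
  by (simp add: sym_h_to_U_def)

lemma sym_h_to_U_scale: "sym_h_to_U (Poly_Mapping.map ((*) c) P) = scaleU c (sym_h_to_U P)"
proof -
  have "Poly_Mapping.keys (Poly_Mapping.map ((*) c) P) \<subseteq> Poly_Mapping.keys P"
    by (auto simp: in_keys_iff map.rep_eq when_def split: if_splits)
  then show ?thesis
    by (simp add: sym_h_to_U_superset[of "Poly_Mapping.keys P"] ugl3.scale_sum_right map.rep_eq in_keys_iff when_def)
qed

lemma E_diag_commute: "E i i * E j j = E j j * E i i"
  using E_bracket[of i i j j] by (cases "i = j") auto

lemma diagonal_word: "(\<And>x. x \<in> set w \<Longrightarrow> fst x = snd x) \<Longrightarrow> \<exists>m. word w = cartan_monomial m"
proof (induction w)
  case Nil show ?case by (intro exI[of _ "(0, 0, 0)"]) simp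
next
  case (Cons x w)
  then obtain m where m: "word w = cartan_monomial m" by auto
  obtain a b c where abc: "m = (a, b, c)" by (metis prod_cases3)
  obtain i where x: "x = (i, i)" using Cons.prems[of x] by (cases x) auto
  have c: "E i i * E j j ^ n = E j j ^ n * E i i" for j n
    using power_commuting_commutes[OF E_diag_commute[of j i], of n] by simp
  have w: "word (x # w) = E i i * (E 1 1 ^ a * E 2 2 ^ b * E 3 3 ^ c)" by (simp add: x m abc)
  consider "i = 1" | "i = 2" | "i = 3" using exhaust_3[of i] by blast
  then show ?case
  proof cases
    case 1
    then show ?thesis unfolding w by (intro exI[of _ "(Suc a, b, c)"]) (simp add: mult.assoc)
  next
    case 2
    have "word (x # w) = E 1 1 ^ a * (E 2 2 * E 2 2 ^ b) * E 3 3 ^ c"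
      unfolding w using c[of 1 a] 2 by (simp flip: mult.assoc)
    then show ?thesis by (intro exI[of _ "(a, Suc b, c)"]) simp
  next
    case 3
    have "word (x # w) = E 1 1 ^ a * E 2 2 ^ b * (E 3 3 * E 3 3 ^ c)"
      unfolding w using c[of 1 a] c[of 2 b] 3 by (metis mult.assoc)
    then show ?thesis by (intro exI[of _ "(a, b, Suc c)"]) simp
  qed
qed

text \<open>
  A lowering letter is moved to the front, a raising letter to the end; the commutator terms are
  sums of shorter words. A word without such letters is a monomial in the commuting diagonal
  matrix units.
\<close>

lemma word_in_triangular: "\<exists>P. word w - sym_h_to_U P \<in> triangular_complement"
proof (induction "length w" arbitrary: w rule: less_induct)
  case less
  define R where "R = {u. \<exists>P. u - sym_h_to_U P \<in> triangular_complement}"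
  have R0: "u \<in> R" if "u \<in> triangular_complement" for u
    using that unfolding R_def by (intro CollectI exI[of _ 0]) simp
  have Radd: "u + v \<in> R" if uv: "u \<in> R" "v \<in> R" for u v
  proof -
    obtain P Q where "u - sym_h_to_U P \<in> triangular_complement" "v - sym_h_to_U Q \<in> triangular_complement"
      using uv unfolding R_def by blast
    from triangular_complement_subspace(2)[OF this] show ?thesis
      unfolding R_def by (intro CollectI exI[of _ "P + Q"]) (simp add: sym_h_to_U_add algebra_simps)
  qed
  have Rscale: "scaleU c u \<in> R" if u: "u \<in> R" for c u
  proof -
    obtain P where "u - sym_h_to_U P \<in> triangular_complement" using u unfolding R_def by blast
    from triangular_complement_subspace(4)[OF this, of c] show ?thesis
      unfolding R_def by (intro CollectI exI[of _ "Poly_Mapping.map ((*) c) P"])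
        (simp add: sym_h_to_U_scale ugl3.scale_right_diff_distrib)
  qed
  have Rsum: "sum f A \<in> R" if "\<And>a. a \<in> A \<Longrightarrow> f a \<in> R" for f and A :: "(3 \<times> 3) list set"
    using that by (induction A rule: infinite_finite_induct)
      (auto intro: Radd R0 simp: triangular_complement_subspace(1))
  have shorter: "word v1 * adE x (word v) * word v2 \<in> R" if "length v1 + length v + length v2 < length w" for v1 v v2 x
  proof -
    have "word v1 * adE x (word v) * word v2 = (\<Sum>v'\<in>words (length v). scaleU (word_coeff x v' v) (word (v1 @ v' @ v2)))"
      by (simp add: adE_word sum_distrib_left sum_distrib_right scaleU_mult_left scaleU_mult_right mult.assoc)
    also have "\<dots> \<in> R"
    proof (intro Rsum Rscale)
      fix v' assume "v' \<in> words (length v)"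
      then have "length (v1 @ v' @ v2) < length w" using that by (simp add: words_def)
      then show "word (v1 @ v' @ v2) \<in> R" using less unfolding R_def by blast
    qed
    finally show ?thesis .
  qed
  have "word w \<in> R"
  proof (cases "\<forall>x\<in>set w. fst x = snd x")
    case True
    then obtain m where "word w = cartan_monomial m" using diagonal_word[of w] by auto
    then show ?thesis unfolding R_def
      by (intro CollectI exI[of _ "Poly_Mapping.single m 1"])
         (simp add: sym_h_to_U_single triangular_complement_subspace(1))
  next
    case False
    then obtain x where x: "x \<in> set w" "fst x \<noteq> snd x" by blast
    obtain i j where ij: "x = (i, j)" by fastforce
    obtain w1 w2 where w: "w = w1 @ x # w2" using x(1) by (metis split_list)
    have "(E i j \<in> {E 2 1, E 3 1, E 3 2}) \<or> (E i j \<in> {E 1 2, E 1 3, E 2 3})"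
      using x(2) exhaust_3[of i] exhaust_3[of j] unfolding ij by auto
    then show ?thesis
    proof
      assume low: "E i j \<in> {E 2 1, E 3 1, E 3 2}"
      have "word w = E i j * (word w1 * word w2) + scaleU (-1) (word [] * adE x (word w1) * word w2)"
        by (simp add: w ij adE_def algebra_simps)
      moreover have "word [] * adE x (word w1) * word w2 \<in> R"
        by (rule shorter) (simp add: w)
      ultimately show ?thesis using R0[OF triangular_complement_lower[OF low]] Rscale Radd by metis
    next
      assume upp: "E i j \<in> {E 1 2, E 1 3, E 2 3}"
      have "word w = (word w1 * word w2) * E i j + word w1 * adE x (word w2) * word []"
        by (simp add: w ij adE_def algebra_simps)
      moreover have "word w1 * adE x (word w2) * word [] \<in> R"
        by (rule shorter) (simp add: w)
      ultimately show ?thesis using R0[OF triangular_complement_upper[OF upp]] Radd by metis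
    qed
  qed
  then show ?case by (simp add: R_def)
qed

lemma triangular_decomposition: "\<exists>P. u - sym_h_to_U P \<in> triangular_complement"
proof (induction u rule: ugl3_induct)
  case zero show ?case by (intro exI[of _ 0]) (simp add: triangular_complement_subspace(1))
next
  case (add w c u)
  obtain Q where Q: "u - sym_h_to_U Q \<in> triangular_complement" using add by blast
  obtain P where P: "word w - sym_h_to_U P \<in> triangular_complement" using word_in_triangular by blast
  have "scaleU c (word w) + u - sym_h_to_U (Poly_Mapping.map ((*) c) P + Q)
     = scaleU c (word w - sym_h_to_U P) + (u - sym_h_to_U Q)"
    by (simp add: sym_h_to_U_add sym_h_to_U_scale ugl3.scale_right_diff_distrib)
  also have "\<dots> \<in> triangular_complement"
    by (intro triangular_complement_subspace P Q)
  finally show ?case by (rule exI)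
qed

lemma sym_h_eval_superset:
  assumes "finite A" "Poly_Mapping.keys P \<subseteq> A"
  shows "sym_h_eval P h = (\<Sum>(a, b, c)\<in>A. Poly_Mapping.lookup P (a, b, c) * (h $ 1 ^ a * h $ 2 ^ b * h $ 3 ^ c))"
  unfolding sym_h_eval_def
  using assms by (intro sum.mono_neutral_left) (auto simp: in_keys_iff)

lemma functional_sym_h:
  fixes h :: "complex ^ 3"
  assumes add: "\<And>u v. F (u + v) = F u + F v" and scale: "\<And>c u. F (scaleU c u) = c * F u"
    and mono: "\<And>a b c. F (E 1 1 ^ a * E 2 2 ^ b * E 3 3 ^ c) = (h $ 1) ^ a * (h $ 2) ^ b * (h $ 3) ^ c"
  shows "F (sym_h_to_U P) = sym_h_eval P h"
proof -
  have zero: "F 0 = 0" using scale[of 0 0] by simp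
  have "F (sum f A) = (\<Sum>m\<in>A. F (f m))" for f and A :: "(nat \<times> nat \<times> nat) set"
    by (induction A rule: infinite_finite_induct) (simp_all add: add zero)
  then show ?thesis
    by (simp add: sym_h_to_U_superset[of "Poly_Mapping.keys P"] sym_h_eval_def scale mono case_prod_unfold)
qed

lemma functional_triangular:
  assumes add: "\<And>u v. F (u + v) = (F u + F v :: complex)" and scale: "\<And>c u. F (scaleU c u) = c * F u"
    and low: "\<And>y u. y \<in> {E 2 1, E 3 1, E 3 2} \<Longrightarrow> F (y * u) = 0"
    and upp: "\<And>x u. x \<in> {E 1 2, E 1 3, E 2 3} \<Longrightarrow> F (u * x) = 0"
    and u: "u \<in> triangular_complement"
  shows "F u = 0"
  using u
proof (induction rule: triangular_complement_induct)
  case zero then show ?case using scale[of 0 0] by simp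
next
  case (lower c y u v)
  then show ?case using low[of y u] by (simp add: add scale)
next
  case (upper c x u v)
  then show ?case using upp[of x u] by (simp add: add scale)
qed

subsection \<open>Independence of the Cartan part\<close>

type_synonym biexp = "(int ^ 3) \<times> (int ^ 3)"

text \<open>
  The operators below act on functions of two exponent vectors, that is, on formal coefficient
  families. For exponents \<open>k\<close> of \<open>x\<^sub>1, x\<^sub>2, x\<^sub>3\<close> and
  \<open>l\<close> of dual variables they give a model of \<open>S\<^sup>a(V) \<otimes>
  S\<^sup>b(V\<^sup>*)\<close>, and the scalar \<open>\<gamma>\<close> in \<open>biexp_act\<close>
  twists it by a multiple of the trace. The highest weights \<open>(a + \<gamma>, \<gamma>,
  \<gamma> - b)\<close> that arise are Zariski dense.
\<close>

definition coord_act :: "3 \<Rightarrow> 3 \<Rightarrow> (biexp \<Rightarrow> complex) \<Rightarrow> biexp \<Rightarrow> complex" where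
  "coord_act i j g p = of_int (fst p $ i) * g (fst p - axis i 1 + axis j 1, snd p)"

definition dual_act :: "3 \<Rightarrow> 3 \<Rightarrow> (biexp \<Rightarrow> complex) \<Rightarrow> biexp \<Rightarrow> complex" where
  "dual_act i j g p = - of_int (snd p $ j) * g (fst p, snd p - axis j 1 + axis i 1)"

definition biexp_act :: "complex \<Rightarrow> 3 \<times> 3 \<Rightarrow> (biexp \<Rightarrow> complex) \<Rightarrow> biexp \<Rightarrow> complex" where
  "biexp_act \<gamma> x g p = coord_act (fst x) (snd x) g p + dual_act (fst x) (snd x) g p
     + (if fst x = snd x then \<gamma> * g p else 0)"

lemma axis_nth': "axis i (1::int) $ j = (if j = i then 1 else 0)"
  by (simp add: axis_def)

lemma coord_act_bracket:
  "coord_act i j (coord_act k l g) p - coord_act k l (coord_act i j g) p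
     = (if j = k then coord_act i l g p else 0) - (if l = i then coord_act k j g p else 0)"
proof -
  obtain m n where p: "p = (m, n)" by fastforce
  have e: "m - axis k 1 + axis l 1 - axis i 1 + axis j 1 = m - axis i 1 + axis j 1 - axis k 1 + (axis l 1 :: int ^ 3)"
    by simp
  show ?thesis
    unfolding coord_act_def p fst_conv snd_conv e
    by (cases "j = k"; cases "l = i"; cases "i = k") (auto simp: axis_nth' algebra_simps)
qed

lemma dual_act_bracket:
  "dual_act i j (dual_act k l g) p - dual_act k l (dual_act i j g) p
     = (if j = k then dual_act i l g p else 0) - (if l = i then dual_act k j g p else 0)"
proof -
  obtain m n where p: "p = (m, n)" by fastforce
  have e: "n - axis l 1 + axis k 1 - axis j 1 + axis i 1 = n - axis j 1 + axis i 1 - axis l 1 + (axis k 1 :: int ^ 3)"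
    by simp
  show ?thesis
    unfolding dual_act_def p fst_conv snd_conv e
    by (cases "j = k"; cases "l = i"; cases "j = l") (auto simp: axis_nth' algebra_simps)
qed

lemma coord_dual_commute: "coord_act i j (dual_act k l g) p = dual_act k l (coord_act i j g) p"
  by (simp add: coord_act_def dual_act_def)

lemma coord_act_linear:
  "coord_act i j (\<lambda>p. f p + g p) p = coord_act i j f p + coord_act i j g p"
  "coord_act i j (\<lambda>p. c * f p) p = c * coord_act i j f p"
  "dual_act i j (\<lambda>p. f p + g p) p = dual_act i j f p + dual_act i j g p"
  "dual_act i j (\<lambda>p. c * f p) p = c * dual_act i j f p"
  by (simp_all add: coord_act_def dual_act_def algebra_simps)

lemma biexp_act_bracket:
  "biexp_act \<gamma> (i, j) (biexp_act \<gamma> (k, l) g) p - biexp_act \<gamma> (k, l) (biexp_act \<gamma> (i, j) g) p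
   = (if j = k then biexp_act \<gamma> (i, l) g p else 0) - (if l = i then biexp_act \<gamma> (k, j) g p else 0)"
proof -
  define s t :: complex where "s = (if i = j then \<gamma> else 0)" and "t = (if k = l then \<gamma> else 0)"
  have x: "biexp_act \<gamma> (i, j) f q = coord_act i j f q + dual_act i j f q + s * f q" for f q
    by (simp add: biexp_act_def s_def)
  have y: "biexp_act \<gamma> (k, l) f q = coord_act k l f q + dual_act k l f q + t * f q" for f q
    by (simp add: biexp_act_def t_def)
  have "biexp_act \<gamma> (i, j) (biexp_act \<gamma> (k, l) g) p - biexp_act \<gamma> (k, l) (biexp_act \<gamma> (i, j) g) p
    = (coord_act i j (coord_act k l g) p - coord_act k l (coord_act i j g) p)
      + (dual_act i j (dual_act k l g) p - dual_act k l (dual_act i j g) p)"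
    unfolding x y ext[OF x] ext[OF y] coord_act_linear coord_dual_commute by (simp add: algebra_simps)
  also have "\<dots> = (if j = k then biexp_act \<gamma> (i, l) g p else 0) - (if l = i then biexp_act \<gamma> (k, j) g p else 0)"
    unfolding coord_act_bracket dual_act_bracket by (auto simp: biexp_act_def)
  finally show ?thesis .
qed

interpretation biexp: gl3_module "\<lambda>c (g :: biexp \<Rightarrow> complex) p. c * g p" "biexp_act \<gamma>"
proof -
  interpret vector_space "\<lambda>c (g :: biexp \<Rightarrow> complex) p. c * g p" by (rule function_vector_space)
  show "gl3_module (\<lambda>c (g :: biexp \<Rightarrow> complex) p. c * g p) (biexp_act \<gamma>)"
  proof
    show "biexp_act \<gamma> x (v + w) = biexp_act \<gamma> x v + biexp_act \<gamma> x w" for x v w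
      by (auto simp: fun_eq_iff biexp_act_def coord_act_def dual_act_def algebra_simps)
    show "biexp_act \<gamma> x (\<lambda>p. c * v p) = (\<lambda>p. c * biexp_act \<gamma> x v p)" for x c v
      by (auto simp: fun_eq_iff biexp_act_def coord_act_def dual_act_def algebra_simps)
    show "biexp_act \<gamma> (i, j) (biexp_act \<gamma> (k, l) v) - biexp_act \<gamma> (k, l) (biexp_act \<gamma> (i, j) v)
       = (if j = k then biexp_act \<gamma> (i, l) v else 0) - (if l = i then biexp_act \<gamma> (k, j) v else 0)" for i j k l v
      using biexp_act_bracket[of \<gamma> i j k l v] by (auto simp: fun_eq_iff)
  qed
qed

lift_definition biexp_rep :: "complex \<Rightarrow> ugl3 \<Rightarrow> (biexp \<Rightarrow> complex) \<Rightarrow> biexp \<Rightarrow> complex"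
  is "\<lambda>\<gamma>. falg_act (\<lambda>c g p. c * g p) (biexp_act \<gamma>)"
  by (rule biexp.act_respects)

lemma biexp_rep_simps:
  "biexp_rep \<gamma> (u + v) g = biexp_rep \<gamma> u g + biexp_rep \<gamma> v g"
  "biexp_rep \<gamma> (u * v) g = biexp_rep \<gamma> u (biexp_rep \<gamma> v g)"
  "biexp_rep \<gamma> (scaleU c u) g = (\<lambda>p. c * biexp_rep \<gamma> u g p)"
  "biexp_rep \<gamma> (E i j) g = biexp_act \<gamma> (i, j) g"
  "biexp_rep \<gamma> 1 g = g" "biexp_rep \<gamma> 0 g = 0"
  by (transfer, rule biexp.act_add, transfer, rule biexp.act_mult,
      transfer, simp add: biexp.act_mult biexp.act_single, transfer, simp add: biexp.act_gen,
      transfer, simp add: biexp.act_single flip: single_one, transfer, simp)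

text \<open>
  The genuine module is the quotient by the functions that vanish on non-negative exponents;
  indices outside this range never feed back, since the coefficient \<open>k\<^sub>i\<close>
  vanishes on the boundary.
\<close>

definition vanishes_nonneg :: "(biexp \<Rightarrow> complex) \<Rightarrow> bool" where
  "vanishes_nonneg g \<longleftrightarrow> (\<forall>p. (\<forall>i. fst p $ i \<ge> 0 \<and> snd p $ i \<ge> 0) \<longrightarrow> g p = 0)"

lemma vanishes_nonnegD:
  "vanishes_nonneg g \<Longrightarrow> (\<And>i. k $ i \<ge> 0) \<Longrightarrow> (\<And>i. l $ i \<ge> 0) \<Longrightarrow> g (k, l) = 0"
  unfolding vanishes_nonneg_def by (drule spec[of _ "(k, l)"]) simp

lemma vanishes_nonneg_act: assumes g: "vanishes_nonneg g" shows "vanishes_nonneg (biexp_act \<gamma> x g)"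
  unfolding vanishes_nonneg_def
proof (intro allI impI)
  fix p :: biexp
  assume p: "\<forall>i. fst p $ i \<ge> 0 \<and> snd p $ i \<ge> 0"
  obtain k l where kl: "p = (k, l)" by fastforce
  have pk: "k $ m \<ge> 0" and pl: "l $ m \<ge> 0" for m using p by (simp_all add: kl)
  have "coord_act i j g p = 0" for i j
  proof (cases "k $ i = 0")
    case False
    have "(k - axis i 1 + axis j 1) $ m \<ge> 0" for m
      using pk[of m] pk[of i] False by (simp add: axis_nth')
    then show ?thesis using vanishes_nonnegD[OF g _ pl] by (simp add: coord_act_def kl)
  qed (simp add: coord_act_def kl)
  moreover have "dual_act i j g p = 0" for i j
  proof (cases "l $ j = 0")
    case False
    have "(l - axis j 1 + axis i 1) $ m \<ge> 0" for m
      using pl[of m] pl[of j] False by (simp add: axis_nth')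
    then show ?thesis using vanishes_nonnegD[OF g pk] by (simp add: dual_act_def kl)
  qed (simp add: dual_act_def kl)
  moreover have "g p = 0" using vanishes_nonnegD[OF g pk pl] by (simp add: kl)
  ultimately show "biexp_act \<gamma> x g p = 0" by (simp add: biexp_act_def)
qed

lemma vanishes_nonneg_rep: assumes "vanishes_nonneg g" shows "vanishes_nonneg (biexp_rep \<gamma> u g)"
proof (induction u rule: ugl3_induct)
  case zero show ?case by (simp add: biexp_rep_simps vanishes_nonneg_def)
next
  case (add w c u)
  have "vanishes_nonneg (biexp_rep \<gamma> (word w) g)"
  proof (induction w)
    case (Cons x w)
    then show ?case by (cases x) (simp add: biexp_rep_simps vanishes_nonneg_act)
  qed (simp add: biexp_rep_simps assms)
  with add show ?case by (simp add: biexp_rep_simps vanishes_nonneg_def)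
qed

definition hw_exp :: "nat \<Rightarrow> nat \<Rightarrow> biexp" where
  "hw_exp a b = (axis 1 (int a), axis 3 (int b))"

definition hw_vec :: "nat \<Rightarrow> nat \<Rightarrow> biexp \<Rightarrow> complex" where
  "hw_vec a b p = (if p = hw_exp a b then 1 else 0)"

text \<open>
  The coefficient of the highest weight monomial is unaffected by \<open>n\<^sub>- U\<close>: at
  that point all factors \<open>k\<^sub>i\<close> and \<open>l\<^sub>j\<close> that could occur
  are zero.
\<close>

lemma biexp_rep_lower:
  assumes "y \<in> {E 2 1, E 3 1, E 3 2}" shows "biexp_rep \<gamma> (y * u) g (hw_exp a b) = 0"
  using assms
  by (auto simp: biexp_rep_simps biexp_act_def coord_act_def dual_act_def hw_exp_def axis_def)

lemma biexp_rep_upper: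
  assumes "x \<in> {E 1 2, E 1 3, E 2 3}" shows "biexp_rep \<gamma> (u * x) (hw_vec a b) (hw_exp a b) = 0"
proof -
  have *: "vanishes_nonneg (biexp_act \<gamma> (i, j) (hw_vec a b))" if "(i, j) \<in> {(1, 2), (1, 3), (2, 3)}" for i j
    unfolding vanishes_nonneg_def
  proof (intro allI impI)
    fix p :: biexp
    assume p: "\<forall>i. fst p $ i \<ge> 0 \<and> snd p $ i \<ge> 0"
    have "fst p - axis i 1 + axis j 1 \<noteq> axis 1 (int a)"
    proof
      assume "fst p - axis i 1 + axis j 1 = axis 1 (int a)"
      then have "(fst p - axis i 1 + axis j 1) $ j = axis 1 (int a) $ j" by simp
      then have "fst p $ j = -1" using that by (auto simp: axis_def)
      then show False using p by (metis not_one_le_zero neg_0_le_iff_le)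
    qed
    moreover have "snd p - axis j 1 + axis i 1 \<noteq> axis 3 (int b)"
    proof
      assume "snd p - axis j 1 + axis i 1 = axis 3 (int b)"
      then have "(snd p - axis j 1 + axis i 1) $ i = axis 3 (int b) $ i" by simp
      then have "snd p $ i = -1" using that by (auto simp: axis_def)
      then show False using p by (metis not_one_le_zero neg_0_le_iff_le)
    qed
    ultimately show "biexp_act \<gamma> (i, j) (hw_vec a b) p = 0"
      using that by (auto simp: biexp_act_def coord_act_def dual_act_def hw_vec_def hw_exp_def)
  qed
  obtain i j where ij: "x = E i j" "(i, j) \<in> {(1, 2), (1, 3), (2, 3)}" using assms by auto
  have "vanishes_nonneg (biexp_rep \<gamma> (u * x) (hw_vec a b))"
    unfolding ij biexp_rep_simps by (intro vanishes_nonneg_rep * ij)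
  then show ?thesis by (simp add: vanishes_nonneg_def hw_exp_def axis_def)
qed

definition hw_weight :: "complex \<Rightarrow> nat \<Rightarrow> nat \<Rightarrow> complex ^ 3" where
  "hw_weight \<gamma> a b = vector [of_nat a + \<gamma>, \<gamma>, \<gamma> - of_nat b]"

lemma biexp_act_diag: "biexp_act \<gamma> (i, i) g p = (of_int (fst p $ i) - of_int (snd p $ i) + \<gamma>) * g p"
  by (simp add: biexp_act_def coord_act_def dual_act_def algebra_simps)

lemma biexp_rep_diag: "biexp_rep \<gamma> (E i i) (\<lambda>p. c * hw_vec a b p) = (\<lambda>p. (hw_weight \<gamma> a b $ i * c) * hw_vec a b p)"
proof
  fix p
  have "of_int (fst (hw_exp a b) $ i) - of_int (snd (hw_exp a b) $ i) + \<gamma> = hw_weight \<gamma> a b $ i"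
    using exhaust_3[of i] by (auto simp: hw_exp_def hw_weight_def vector_3 axis_def)
  then show "biexp_rep \<gamma> (E i i) (\<lambda>p. c * hw_vec a b p) p = (hw_weight \<gamma> a b $ i * c) * hw_vec a b p"
    unfolding biexp_rep_simps biexp_act_diag
    by (cases "p = hw_exp a b") (simp_all add: hw_vec_def)
qed

lemma biexp_rep_monomial:
  "biexp_rep \<gamma> (E 1 1 ^ k * E 2 2 ^ l * E 3 3 ^ m) (hw_vec a b) (hw_exp a b)
    = (hw_weight \<gamma> a b $ 1) ^ k * (hw_weight \<gamma> a b $ 2) ^ l * (hw_weight \<gamma> a b $ 3) ^ m"
proof -
  let ?v = "hw_vec a b" and ?w = "hw_weight \<gamma> a b"
  have pow: "biexp_rep \<gamma> (E i i ^ n) (\<lambda>p. c * ?v p) = (\<lambda>p. ((?w $ i) ^ n * c) * ?v p)" for i n c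
  proof (induction n)
    case 0
    show ?case by (simp add: biexp_rep_simps(5))
  next
    case (Suc n)
    have "biexp_rep \<gamma> (E i i ^ Suc n) (\<lambda>p. c * ?v p) = biexp_rep \<gamma> (E i i) (\<lambda>p. ((?w $ i) ^ n * c) * ?v p)"
      by (simp only: power_Suc biexp_rep_simps(2) Suc)
    also have "\<dots> = (\<lambda>p. (?w $ i * ((?w $ i) ^ n * c)) * ?v p)" by (rule biexp_rep_diag)
    finally show ?case by (simp only: power_Suc mult.assoc)
  qed
  have "?v = (\<lambda>p. 1 * ?v p)" by simp
  then have "biexp_rep \<gamma> (E 1 1 ^ k * E 2 2 ^ l * E 3 3 ^ m) ?v
    = biexp_rep \<gamma> (E 1 1 ^ k) (biexp_rep \<gamma> (E 2 2 ^ l) (biexp_rep \<gamma> (E 3 3 ^ m) (\<lambda>p. 1 * ?v p)))"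
    by (simp only: biexp_rep_simps(2))
  also have "\<dots> = (\<lambda>p. ((?w $ 1) ^ k * ((?w $ 2) ^ l * ((?w $ 3) ^ m * 1))) * ?v p)"
    by (simp only: pow)
  finally have "biexp_rep \<gamma> (E 1 1 ^ k * E 2 2 ^ l * E 3 3 ^ m) ?v (hw_exp a b)
    = ((?w $ 1) ^ k * ((?w $ 2) ^ l * ((?w $ 3) ^ m * 1))) * ?v (hw_exp a b)"
    by (rule fun_cong)
  then show ?thesis by (simp only: hw_vec_def refl if_True mult_1_right mult.assoc)
qed

definition hw_functional :: "complex \<Rightarrow> nat \<Rightarrow> nat \<Rightarrow> ugl3 \<Rightarrow> complex" where
  "hw_functional \<gamma> a b u = biexp_rep \<gamma> u (hw_vec a b) (hw_exp a b)"

lemma hw_functional_linear: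
  "hw_functional \<gamma> a b (u + v) = hw_functional \<gamma> a b u + hw_functional \<gamma> a b v"
  "hw_functional \<gamma> a b (scaleU c u) = c * hw_functional \<gamma> a b u"
  unfolding hw_functional_def biexp_rep_simps(1,3) by (rule plus_fun_apply, rule refl)

lemma sym_h_eval_hw_weight:
  "hw_functional \<gamma> a b (sym_h_to_U P) = sym_h_eval P (hw_weight \<gamma> a b)"
  by (rule functional_sym_h[where F = "hw_functional \<gamma> a b"])
     (rule hw_functional_linear, rule hw_functional_linear, unfold hw_functional_def, rule biexp_rep_monomial)

lemma triangular_complement_hw:
  "u \<in> triangular_complement \<Longrightarrow> hw_functional \<gamma> a b u = 0"
  by (rule functional_triangular[where F = "hw_functional \<gamma> a b"])
     (rule hw_functional_linear, rule hw_functional_linear, unfold hw_functional_def,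
      rule biexp_rep_lower, assumption, rule biexp_rep_upper, assumption)

lemma polyfun_zero:
  assumes "infinite A" "\<And>x. x \<in> A \<Longrightarrow> (\<Sum>i\<le>n. c i * x ^ i) = (0 :: complex)" "i \<le> n"
  shows "c i = 0"
proof (rule ccontr)
  assume "c i \<noteq> 0"
  then have "finite {z. (\<Sum>i\<le>n. c i * z ^ i) = 0}" using polyfun_finite_roots[of c n] assms(3) by blast
  moreover have "A \<subseteq> {z. (\<Sum>i\<le>n. c i * z ^ i) = 0}" using assms(2) by blast
  ultimately show False using assms(1) finite_subset by blast
qed

lemma infinite_shift: "infinite (range (\<lambda>n. of_nat n + z :: complex))"
  by (rule range_inj_infinite) (simp add: inj_def)

text \<open>
  Vanishing at all points \<open>(a + \<gamma>, \<gamma>, \<gamma> - b)\<close> is used one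
  variable at a time: each variable runs through infinitely many values while the remaining ones
  are fixed.
\<close>

lemma sym_h_zero_if_eval_zero:
  assumes "\<And>\<gamma> a b. sym_h_eval P (hw_weight \<gamma> a b) = 0"
  shows "P = 0"
proof -
  have "\<exists>M. \<forall>(a, b, c)\<in>Poly_Mapping.keys P. a \<le> M \<and> b \<le> M \<and> c \<le> M"
  proof -
    let ?f = "\<lambda>(a, b, c). a + b + (c :: nat)"
    have "\<forall>m\<in>Poly_Mapping.keys P. ?f m \<le> (\<Sum>m\<in>Poly_Mapping.keys P. ?f m)"
      by (intro ballI member_le_sum) auto
    then show ?thesis by (intro exI[of _ "\<Sum>m\<in>Poly_Mapping.keys P. ?f m"]) fastforce
  qed
  then obtain M where M: "Poly_Mapping.keys P \<subseteq> {..M} \<times> {..M} \<times> {..M}" by fastforce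
  let ?c = "\<lambda>a b c. Poly_Mapping.lookup P (a, b, c)"
  have ev: "sym_h_eval P h = (\<Sum>a\<le>M. (\<Sum>b\<le>M. (\<Sum>c\<le>M. ?c a b c * h $ 3 ^ c) * h $ 2 ^ b) * h $ 1 ^ a)" for h
  proof -
    have "sym_h_eval P h = (\<Sum>(a, b, c)\<in>{..M} \<times> {..M} \<times> {..M}. ?c a b c * ((h $ 1) ^ a * (h $ 2) ^ b * (h $ 3) ^ c))"
      by (rule sym_h_eval_superset[OF _ M]) simp
    also have "\<dots> = (\<Sum>a\<le>M. \<Sum>b\<le>M. \<Sum>c\<le>M. ?c a b c * ((h $ 1) ^ a * (h $ 2) ^ b * (h $ 3) ^ c))"
      by (simp only: sum.cartesian_product)
    also have "\<dots> = (\<Sum>a\<le>M. (\<Sum>b\<le>M. (\<Sum>c\<le>M. ?c a b c * h $ 3 ^ c) * h $ 2 ^ b) * h $ 1 ^ a)"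
      unfolding sum_distrib_right by (intro sum.cong refl) (simp only: mult_ac)
    finally show ?thesis .
  qed
  have 1: "(\<Sum>b\<le>M. (\<Sum>c\<le>M. ?c a b c * (\<gamma> - of_nat l) ^ c) * \<gamma> ^ b) = 0" if a: "a \<le> M" for a l \<gamma>
  proof (rule polyfun_zero[OF infinite_shift[of \<gamma>] _ a, of "\<lambda>a. (\<Sum>b\<le>M. (\<Sum>c\<le>M. ?c a b c * (\<gamma> - of_nat l) ^ c) * \<gamma> ^ b)"])
    fix x assume "x \<in> range (\<lambda>n. of_nat n + \<gamma>)"
    then obtain n where x: "x = of_nat n + \<gamma>" by blast
    show "(\<Sum>a\<le>M. (\<Sum>b\<le>M. (\<Sum>c\<le>M. ?c a b c * (\<gamma> - of_nat l) ^ c) * \<gamma> ^ b) * x ^ a) = 0"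
      using assms[of \<gamma> n l] unfolding ev x by (simp add: hw_weight_def vector_3)
  qed
  have 2: "(\<Sum>c\<le>M. ?c a b c * x ^ c) = 0" if a: "a \<le> M" and b: "b \<le> M" for a b x
  proof (rule polyfun_zero[OF infinite_shift[of x] _ b, of "\<lambda>b. \<Sum>c\<le>M. ?c a b c * x ^ c"])
    fix y assume "y \<in> range (\<lambda>n. of_nat n + x)"
    then obtain n where y: "y = of_nat n + x" by blast
    show "(\<Sum>b\<le>M. (\<Sum>c\<le>M. ?c a b c * x ^ c) * y ^ b) = 0"
      using 1[OF a, of y n] by (simp add: y)
  qed
  have 3: "?c a b c = 0" if "a \<le> M" "b \<le> M" "c \<le> M" for a b c
    by (rule polyfun_zero[OF infinite_shift[of 0] _ that(3)]) (use 2[OF that(1,2)] in simp)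
  have "Poly_Mapping.lookup P m = 0" for m
  proof (cases "m \<in> Poly_Mapping.keys P")
    case True
    obtain a b c where "m = (a, b, c)" by (metis prod_cases3)
    then show ?thesis using 3 M True by auto
  qed (simp add: in_keys_iff)
  then show ?thesis by (intro poly_mapping_eqI) simp
qed

lemma sym_h_eval_diff: "sym_h_eval (P - Q) h = sym_h_eval P h - sym_h_eval Q h"
proof -
  let ?A = "Poly_Mapping.keys P \<union> Poly_Mapping.keys Q"
  have "Poly_Mapping.keys (P - Q) \<subseteq> ?A" by (auto simp: in_keys_iff lookup_minus)
  then show ?thesis
    by (simp add: sym_h_eval_superset[of ?A] lookup_minus case_prod_unfold sum_subtractf left_diff_distrib)
qed

text \<open>
  Two candidates differ by an element of \<open>S(h)\<close> in the triangular complement;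
  evaluating on highest weight vectors shows that this polynomial vanishes on a Zariski dense set.
\<close>

lemma harish_chandra_unique:
  assumes "z - sym_h_to_U P \<in> triangular_complement"
  shows "harish_chandra z = P"
  unfolding harish_chandra_def triangular_complement_def[symmetric]
proof (rule the_equality)
  show "z - sym_h_to_U P \<in> triangular_complement" by (rule assms)
next
  fix Q assume Q: "z - sym_h_to_U Q \<in> triangular_complement"
  have mem: "sym_h_to_U P - sym_h_to_U Q \<in> triangular_complement"
    using triangular_complement_subspace(3)[OF Q assms] by simp
  have "sym_h_eval (Q - P) (hw_weight \<gamma> a b) = 0" for \<gamma> a b
  proof -
    have "hw_functional \<gamma> a b (sym_h_to_U P - sym_h_to_U Q + sym_h_to_U Q) = hw_functional \<gamma> a b (sym_h_to_U Q)"
      unfolding hw_functional_linear(1) triangular_complement_hw[OF mem] by simp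
    then show ?thesis by (simp add: sym_h_eval_diff sym_h_eval_hw_weight)
  qed
  then show "Q = P" using sym_h_zero_if_eval_zero[of "Q - P"] by simp
qed

subsection \<open>The trace functional\<close>

definition top_exp :: "complex \<Rightarrow> complex ^ 3" where
  "top_exp \<alpha> = vector [\<alpha>, 0, 0]"

text \<open>
  The diagonal matrix coefficient of \<open>u\<close> at the highest weight vector
  \<open>x\<^sub>1\<^sup>\<alpha>\<close>.
\<close>

definition vacuum :: "complex \<Rightarrow> ugl3 \<Rightarrow> complex" where
  "vacuum \<alpha> u = Poly_Mapping.lookup (rep u (Poly_Mapping.single (top_exp \<alpha>) 1)) (top_exp \<alpha>)"

lemma top_exp_nth [simp]: "top_exp \<alpha> $ 1 = \<alpha>" "top_exp \<alpha> $ 2 = 0" "top_exp \<alpha> $ 3 = 0"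
  by (simp_all add: top_exp_def vector_3)

lemma top_exp_in: "top_exp \<alpha> \<in> S_exponents \<alpha>"
  by (simp add: S_exponents_def)

lemma vacuum_linear: "vacuum \<alpha> (u + v) = vacuum \<alpha> u + vacuum \<alpha> v"
  "vacuum \<alpha> (scaleU c u) = c * vacuum \<alpha> u"
  by (simp_all add: vacuum_def rep_add lookup_add rep_scaleU scaleS_def map.rep_eq when_def)

lemma vacuum_J: "u \<in> J_ideal \<alpha> \<Longrightarrow> vacuum \<alpha> u = 0"
  using top_exp_in by (simp add: vacuum_def J_iff)

lemma lookup_xd_lower:
  assumes v: "v \<in> S_mod \<alpha>" and ij: "(i, j) \<in> {(2, 1), (3, 1), (3, 2)}"
  shows "Poly_Mapping.lookup (xd i j v) (top_exp \<alpha>) = 0"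
proof -
  have "Poly_Mapping.lookup (Poly_Mapping.single (k - axis j 1 + axis i 1) c) (top_exp \<alpha>) = 0"
    if k: "k \<in> Poly_Mapping.keys v" for k and c :: complex
  proof -
    have "k \<in> S_exponents \<alpha>" using k v by (auto simp: S_mod_def)
    then have n: "k $ i \<in> \<nat>" using ij by (auto simp: S_exponents_def)
    have "k - axis j 1 + axis i 1 \<noteq> top_exp \<alpha>"
    proof
      assume "k - axis j 1 + axis i 1 = top_exp \<alpha>"
      then have "(k - axis j 1 + axis i 1) $ i = top_exp \<alpha> $ i" by simp
      then have "k $ i = - 1" using ij by (auto simp: axis_def eq_neg_iff_add_eq_0)
      then have "of_nat (Suc 0) + (k $ i) = 0" by simp
      moreover obtain n where "k $ i = of_nat n" using n by (elim Nats_cases)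
      ultimately have "of_nat (Suc 0 + n) = (0 :: complex)" by (simp only: of_nat_add)
      then show False by (simp only: of_nat_eq_0_iff)
    qed
    then show ?thesis by (simp add: lookup_single)
  qed
  then show ?thesis by (simp add: xd_def lookup_sum)
qed

lemma vacuum_lower: assumes "y \<in> {E 2 1, E 3 1, E 3 2}" shows "vacuum \<alpha> (y * u) = 0"
proof -
  have "rep u (Poly_Mapping.single (top_exp \<alpha>) 1) \<in> S_mod \<alpha>"
    by (intro rep_S_mod) (simp add: S_mod_single top_exp_in)
  then show ?thesis using assms lookup_xd_lower by (auto simp: vacuum_def rep_mult rep_E)
qed

lemma vacuum_upper: assumes "x \<in> {E 1 2, E 1 3, E 2 3}" shows "vacuum \<alpha> (u * x) = 0"
proof -
  have "rep x (Poly_Mapping.single (top_exp \<alpha>) 1) = 0"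
    using assms by (auto simp: rep_E xd_single)
  then show ?thesis by (simp add: vacuum_def rep_mult)
qed

lemma vacuum_monomial:
  "vacuum \<alpha> (E 1 1 ^ k * E 2 2 ^ l * E 3 3 ^ m) = (top_exp \<alpha> $ 1) ^ k * (top_exp \<alpha> $ 2) ^ l * (top_exp \<alpha> $ 3) ^ m"
proof -
  let ?s = "Poly_Mapping.single (top_exp \<alpha>)"
  have pow: "rep (E i i ^ n) (?s c) = ?s ((top_exp \<alpha> $ i) ^ n * c)" for i n c
    by (induction n) (simp_all add: rep_mult rep_E xd_single mult_ac)
  have "rep (E 1 1 ^ k * E 2 2 ^ l * E 3 3 ^ m) (?s 1)
    = ?s ((top_exp \<alpha> $ 1) ^ k * ((top_exp \<alpha> $ 2) ^ l * ((top_exp \<alpha> $ 3) ^ m * 1)))"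
    by (simp only: rep_mult pow)
  then show ?thesis by (simp add: vacuum_def mult.assoc)
qed

text \<open>
  Both sides are linear, vanish on the triangular complement and agree on monomials in the
  diagonal matrix units. Thus the value of the Harish-Chandra image at \<open>(\<alpha>, 0,
  0)\<close> can be read off in \<open>S\<^sup>\<alpha>(V)\<close>.
\<close>

lemma sym_h_eval_harish_chandra: "sym_h_eval (harish_chandra u) (vector [\<alpha>, 0, 0]) = vacuum \<alpha> u"
proof -
  obtain P where P: "u - sym_h_to_U P \<in> triangular_complement"
    using triangular_decomposition by blast
  have "vacuum \<alpha> (u - sym_h_to_U P) = 0"
    by (rule functional_triangular[where F = "vacuum \<alpha>", OF vacuum_linear vacuum_lower vacuum_upper P])
  then have "vacuum \<alpha> u = vacuum \<alpha> (sym_h_to_U P)"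
    using vacuum_linear(1)[of \<alpha> "u - sym_h_to_U P" "sym_h_to_U P"] by simp
  also have "\<dots> = sym_h_eval P (top_exp \<alpha>)"
    by (rule functional_sym_h[where F = "vacuum \<alpha>", OF vacuum_linear vacuum_monomial])
  finally show ?thesis by (simp add: harish_chandra_unique[OF P] top_exp_def)
qed

lemma chevalley_add: "chevalley (u + v) = chevalley u + chevalley v"
  by transfer (simp add: falg_transpose_add ueq_def gl3_ideal.zero)
lemma chevalley_diff: "chevalley (u - v) = chevalley u - chevalley v"
  by transfer (simp add: falg_transpose_diff ueq_def gl3_ideal.zero)
lemma chevalley_zero [simp]: "chevalley 0 = 0"
  by transfer (simp add: ueq_def gl3_ideal.zero)
lemma chevalley_mult: "chevalley (u * v) = chevalley v * chevalley u"
  by transfer (simp add: falg_transpose_mult ueq_def gl3_ideal.zero)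
lemma chevalley_E [simp]: "chevalley (E i j) = E j i"
  by transfer (simp add: falg_transpose_gen ueq_def gl3_ideal.zero)
lemma word_transpose_zero: "word_transpose 0 = 0"
  by (simp add: word_transpose_def zero_fword_def)
lemma chevalley_scale: "chevalley (scaleU c u) = scaleU c (chevalley u)"
  by transfer (simp add: falg_transpose_mult falg_transpose_single word_transpose_zero falg_scalar_commute
      ueq_def gl3_ideal.zero)
lemma chevalley_one [simp]: "chevalley 1 = 1"
  by transfer (simp add: falg_transpose_single word_transpose_zero ueq_def gl3_ideal.zero flip: single_one)
lemma falg_transpose_involution: "falg_transpose (falg_transpose p) = p"
proof (induction p rule: poly_mapping_single_induct)
  case (2 w c p)
  have "word_transpose (word_transpose w) = w"
    by (simp add: word_transpose_def rev_map comp_def)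
  with 2 show ?case by (simp add: falg_transpose_add falg_transpose_single)
qed simp
lemma chevalley_involution [simp]: "chevalley (chevalley u) = u"
  by transfer (simp add: falg_transpose_involution ueq_def gl3_ideal.zero)

lemma chevalley_centre: "z \<in> centre \<Longrightarrow> chevalley z \<in> centre"
  unfolding centre_def
proof safe
  fix u assume z: "\<forall>u. z * u = u * z"
  then have "chevalley (z * chevalley u) = chevalley (chevalley u * z)" by simp
  then show "chevalley z * u = u * chevalley z" by (simp add: chevalley_mult)
qed

lemma chevalley_commutator_space: "u \<in> commutator_space \<Longrightarrow> chevalley u \<in> commutator_space"
  unfolding commutator_space_def
proof (induction rule: ugl3.span_induct_alt)
  case base show ?case by (simp add: ugl3.span_zero)
next
  case (step c x y)
  then obtain u v where x: "x = u * v - v * u" by blast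
  have "chevalley x = chevalley v * chevalley u - chevalley u * chevalley v"
    by (simp add: x chevalley_diff chevalley_mult)
  then have "chevalley x \<in> ugl3.span {u * v - v * u |u v. True}"
    by (intro ugl3.span_base) blast
  with step show ?case by (simp add: chevalley_add chevalley_scale ugl3.span_add ugl3.span_scale)
qed

lemma sharp_chevalley: "sharp (chevalley u) = chevalley (sharp u)"
  using chevalley_commutator_space[OF sharp_props(2)[of u]]
  by (intro sharp_unique) (simp_all add: chevalley_centre sharp_props chevalley_diff)

lemma chevalley_triangular_complement:
  "u \<in> triangular_complement \<Longrightarrow> chevalley u \<in> triangular_complement"
proof (induction rule: triangular_complement_induct)
  case zero then show ?case by (simp add: triangular_complement_subspace)
next
  case (lower c y u v)
  have "chevalley u * chevalley y \<in> triangular_complement"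
    using lower(1) by (intro triangular_complement_upper) auto
  with lower show ?case
    by (simp add: chevalley_add chevalley_scale chevalley_mult triangular_complement_subspace)
next
  case (upper c x u v)
  have "chevalley x * chevalley u \<in> triangular_complement"
    using upper(1) by (intro triangular_complement_lower) auto
  with upper show ?case
    by (simp add: chevalley_add chevalley_scale chevalley_mult triangular_complement_subspace)
qed

lemma E_diag_pow_commute: "E i i ^ m * E j j ^ n = E j j ^ n * E i i ^ m"
proof -
  have "E i i ^ m * E j j = E j j * E i i ^ m" for m
    using power_commuting_commutes[OF E_diag_commute[of i j], of m] by simp
  from power_commuting_commutes[OF this[symmetric], of n] show ?thesis by simp
qed

lemma chevalley_E_power: "chevalley (E i i ^ n) = E i i ^ n"
  by (induction n) (simp_all add: chevalley_mult power_commutes)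

lemma chevalley_sym_h: "chevalley (sym_h_to_U P) = sym_h_to_U P"
proof -
  have m: "chevalley (cartan_monomial m) = cartan_monomial m" for m
    by (simp add: chevalley_mult chevalley_E_power)
       (metis (no_types) E_diag_pow_commute mult.assoc)
  have s: "chevalley (sum f A) = (\<Sum>x\<in>A. chevalley (f x))" for f and A :: "(nat \<times> nat \<times> nat) set"
    by (induction A rule: infinite_finite_induct) (simp_all add: chevalley_add)
  show ?thesis
    by (simp only: sym_h_to_U_superset[OF finite_keys order_refl] s chevalley_scale m)
qed

text \<open>
  The transposition exchanges \<open>n\<^sub>- U\<close> and \<open>U n\<^sub>+\<close> and fixes
  \<open>S(h)\<close>, so it does not change the Harish-Chandra projection.
\<close>

lemma vacuum_chevalley: "vacuum \<alpha> (chevalley u) = vacuum \<alpha> u"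
proof -
  obtain P where P: "u - sym_h_to_U P \<in> triangular_complement"
    using triangular_decomposition by blast
  have "chevalley u - sym_h_to_U P \<in> triangular_complement"
    using chevalley_triangular_complement[OF P] by (simp add: chevalley_diff chevalley_sym_h)
  then have "harish_chandra (chevalley u) = harish_chandra u"
    using P harish_chandra_unique by metis
  then show ?thesis using sym_h_eval_harish_chandra by metis
qed

definition trace_functional :: "complex \<Rightarrow> ugl3 \<Rightarrow> complex" where
  "trace_functional \<alpha> u = vacuum \<alpha> (sharp u)"

lemma formU_trace: "formU \<alpha> u v = trace_functional \<alpha> (u * chevalley v)"
  by (simp add: formU_def trace_functional_def sym_h_eval_harish_chandra)

lemma trace_functional_add: "trace_functional \<alpha> (u + v) = trace_functional \<alpha> u + trace_functional \<alpha> v"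
  by (simp add: trace_functional_def sharp_add vacuum_linear)
lemma trace_functional_scale: "trace_functional \<alpha> (scaleU c u) = c * trace_functional \<alpha> u"
  by (simp add: trace_functional_def sharp_scale vacuum_linear)
lemma trace_functional_zero [simp]: "trace_functional \<alpha> 0 = 0"
  using trace_functional_scale[of \<alpha> 0 0] by simp
lemma trace_functional_diff: "trace_functional \<alpha> (u - v) = trace_functional \<alpha> u - trace_functional \<alpha> v"
  using trace_functional_add[of \<alpha> "u - v" v] by simp
lemma trace_functional_sum: "trace_functional \<alpha> (sum f A) = (\<Sum>x\<in>A. trace_functional \<alpha> (f x))"
  by (induction A rule: infinite_finite_induct) (simp_all add: trace_functional_add)
lemma trace_functional_commute: "trace_functional \<alpha> (u * v) = trace_functional \<alpha> (v * u)"
proof -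
  have "trace_functional \<alpha> (u * v - v * u) = vacuum \<alpha> 0"
    by (simp only: trace_functional_def sharp_commutator)
  moreover have "vacuum \<alpha> 0 = 0" using vacuum_linear(2)[of \<alpha> 0 0] by simp
  ultimately show ?thesis by (simp add: trace_functional_diff)
qed
lemma trace_functional_J: "u \<in> J_ideal \<alpha> \<Longrightarrow> trace_functional \<alpha> u = 0"
  by (simp add: trace_functional_def sharp_J vacuum_J)
lemma trace_functional_chevalley: "trace_functional \<alpha> (chevalley u) = trace_functional \<alpha> u"
  by (simp add: trace_functional_def sharp_chevalley vacuum_chevalley)

text \<open>
  By invariance under the transposition, \<open>\<tau>(u \<omega>(v)) = \<tau>(v \<omega>(u))\<close>,
  which reduces this to the other argument.
\<close>

lemma trace_functional_J_right: "v \<in> J_ideal \<alpha> \<Longrightarrow> trace_functional \<alpha> (u * chevalley v) = 0"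
  using trace_functional_chevalley[of \<alpha> "u * chevalley v"] trace_functional_J[OF J_rmult[of v \<alpha> "chevalley u"]]
  by (simp add: chevalley_mult)

text \<open>
  Independence of the representatives: \<open>\<tau>\<close> kills the annihilator in either
  argument.
\<close>

lemma formA_img: "formA \<alpha> (img \<alpha> u) (img \<alpha> v) = trace_functional \<alpha> (u * chevalley v)"
proof -
  have e: "formU \<alpha> a b = trace_functional \<alpha> (u * chevalley v)" if "a \<in> img \<alpha> u" "b \<in> img \<alpha> v" for a b
  proof -
    have "a * chevalley b = (a - u) * chevalley b + u * chevalley (b - v) + u * chevalley v"
      by (simp add: algebra_simps chevalley_diff)
    moreover have "trace_functional \<alpha> ((a - u) * chevalley b) = 0"
      using that by (intro trace_functional_J J_rmult) (simp add: in_img)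
    moreover have "trace_functional \<alpha> (u * chevalley (b - v)) = 0"
      using that by (intro trace_functional_J_right) (simp add: in_img)
    ultimately show ?thesis by (simp add: formU_trace trace_functional_add)
  qed
  have mem: "u \<in> img \<alpha> u" "v \<in> img \<alpha> v" by (simp_all add: in_img)
  show ?thesis unfolding formA_def
  proof (rule the_equality)
    show "\<forall>a\<in>img \<alpha> u. \<forall>b\<in>img \<alpha> v. formU \<alpha> a b = trace_functional \<alpha> (u * chevalley v)" using e by blast
  next
    fix c assume "\<forall>a\<in>img \<alpha> u. \<forall>b\<in>img \<alpha> v. formU \<alpha> a b = c"
    then show "c = trace_functional \<alpha> (u * chevalley v)" using e mem by metis
  qed
qed

text \<open>
  Cyclicity of \<open>\<tau>\<close>: \<open>\<tau>([x, u] w) = \<tau>(u [w, x])\<close>, and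
  \<open>[\<omega>(v), x] = \<omega>([\<omega>(x), v])\<close>.
\<close>

lemma trace_functional_adE:
  "trace_functional \<alpha> (adE (i, j) u * chevalley v) = trace_functional \<alpha> (u * chevalley (adE (j, i) v))"
proof -
  have "trace_functional \<alpha> (adE (i, j) u * chevalley v)
    = trace_functional \<alpha> (E i j * (u * chevalley v)) - trace_functional \<alpha> (u * E i j * chevalley v)"
    by (simp add: adE_def trace_functional_diff[symmetric] algebra_simps)
  also have "trace_functional \<alpha> (E i j * (u * chevalley v)) = trace_functional \<alpha> (u * chevalley v * E i j)"
    by (rule trace_functional_commute)
  also have "trace_functional \<alpha> (u * chevalley v * E i j) - trace_functional \<alpha> (u * E i j * chevalley v)
    = trace_functional \<alpha> (u * chevalley (adE (j, i) v))"
    by (simp add: adE_def trace_functional_diff[symmetric] chevalley_diff chevalley_mult algebra_simps)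
  finally show ?thesis .
qed

lemma trace_functional_casimir:
  "trace_functional \<alpha> (adU casimir u * chevalley v) = trace_functional \<alpha> (u * chevalley (adU casimir v))"
proof -
  have s: "chevalley (sum f A) = (\<Sum>x\<in>A. chevalley (f x))" for f and A :: "(3 \<times> 3) set"
    by (induction A rule: infinite_finite_induct) (simp_all add: chevalley_add)
  have "trace_functional \<alpha> (adE x (adE (prod.swap x) u) * chevalley v)
      = trace_functional \<alpha> (u * chevalley (adE x (adE (prod.swap x) v)))" for x
    by (cases x) (simp add: trace_functional_adE)
  then show ?thesis
    by (simp add: adU_casimir sum_distrib_right sum_distrib_left s trace_functional_sum)
qed

text \<open>Eigenvectors of a self-adjoint operator with different eigenvalues are orthogonal.\<close>

lemma formA_orthogonal:
  assumes adj: "\<And>u v. trace_functional \<alpha> (T u * chevalley v) = trace_functional \<alpha> (u * chevalley (T v))"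
    and u: "T u - scaleU c u \<in> J_ideal \<alpha>" and v: "T v - scaleU d v \<in> J_ideal \<alpha>" and ne: "c \<noteq> d"
  shows "formA \<alpha> (img \<alpha> u) (img \<alpha> v) = 0"
proof -
  let ?t = "trace_functional \<alpha> (u * chevalley v)"
  have "trace_functional \<alpha> ((T u - scaleU c u) * chevalley v) = 0"
    by (intro trace_functional_J J_rmult u)
  then have 1: "trace_functional \<alpha> (T u * chevalley v) = c * ?t"
    by (simp add: left_diff_distrib trace_functional_diff scaleU_mult_left trace_functional_scale)
  have "trace_functional \<alpha> (u * chevalley (T v - scaleU d v)) = 0"
    by (rule trace_functional_J_right[OF v])
  then have 2: "trace_functional \<alpha> (u * chevalley (T v)) = d * ?t"
    by (simp add: chevalley_diff chevalley_scale right_diff_distrib trace_functional_diff scaleU_mult_right trace_functional_scale)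
  have "c * ?t = d * ?t" using 1 2 adj[of u v] by metis
  then have "?t = 0" using ne by (metis mult_cancel_right)
  then show ?thesis by (simp add: formA_img)
qed

section \<open>Weight operators on monomials\<close>

subsection \<open>Falling factorials\<close>

text \<open>
  The falling factorial \<open>x(x - 1) \<cdots> (x - n + 1)\<close>, the coefficient of
  \<open>\<partial>\<^sup>n\<close> on a monomial.
\<close>

definition falling :: "complex \<Rightarrow> nat \<Rightarrow> complex" where
  "falling x n = (\<Prod>i<n. x - of_nat i)"

lemma falling_0 [simp]: "falling x 0 = 1" by (simp add: falling_def)
lemma falling_Suc: "falling x (Suc n) = falling x n * (x - of_nat n)" by (simp add: falling_def)

lemma falling_Suc': "falling x (Suc n) = x * falling (x - 1) n"
  unfolding falling_def prod.lessThan_Suc_shift by (simp add: algebra_simps)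

lemma falling_shift: "x * falling (x - 1) n = (x - of_nat n) * falling x n"
  using falling_Suc[of x n] falling_Suc'[of x n] by (simp add: mult.commute)

lemma falling_shift': "(x + 1 - of_nat n) * falling (x + 1) n = (x + 1) * falling x n"
  using falling_shift[of "x + 1" n] by simp

lemma falling_eq_0: "m < n \<Longrightarrow> falling (of_nat m) n = 0"
  by (auto simp: falling_def)

lemma falling_neq_0: "n \<le> m \<Longrightarrow> falling (of_nat m) n \<noteq> 0"
  by (auto simp: falling_def)

text \<open>
  With \<open>m = max 0 (-n)\<close>, the factor \<open>x + n\<close> either extends the falling
  factorial of length \<open>m\<close> (if \<open>n \<le> 0\<close>) or is an honest polynomial
  factor; \<open>falling_release\<close> is the reverse step.
\<close>

lemma falling_absorb: "\<exists>p. \<forall>x. (x + of_int n) * falling x (nat (- n)) = poly p x * falling x (nat (1 - n))"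
proof (cases "n \<le> 0")
  case True
  then have "nat (1 - n) = Suc (nat (- n))" by simp
  then have "\<forall>x. (x + of_int n) * falling x (nat (- n)) = poly 1 x * falling x (nat (1 - n))"
    using True by (simp add: falling_Suc of_nat_nat)
  then show ?thesis by blast
next
  case False
  then show ?thesis by (intro exI[of _ "[:of_int n, 1:]"]) (simp add: add.commute)
qed

lemma falling_release: "\<exists>p. \<forall>x. falling x (nat (- n)) = poly p x * falling x (nat (- 1 - n))"
proof (cases "n < 0")
  case True
  then have "nat (- n) = Suc (nat (- 1 - n))" by simp
  then have "\<forall>x. falling x (nat (- n)) = poly [:- of_nat (nat (- 1 - n)), 1:] x * falling x (nat (- 1 - n))"
    by (simp add: falling_Suc)
  then show ?thesis by blast
next
  case False
  then show ?thesis by (intro exI[of _ 1]) simp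
qed

subsection \<open>Operators of a given weight\<close>

definition wt :: "int ^ 3 \<Rightarrow> complex ^ 3" where
  "wt \<nu> = (\<chi> i. of_int (\<nu> $ i))"

lemma wt_nth [simp]: "wt \<nu> $ i = of_int (\<nu> $ i)" by (simp add: wt_def)
lemma wt_add: "wt (\<nu> + \<mu>) = wt \<nu> + wt \<mu>" by (simp add: vec_eq_iff)
lemma wt_0 [simp]: "wt 0 = 0" by (simp add: vec_eq_iff)
lemma wt_diff: "wt (\<nu> - \<mu>) = wt \<nu> - wt \<mu>" by (simp add: vec_eq_iff)
lemma wt_axis [simp]: "wt (axis i 1) = axis i 1" by (simp add: vec_eq_iff axis_def)
lemma wt_inject [simp]: "wt \<nu> = wt \<mu> \<longleftrightarrow> \<nu> = \<mu>" by (simp add: vec_eq_iff)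

text \<open>
  An operator of weight \<open>\<nu>\<close> on \<open>S\<^sup>\<alpha>(V)\<close> is a function
  \<open>c\<close> on exponents; only its values on the exponents of the module matter.
\<close>

definition acts :: "complex \<Rightarrow> ugl3 \<Rightarrow> int ^ 3 \<Rightarrow> (complex ^ 3 \<Rightarrow> complex) \<Rightarrow> bool" where
  "acts \<alpha> u \<nu> c \<longleftrightarrow>
     (\<forall>k\<in>S_exponents \<alpha>. rep u (Poly_Mapping.single k 1) = Poly_Mapping.single (k + wt \<nu>) (c k))"

lemma scaleS_single: "scaleS c (Poly_Mapping.single k d) = Poly_Mapping.single k (c * d)"
  by (simp add: scaleS_conv_mult mult_single)

lemma rep_single: "rep u (Poly_Mapping.single k c) = scaleS c (rep u (Poly_Mapping.single k 1))"
  by (simp add: scaleS_single flip: rep_arg_scale)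

lemma actsD: "acts \<alpha> u \<nu> c \<Longrightarrow> k \<in> S_exponents \<alpha> \<Longrightarrow>
    rep u (Poly_Mapping.single k d) = Poly_Mapping.single (k + wt \<nu>) (d * c k)"
  by (subst rep_single) (simp add: acts_def scaleS_single)

lemma acts_support: "acts \<alpha> u \<nu> c \<Longrightarrow> k \<in> S_exponents \<alpha> \<Longrightarrow> c k = 0 \<or> k + wt \<nu> \<in> S_exponents \<alpha>"
  using rep_S_mod[of "Poly_Mapping.single k 1" \<alpha> u] by (simp add: acts_def S_mod_single)

lemma acts_E: "acts \<alpha> (E i j) (axis i 1 - axis j 1) (\<lambda>k. k $ j)"
  by (simp add: acts_def rep_E xd_single wt_diff algebra_simps)

lemma acts_mult:
  assumes "acts \<alpha> u \<nu> c" "acts \<alpha> v \<mu> d"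
  shows "acts \<alpha> (u * v) (\<nu> + \<mu>) (\<lambda>k. c (k + wt \<mu>) * d k)"
  unfolding acts_def
proof
  fix k assume k: "k \<in> S_exponents \<alpha>"
  show "rep (u * v) (Poly_Mapping.single k 1) = Poly_Mapping.single (k + wt (\<nu> + \<mu>)) (c (k + wt \<mu>) * d k)"
    using acts_support[OF assms(2) k]
  proof
    assume "d k = 0"
    then show ?thesis using actsD[OF assms(2) k, of 1] by (simp add: rep_mult)
  next
    assume "k + wt \<mu> \<in> S_exponents \<alpha>"
    then show ?thesis using actsD[OF assms(2) k, of 1] actsD[OF assms(1)]
      by (simp add: rep_mult wt_add algebra_simps)
  qed
qed

lemma acts_add: "acts \<alpha> u \<nu> c \<Longrightarrow> acts \<alpha> v \<nu> d \<Longrightarrow> acts \<alpha> (u + v) \<nu> (\<lambda>k. c k + d k)"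
  by (simp add: acts_def rep_add single_add)
lemma acts_diff: "acts \<alpha> u \<nu> c \<Longrightarrow> acts \<alpha> v \<nu> d \<Longrightarrow> acts \<alpha> (u - v) \<nu> (\<lambda>k. c k - d k)"
  by (simp add: acts_def rep_diff single_diff)
lemma acts_scale: "acts \<alpha> u \<nu> c \<Longrightarrow> acts \<alpha> (scaleU r u) \<nu> (\<lambda>k. r * c k)"
  by (simp add: acts_def rep_scaleU scaleS_single)
lemma acts_cong: "acts \<alpha> u \<nu> c \<Longrightarrow> \<nu> = \<mu> \<Longrightarrow> (\<And>k. k \<in> S_exponents \<alpha> \<Longrightarrow> c k = d k) \<Longrightarrow> acts \<alpha> u \<mu> d"
  by (simp add: acts_def)
lemma acts_zero: "acts \<alpha> 0 \<nu> (\<lambda>_. 0)"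
  by (simp add: acts_def)
lemma acts_J_iff: "acts \<alpha> u \<nu> c \<Longrightarrow> u \<in> J_ideal \<alpha> \<longleftrightarrow> (\<forall>k\<in>S_exponents \<alpha>. c k = 0)"
  by (auto simp: J_iff acts_def) (metis lookup_single_eq lookup_zero)

lemma acts_eq: "acts \<alpha> u \<nu> c \<Longrightarrow> acts \<alpha> v \<nu> c \<Longrightarrow> u - v \<in> J_ideal \<alpha>"
  using acts_diff[of \<alpha> u \<nu> c v c] by (simp add: acts_J_iff)

lemma acts_adE:
  assumes "acts \<alpha> u \<nu> c"
  shows "acts \<alpha> (adE (i, j) u) (\<nu> + axis i 1 - axis j 1)
    (\<lambda>k. (k $ j + of_int (\<nu> $ j)) * c k - k $ j * c (k + axis i 1 - axis j 1))"
  unfolding adE_def prod.case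
  by (rule acts_cong[OF acts_diff[OF acts_mult[OF acts_E assms] acts_cong[OF acts_mult[OF assms acts_E]]]])
     (auto simp: wt_diff algebra_simps)

lemma single_sum: "Poly_Mapping.single k (sum f A) = (\<Sum>i\<in>A. Poly_Mapping.single k (f i))"
  by (induction A rule: infinite_finite_induct) (simp_all add: single_add)

lemma rep_poly_E33: "rep (poly_E33 f) (Poly_Mapping.single k c) = Poly_Mapping.single k (poly f (k $ 3) * c)"
proof -
  have pow: "rep (E 3 3 ^ n) (Poly_Mapping.single k c) = Poly_Mapping.single k (c * (k $ 3) ^ n)" for n
    by (induction n) (simp_all add: rep_mult rep_E xd_single mult_ac)
  have s: "rep (sum g A) x = (\<Sum>i\<in>A. rep (g i) x)" for g x and A :: "nat set"
    by (induction A rule: infinite_finite_induct) (simp_all add: rep_add)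
  show ?thesis
    by (simp add: poly_E33_def s rep_scaleU pow scaleS_single poly_altdef sum_distrib_right mult_ac flip: single_sum sum_distrib_left)
qed

lemma acts_poly_E33: "acts \<alpha> (poly_E33 f) 0 (\<lambda>k. poly f (k $ 3))"
  by (simp add: acts_def rep_poly_E33)

lemma acts_poly_mult:
  "acts \<alpha> u \<nu> c \<Longrightarrow> acts \<alpha> (poly_E33 f * u) \<nu> (\<lambda>k. poly f (k $ 3 + of_int (\<nu> $ 3)) * c k)"
  by (rule acts_cong[OF acts_mult[OF acts_poly_E33]]) auto

lemma acts_E_power:
  assumes "i \<noteq> j"
  shows "acts \<alpha> (E i j ^ n) (int n *s (axis i 1 - axis j 1)) (\<lambda>k. falling (k $ j) n)"
proof (induction n)
  case 0
  show ?case by (simp add: acts_def)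
next
  case (Suc n)
  show ?case unfolding power_Suc
    by (rule acts_cong[OF acts_mult[OF acts_E Suc]])
       (use assms in \<open>auto simp: vec_eq_iff axis_def falling_Suc algebra_simps\<close>)
qed

fun word_wt :: "(3 \<times> 3) list \<Rightarrow> int ^ 3" where
  "word_wt [] = 0"
| "word_wt ((i, j) # w) = axis i 1 - axis j 1 + word_wt w"

fun word_fun :: "(3 \<times> 3) list \<Rightarrow> complex ^ 3 \<Rightarrow> complex" where
  "word_fun [] k = 1"
| "word_fun ((i, j) # w) k = (k $ j + of_int (word_wt w $ j)) * word_fun w k"

lemma acts_word: "acts \<alpha> (word w) (word_wt w) (word_fun w)"
proof (induction w)
  case Nil show ?case by (simp add: acts_def)
next
  case (Cons x w)
  obtain i j where x: "x = (i, j)" by fastforce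
  show ?case unfolding x word_simps
    by (rule acts_cong[OF acts_mult[OF acts_E Cons]]) auto
qed

subsection \<open>Highest weight vectors as operators\<close>

lemma A_plus_wt_iff:
  "img \<alpha> u \<in> A_plus_wt \<alpha> \<nu> \<longleftrightarrow>
     adE (1, 2) u \<in> J_ideal \<alpha> \<and> (\<forall>i. adE (i, i) u - scaleU (of_int (\<nu> $ i)) u \<in> J_ideal \<alpha>)"
proof -
  have cart: "cartan h * u - u * cartan h = (\<Sum>i\<in>UNIV. scaleU (h $ i) (adE (i, i) u))" for h
    by (simp add: cartan_def adE_def sum_distrib_left sum_distrib_right scaleU_mult_left scaleU_mult_right
        ugl3.scale_right_diff_distrib sum_subtractf)
  have sc: "scaleU (\<Sum>i\<in>UNIV. h $ i * of_int (\<nu> $ i)) u = (\<Sum>i\<in>UNIV. scaleU (h $ i) (scaleU (of_int (\<nu> $ i)) u))"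
    for h :: "complex ^ 3"
    by (simp add: ugl3.scale_sum_left)
  have "(\<forall>h :: complex ^ 3. (\<Sum>i\<in>UNIV. scaleU (h $ i) (adE (i, i) u - scaleU (of_int (\<nu> $ i)) u)) \<in> J_ideal \<alpha>)
     \<longleftrightarrow> (\<forall>i. adE (i, i) u - scaleU (of_int (\<nu> $ i)) u \<in> J_ideal \<alpha>)" (is "?L \<longleftrightarrow> ?R")
  proof
    assume L: ?L
    show ?R
    proof
      fix i
      have "(\<Sum>l\<in>UNIV. scaleU (axis i 1 $ l) (adE (l, l) u - scaleU (of_int (\<nu> $ l)) u))
        = (\<Sum>l\<in>UNIV. if i = l then (adE (l, l) u - scaleU (of_int (\<nu> $ l)) u) else 0)"
        by (intro sum.cong) (auto simp: axis_def)
      then show "adE (i, i) u - scaleU (of_int (\<nu> $ i)) u \<in> J_ideal \<alpha>"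
        using L[rule_format, of "axis i 1"] by simp
    qed
  next
    assume ?R then show ?L by (auto simp: sum_3 intro!: J_add J_scale)
  qed
  moreover have "adE (1, 2) u \<in> J_ideal \<alpha> \<longleftrightarrow> img \<alpha> (E 1 2 * u - u * E 1 2) = \<zero>\<^bsub>\<AA> \<alpha>\<^esub>"
    by (simp add: A_zero img_eq_iff adE_def)
  ultimately show ?thesis
    by (simp add: A_plus_wt_def A_plus_def carrier_A rangeI bracketA_img scaleA_img img_eq_iff cart sc
        ugl3.scale_right_diff_distrib flip: sum_subtractf)
qed

lemma A_plus_wt_img: "v \<in> A_plus_wt \<alpha> \<nu> \<Longrightarrow> \<exists>u. v = img \<alpha> u"
  by (auto simp: A_plus_wt_def A_plus_def carrier_A)

lemma lookup_xd_diag: "Poly_Mapping.lookup (xd i i v) l = l $ i * Poly_Mapping.lookup v l"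
  by (induction v rule: poly_mapping_single_induct)
     (auto simp: xd_add lookup_add xd_single lookup_single when_def algebra_simps)

text \<open>
  Comparing both sides of \<open>[E\<^sub>i\<^sub>i, u] \<equiv> \<nu>\<^sub>i u\<close> on a
  monomial, the words of other weights cancel out modulo the annihilator.
\<close>

lemma weight_component:
  assumes W: "finite W" and u: "u = (\<Sum>w\<in>W. scaleU (a w) (word w))"
    and wt: "\<And>i. adE (i, i) u - scaleU (of_int (\<nu> $ i)) u \<in> J_ideal \<alpha>"
  shows "acts \<alpha> u \<nu> (\<lambda>k. \<Sum>w\<in>{w\<in>W. word_wt w = \<nu>}. a w * word_fun w k)"
  unfolding acts_def
proof
  fix k assume k: "k \<in> S_exponents \<alpha>"
  define V where "V = rep u (Poly_Mapping.single k 1)"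
  have s: "rep (sum g A) x = (\<Sum>i\<in>A. rep (g i) x)" for g x and A :: "(3 \<times> 3) list set"
    by (induction A rule: infinite_finite_induct) (simp_all add: rep_add)
  have V: "V = (\<Sum>w\<in>W. Poly_Mapping.single (k + wt (word_wt w)) (a w * word_fun w k))"
    unfolding V_def u s rep_scaleU using acts_word[of \<alpha>] k by (simp add: acts_def scaleS_single)
  have "Poly_Mapping.lookup V l = 0" if l: "l \<noteq> k + wt \<nu>" for l
  proof -
    obtain i where i: "l $ i \<noteq> k $ i + of_int (\<nu> $ i)" using l by (auto simp: vec_eq_iff)
    have "rep (adE (i, i) u - scaleU (of_int (\<nu> $ i)) u) (Poly_Mapping.single k 1) = 0"
      using wt[of i] k by (simp add: J_iff)
    moreover have "rep (adE (i, i) u - scaleU (of_int (\<nu> $ i)) u) (Poly_Mapping.single k 1)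
      = xd i i V - scaleS (k $ i) V - scaleS (of_int (\<nu> $ i)) V"
      unfolding V_def adE_def
      by (simp add: rep_diff rep_mult rep_E rep_scaleU xd_single) (subst rep_single, simp)
    ultimately have "Poly_Mapping.lookup (xd i i V - scaleS (k $ i) V - scaleS (of_int (\<nu> $ i)) V) l = 0"
      by simp
    then have "(l $ i - (k $ i + of_int (\<nu> $ i))) * Poly_Mapping.lookup V l = 0"
      by (simp add: lookup_minus lookup_add lookup_xd_diag scaleS_def map.rep_eq when_def algebra_simps split: if_splits)
    then show ?thesis using i by simp
  qed
  moreover have "Poly_Mapping.lookup V (k + wt \<nu>) = (\<Sum>w\<in>{w\<in>W. word_wt w = \<nu>}. a w * word_fun w k)"
    using W by (simp add: V lookup_sum lookup_single when_def sum.If_cases Int_def eq_commute[of "word_wt _"] cong: if_cong)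
  ultimately show "rep u (Poly_Mapping.single k 1) =
      Poly_Mapping.single (k + wt \<nu>) (\<Sum>w\<in>{w\<in>W. word_wt w = \<nu>}. a w * word_fun w k)"
    unfolding V_def[symmetric] by (intro poly_mapping_eqI) (auto simp: lookup_single when_def)
qed

subsection \<open>Exponent grids and slices\<close>

text \<open>
  Coordinates on the exponents of total degree \<open>\<alpha>\<close>; complex arguments are
  allowed so that coefficient functions can be treated as polynomials along lines.
\<close>

definition pt :: "complex \<Rightarrow> complex \<Rightarrow> complex \<Rightarrow> complex ^ 3" where
  "pt \<alpha> m z = vector [\<alpha> - m - z, m, z]"

lemma pt_nth [simp]: "pt \<alpha> m z $ 1 = \<alpha> - m - z" "pt \<alpha> m z $ 2 = m" "pt \<alpha> m z $ 3 = z"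
  by (simp_all add: pt_def vector_3)

text \<open>
  The condition that \<open>d\<close> derivatives do not annihilate
  \<open>S\<^sup>\<alpha>(V)\<close>: void unless \<open>\<alpha>\<close> is a natural number.
\<close>

definition allowed :: "complex \<Rightarrow> nat \<Rightarrow> bool" where
  "allowed \<alpha> d \<longleftrightarrow> (\<forall>A. \<alpha> = of_nat A \<longrightarrow> d \<le> A)"

lemma allowed_mono: "allowed \<alpha> d \<Longrightarrow> d' \<le> d \<Longrightarrow> allowed \<alpha> d'"
  by (auto simp: allowed_def)
lemma allowed_of_nat [simp]: "allowed (of_nat A) d \<longleftrightarrow> d \<le> A"
  by (auto simp: allowed_def)
lemma allowed_not_Nats: "\<alpha> \<notin> \<nat> \<Longrightarrow> allowed \<alpha> d"
  by (auto simp: allowed_def)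

lemma pt_in_S: "pt \<alpha> (of_nat m) (of_nat n) \<in> S_exponents \<alpha> \<longleftrightarrow> allowed \<alpha> (m + n)"
proof (cases "\<alpha> \<in> \<nat>")
  case True
  then obtain A where A: "\<alpha> = of_nat A" by (elim Nats_cases)
  have "\<alpha> - of_nat m - of_nat n \<in> \<nat> \<longleftrightarrow> m + n \<le> A"
  proof
    assume "\<alpha> - of_nat m - of_nat n \<in> \<nat>"
    then obtain r where "\<alpha> - of_nat m - of_nat n = of_nat r" by (elim Nats_cases)
    then have "(of_nat A :: complex) = of_nat (r + m + n)" by (simp add: A algebra_simps)
    then show "m + n \<le> A" by (simp only: of_nat_eq_iff)
  next
    assume "m + n \<le> A"
    then have "\<alpha> - of_nat m - of_nat n = of_nat (A - (m + n))" by (simp add: A of_nat_diff)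
    then show "\<alpha> - of_nat m - of_nat n \<in> \<nat>" by simp
  qed
  then show ?thesis using True A by (simp add: S_exponents_def)
next
  case False
  then show ?thesis by (simp add: S_exponents_def allowed_not_Nats)
qed

lemma S_cases:
  assumes "k \<in> S_exponents \<alpha>"
  obtains m n where "k = pt \<alpha> (of_nat m) (of_nat n)" "allowed \<alpha> (m + n)"
proof -
  obtain m n where mn: "k $ 2 = of_nat m" "k $ 3 = of_nat n" "k $ 1 + k $ 2 + k $ 3 = \<alpha>"
    using assms by (auto simp: S_exponents_def elim!: Nats_cases)
  have "k = pt \<alpha> (of_nat m) (of_nat n)"
    using mn by (auto simp: vec_eq_iff forall_3)
  then show ?thesis using that pt_in_S assms by metis
qed

text \<open>
  An operator that lowers the exponent of \<open>x\<^sub>1\<close> or \<open>x\<^sub>3\<close> by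
  \<open>m\<close> contains \<open>m\<close> derivatives in that variable, which accounts for the
  falling factorials.
\<close>

lemma word_fun_slice:
  "\<exists>p. \<forall>z. word_fun w (pt \<alpha> m z)
     = poly p z * falling (\<alpha> - m - z) (nat (- word_wt w $ 1)) * falling z (nat (- word_wt w $ 3))"
proof (induction w)
  case Nil show ?case by (intro exI[of _ 1]) simp
next
  case (Cons x w)
  obtain i j where x: "x = (i, j)" by fastforce
  define \<nu> where "\<nu> = word_wt w"
  obtain p where p: "\<And>z. word_fun w (pt \<alpha> m z)
     = poly p z * falling (\<alpha> - m - z) (nat (- \<nu> $ 1)) * falling z (nat (- \<nu> $ 3))"
    using Cons unfolding \<nu>_def by blast
  obtain a1 where a1: "\<And>x. (x + of_int (\<nu> $ 1)) * falling x (nat (- \<nu> $ 1)) = poly a1 x * falling x (nat (1 - \<nu> $ 1))"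
    using falling_absorb by blast
  obtain a3 where a3: "\<And>x. (x + of_int (\<nu> $ 3)) * falling x (nat (- \<nu> $ 3)) = poly a3 x * falling x (nat (1 - \<nu> $ 3))"
    using falling_absorb by blast
  obtain r1 where r1: "\<And>x. falling x (nat (- \<nu> $ 1)) = poly r1 x * falling x (nat (- 1 - \<nu> $ 1))"
    using falling_release by blast
  obtain r3 where r3: "\<And>x. falling x (nat (- \<nu> $ 3)) = poly r3 x * falling x (nat (- 1 - \<nu> $ 3))"
    using falling_release by blast
  define l where "l = [:\<alpha> - m, -1:]"
  have l: "poly l z = \<alpha> - m - z" for z by (simp add: l_def)
  have F: "word_fun (x # w) (pt \<alpha> m z) = (pt \<alpha> m z $ j + of_int (\<nu> $ j)) *
     (poly p z * falling (\<alpha> - m - z) (nat (- \<nu> $ 1)) * falling z (nat (- \<nu> $ 3)))" for z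
    by (simp add: x p \<nu>_def[symmetric])
  let ?w1 = "word_wt (x # w) $ 1" and ?w3 = "word_wt (x # w) $ 3"
  have w1: "?w1 = \<nu> $ 1 + (if i = 1 then 1 else 0) - (if j = 1 then 1 else 0)"
    and w3: "?w3 = \<nu> $ 3 + (if i = 3 then 1 else 0) - (if j = 3 then 1 else 0)"
    by (simp_all add: x \<nu>_def axis_def)
  consider "i = j" | "i \<noteq> j" by blast
  then show ?case
  proof cases
    case 1
    then have w: "?w1 = \<nu> $ 1" "?w3 = \<nu> $ 3" using w1 w3 by auto
    obtain q where q: "\<And>z. poly q z = pt \<alpha> m z $ j + of_int (\<nu> $ j)"
    proof -
      have "\<exists>q. \<forall>z. poly q z = pt \<alpha> m z $ j + of_int (\<nu> $ j)"
        using exhaust_3[of j]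
        by (elim disjE) (rule exI[of _ "l + [:of_int (\<nu> $ 1):]"], simp add: l,
          rule exI[of _ "[:m + of_int (\<nu> $ 2):]"], simp, rule exI[of _ "[:of_int (\<nu> $ 3), 1:]"], simp)
      then show ?thesis using that by blast
    qed
    show ?thesis unfolding F w by (intro exI[of _ "q * p"]) (simp add: q)
  next
    case 2
    have "\<exists>q1. \<forall>z. (if j = 1 then \<alpha> - m - z + of_int (\<nu> $ 1) else 1) * falling (\<alpha> - m - z) (nat (- \<nu> $ 1))
       = poly q1 z * falling (\<alpha> - m - z) (nat (- ?w1))"
    proof -
      consider "j = 1" | "j \<noteq> 1" "i = 1" | "j \<noteq> 1" "i \<noteq> 1" by blast
      then show ?thesis
      proof cases
        case j: 1
        then have "- ?w1 = 1 - \<nu> $ 1" using w1 2 by simp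
        then show ?thesis using j by (intro exI[of _ "a1 \<circ>\<^sub>p l"]) (simp add: poly_pcompose l a1)
      next
        case j: 2
        then have "- ?w1 = - 1 - \<nu> $ 1" using w1 by simp
        then show ?thesis using j r1 by (intro exI[of _ "r1 \<circ>\<^sub>p l"]) (simp add: poly_pcompose l)
      next
        case j: 3
        then show ?thesis using w1 by (intro exI[of _ 1]) simp
      qed
    qed
    then obtain q1 where q1: "\<And>z. (if j = 1 then \<alpha> - m - z + of_int (\<nu> $ 1) else 1) * falling (\<alpha> - m - z) (nat (- \<nu> $ 1))
       = poly q1 z * falling (\<alpha> - m - z) (nat (- ?w1))" by blast
    have "\<exists>q3. \<forall>z. (if j = 3 then z + of_int (\<nu> $ 3) else 1) * falling z (nat (- \<nu> $ 3))
       = poly q3 z * falling z (nat (- ?w3))"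
    proof -
      consider "j = 3" | "j \<noteq> 3" "i = 3" | "j \<noteq> 3" "i \<noteq> 3" by blast
      then show ?thesis
      proof cases
        case j: 1
        then have "- ?w3 = 1 - \<nu> $ 3" using w3 2 by simp
        then show ?thesis using j by (intro exI[of _ a3]) (simp add: a3)
      next
        case j: 2
        then have "- ?w3 = - 1 - \<nu> $ 3" using w3 by simp
        then show ?thesis using j r3 by (intro exI[of _ r3]) simp
      next
        case j: 3
        then show ?thesis using w3 by (intro exI[of _ 1]) simp
      qed
    qed
    then obtain q3 where q3: "\<And>z. (if j = 3 then z + of_int (\<nu> $ 3) else 1) * falling z (nat (- \<nu> $ 3))
       = poly q3 z * falling z (nat (- ?w3))" by blast
    define q2 where "q2 = (if j = 2 then [:m + of_int (\<nu> $ 2):] else 1)"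
    have "word_fun (x # w) (pt \<alpha> m z) = poly (p * q2) z *
       (poly q1 z * falling (\<alpha> - m - z) (nat (- ?w1))) * (poly q3 z * falling z (nat (- ?w3)))" for z
      unfolding F q1[symmetric] q3[symmetric] q2_def
      using exhaust_3[of j] by (elim disjE) (simp_all add: mult_ac)
    then show ?thesis by (intro exI[of _ "p * q2 * q1 * q3"]) (simp add: mult_ac)
  qed
qed

text \<open>
  On the line \<open>k\<^sub>1 = 0\<close> each letter contributes one affine factor. This is how
  the standard filtration is seen by the coefficient functions.
\<close>

lemma word_fun_edge: "\<exists>p. Polynomial.degree p \<le> length w \<and> (\<forall>z. word_fun w (pt \<alpha> (\<alpha> - z) z) = poly p z)"
proof (induction w)
  case Nil show ?case by (intro exI[of _ 1]) simp
next
  case (Cons x w)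
  obtain i j where x: "x = (i, j)" by fastforce
  obtain p where p: "Polynomial.degree p \<le> length w" "\<And>z. word_fun w (pt \<alpha> (\<alpha> - z) z) = poly p z"
    using Cons by blast
  have "\<exists>q. Polynomial.degree q \<le> 1 \<and> (\<forall>z. poly q z = pt \<alpha> (\<alpha> - z) z $ j + of_int (word_wt w $ j))"
    using exhaust_3[of j]
    by (elim disjE) (rule exI[of _ "[:of_int (word_wt w $ 1):]"], simp,
      rule exI[of _ "[:\<alpha> + of_int (word_wt w $ 2), -1:]"], simp,
      rule exI[of _ "[:of_int (word_wt w $ 3), 1:]"], simp)
  then obtain q where q: "Polynomial.degree q \<le> 1" "\<And>z. poly q z = pt \<alpha> (\<alpha> - z) z $ j + of_int (word_wt w $ j)" by blast
  have "Polynomial.degree (q * p) \<le> length (x # w)" using degree_mult_le[of q p] p(1) q(1) by simp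
  then show ?case by (intro exI[of _ "q * p"]) (simp add: x p q)
qed

section \<open>The generators\<close>

lemma falling_add: "falling x (m + n) = falling x m * falling (x - of_nat m) n"
  by (induction n) (simp_all add: falling_Suc algebra_simps)

definition falling_poly :: "nat \<Rightarrow> complex poly" where
  "falling_poly n = (\<Prod>i<n. [:- of_nat i, 1:])"

lemma poly_falling_poly [simp]: "poly (falling_poly n) x = falling x n"
  by (simp add: falling_poly_def falling_def poly_prod)

lemma degree_falling_poly [simp]: "Polynomial.degree (falling_poly n) = n"
  unfolding falling_poly_def by (subst degree_prod_eq_sum_degree) auto

lemma falling_poly_neq_0 [simp]: "falling_poly n \<noteq> 0"
  by (simp add: falling_poly_def)

lemma poly_eq_infinite:
  fixes p q :: "complex poly"
  assumes "infinite A" "\<And>z. z \<in> A \<Longrightarrow> poly p z = poly q z"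
  shows "p = q"
proof (rule ccontr)
  assume "p \<noteq> q"
  then have "finite {z. poly (p - q) z = 0}" by (intro poly_roots_finite) simp
  moreover have "A \<subseteq> {z. poly (p - q) z = 0}" using assms(2) by auto
  ultimately show False using assms(1) finite_subset by blast
qed

lemma poly_eq_card:
  fixes p q :: "complex poly"
  assumes "finite A" "\<And>z. z \<in> A \<Longrightarrow> poly p z = poly q z"
    "Polynomial.degree p < card A" "Polynomial.degree q < card A"
  shows "p = q"
proof (rule ccontr)
  assume "p \<noteq> q"
  then have "card {z. poly (p - q) z = 0} \<le> Polynomial.degree (p - q)"
    by (intro card_poly_roots_bound) simp
  also have "\<dots> < card A" using assms(3,4) degree_diff_less by blast
  also have "card A \<le> card {z. poly (p - q) z = 0}"
    using \<open>p \<noteq> q\<close> assms(2) by (intro card_mono poly_roots_finite) auto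
  finally show False by simp
qed

definition dominant :: "int ^ 3 \<Rightarrow> bool" where
  "dominant \<nu> \<longleftrightarrow> \<nu> \<in> root_lattice \<and> \<nu> $ 1 \<ge> 0 \<and> \<nu> $ 2 \<le> 0"

text \<open>
  The generator \<open>E\<^sub>1\<^sub>2\<^sup>a E\<^sub>1\<^sub>3\<^sup>b\<close> or
  \<open>E\<^sub>1\<^sub>2\<^sup>a E\<^sub>3\<^sub>2\<^sup>b\<close>, according to the sign of
  \<open>\<nu>(E\<^sub>3\<^sub>3)\<close>; its factors commute with each other and with
  \<open>E\<^sub>1\<^sub>2\<close>.
\<close>

definition std :: "int ^ 3 \<Rightarrow> ugl3" where
  "std \<nu> = (if \<nu> $ 3 \<le> 0 then E 1 2 ^ nat (- \<nu> $ 2) * E 1 3 ^ nat (- \<nu> $ 3)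
     else E 1 2 ^ nat (\<nu> $ 1) * E 3 2 ^ nat (\<nu> $ 3))"

definition std_coeff :: "int ^ 3 \<Rightarrow> complex ^ 3 \<Rightarrow> complex" where
  "std_coeff \<nu> k = falling (k $ 2) (nat (- \<nu> $ 2)) * falling (k $ 3) (nat (- \<nu> $ 3))"

text \<open>
  For a dominant weight this is \<open>max \<nu>\<^sub>1 (-\<nu>\<^sub>2)\<close>, the number of
  factors of \<open>std \<nu>\<close>.
\<close>

definition width :: "int ^ 3 \<Rightarrow> nat" where
  "width \<nu> = nat (- \<nu> $ 2) + nat (- \<nu> $ 3)"

text \<open>
  The least eigenvalue of \<open>E\<^sub>3\<^sub>3\<close> on the range of \<open>std
  \<nu>\<close>.
\<close>

definition base :: "int ^ 3 \<Rightarrow> nat" where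
  "base \<nu> = nat (\<nu> $ 3)"

lemma dominant_sum: "dominant \<nu> \<Longrightarrow> \<nu> $ 1 + \<nu> $ 2 + \<nu> $ 3 = 0"
  by (simp add: dominant_def root_lattice_def sum_3)

lemma dominant_nat: "dominant \<nu> \<Longrightarrow> \<nu> $ 3 \<ge> 0 \<Longrightarrow> nat (- \<nu> $ 2) = nat (\<nu> $ 3) + nat (\<nu> $ 1)"
  using dominant_sum[of \<nu>] by (simp add: dominant_def flip: nat_add_distrib)

lemma acts_std: assumes "dominant \<nu>" shows "acts \<alpha> (std \<nu>) \<nu> (std_coeff \<nu>)"
proof (cases "\<nu> $ 3 \<le> 0")
  case True
  show ?thesis
    unfolding std_def if_P[OF True]
    by (rule acts_cong[OF acts_mult[OF acts_E_power acts_E_power]])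
       (use assms dominant_sum[OF assms] True in
         \<open>auto simp: vec_eq_iff forall_3 axis_def std_coeff_def dominant_def\<close>)
next
  case False
  have n: "nat (- \<nu> $ 2) = nat (\<nu> $ 3) + nat (\<nu> $ 1)"
    using dominant_nat[OF assms] False by simp
  show ?thesis
    unfolding std_def if_not_P[OF False]
    by (rule acts_cong[OF acts_mult[OF acts_E_power acts_E_power]])
       (use assms dominant_sum[OF assms] False in
         \<open>auto simp: vec_eq_iff forall_3 axis_def std_coeff_def dominant_def n falling_add mult.commute\<close>)
qed

lemma acts_hw: "dominant \<nu> \<Longrightarrow> acts \<alpha> (poly_E33 f * std \<nu>) \<nu>
    (\<lambda>k. poly f (k $ 3 + of_int (\<nu> $ 3)) * std_coeff \<nu> k)"
  by (intro acts_poly_mult acts_std)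

lemma hw_in_A_plus_wt:
  assumes "dominant \<nu>"
  shows "img \<alpha> (poly_E33 f * std \<nu>) \<in> A_plus_wt \<alpha> \<nu>"
  unfolding A_plus_wt_iff
proof (intro conjI allI)
  let ?c = "\<lambda>k. poly f (k $ 3 + of_int (\<nu> $ 3)) * std_coeff \<nu> k"
  have n2: "of_nat (nat (- \<nu> $ 2)) = - complex_of_int (\<nu> $ 2)"
    using assms by (simp add: dominant_def)
  show "adE (1, 2) (poly_E33 f * std \<nu>) \<in> J_ideal \<alpha>"
    unfolding acts_J_iff[OF acts_adE[OF acts_hw[OF assms]]]
  proof
    fix k :: "complex ^ 3"
    have z: "(k $ 2 + of_int (\<nu> $ 2)) * falling (k $ 2) (nat (- \<nu> $ 2)) = k $ 2 * falling (k $ 2 - 1) (nat (- \<nu> $ 2))"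
      using falling_shift[of "k $ 2" "nat (- \<nu> $ 2)"] n2 by simp
    have "(k $ 2 + of_int (\<nu> $ 2)) * ?c k - k $ 2 * ?c (k + axis 1 1 - axis 2 1)
      = poly f (k $ 3 + of_int (\<nu> $ 3)) * falling (k $ 3) (nat (- \<nu> $ 3))
        * ((k $ 2 + of_int (\<nu> $ 2)) * falling (k $ 2) (nat (- \<nu> $ 2)) - k $ 2 * falling (k $ 2 - 1) (nat (- \<nu> $ 2)))"
      by (simp add: std_coeff_def axis_def algebra_simps)
    then show "(k $ 2 + of_int (\<nu> $ 2)) * ?c k - k $ 2 * ?c (k + axis 1 1 - axis 2 1) = 0"
      by (simp add: z)
  qed
  fix i
  show "adE (i, i) (poly_E33 f * std \<nu>) - scaleU (of_int (\<nu> $ i)) (poly_E33 f * std \<nu>) \<in> J_ideal \<alpha>"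
    by (rule acts_eq[OF acts_cong[OF acts_adE[OF acts_hw[OF assms]]] acts_scale[OF acts_hw[OF assms]]])
       (auto simp: algebra_simps)
qed

text \<open>
  The operator \<open>\<phi>(E\<^sub>3\<^sub>3) std \<nu>\<close> sees exactly the values of
  \<open>\<phi>\<close> at \<open>base \<nu>, base \<nu> + 1, \<dots>\<close>; if
  \<open>\<alpha>\<close> is a natural number the list ends at \<open>base \<nu> + \<alpha> -
  width \<nu>\<close>.
\<close>

lemma std_multiple_in_J_iff:
  assumes dom: "dominant \<nu>" and act: "acts \<alpha> u \<nu> (\<lambda>k. \<phi> (k $ 3 + of_int (\<nu> $ 3)) * std_coeff \<nu> k)"
  shows "u \<in> J_ideal \<alpha> \<longleftrightarrow> (\<forall>j. allowed \<alpha> (width \<nu> + j) \<longrightarrow> \<phi> (of_nat (base \<nu> + j)) = 0)"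
proof -
  let ?a = "nat (- \<nu> $ 2)" and ?b = "nat (- \<nu> $ 3)"
  have e: "of_nat (?b + j) + complex_of_int (\<nu> $ 3) = of_nat (base \<nu> + j)" for j
    by (cases "\<nu> $ 3 \<le> 0") (auto simp: base_def)
  show ?thesis
    unfolding acts_J_iff[OF act]
  proof (intro iffI allI impI ballI)
    fix j assume h: "\<forall>k\<in>S_exponents \<alpha>. \<phi> (k $ 3 + of_int (\<nu> $ 3)) * std_coeff \<nu> k = 0"
      and j: "allowed \<alpha> (width \<nu> + j)"
    have "pt \<alpha> (of_nat ?a) (of_nat (?b + j)) \<in> S_exponents \<alpha>"
      unfolding pt_in_S using j by (simp add: width_def add.assoc)
    then have "\<phi> (of_nat (?b + j) + of_int (\<nu> $ 3)) * (falling (of_nat ?a) ?a * falling (of_nat (?b + j)) ?b) = 0"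
      using h by (auto simp only: std_coeff_def pt_nth dest: bspec)
    then show "\<phi> (of_nat (base \<nu> + j)) = 0"
      using falling_neq_0[of ?a ?a] falling_neq_0[of ?b "?b + j"] unfolding e by simp
  next
    fix k assume h: "\<forall>j. allowed \<alpha> (width \<nu> + j) \<longrightarrow> \<phi> (of_nat (base \<nu> + j)) = 0"
      and k: "k \<in> S_exponents \<alpha>"
    obtain m n where mn: "k = pt \<alpha> (of_nat m) (of_nat n)" "allowed \<alpha> (m + n)" using k by (rule S_cases)
    show "\<phi> (k $ 3 + of_int (\<nu> $ 3)) * std_coeff \<nu> k = 0"
    proof (cases "?a \<le> m \<and> ?b \<le> n")
      case True
      then obtain j where j: "n = ?b + j" using le_Suc_ex by blast
      have "allowed \<alpha> (width \<nu> + j)" using mn(2) True j by (auto simp: width_def intro: allowed_mono)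
      then have "\<phi> (of_nat n + of_int (\<nu> $ 3)) = 0" using h unfolding j e by blast
      then show ?thesis by (simp add: mn)
    next
      case False
      then have "falling (of_nat m) ?a = 0 \<or> falling (of_nat n) ?b = 0"
        using falling_eq_0 by (meson not_le)
      then show ?thesis by (auto simp: mn std_coeff_def)
    qed
  qed
qed

lemma poly_sum_slice:
  assumes "\<And>w. w \<in> W \<Longrightarrow> \<exists>p. \<forall>z. f w z = poly p z * g z"
  shows "\<exists>p. \<forall>z. (\<Sum>w\<in>W. a w * f w z) = poly p z * (g z :: complex)"
proof -
  obtain p where p: "\<And>w z. w \<in> W \<Longrightarrow> f w z = poly (p w) z * g z" using assms by metis
  have "(\<Sum>w\<in>W. a w * f w z) = poly (\<Sum>w\<in>W. Polynomial.smult (a w) (p w)) z * g z" for z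
    by (simp add: p poly_sum sum_distrib_right mult.assoc)
  then show ?thesis by blast
qed

lemma A_plus_wt_slices:
  assumes "img \<alpha> u \<in> A_plus_wt \<alpha> \<nu>"
  shows "\<exists>c. acts \<alpha> u \<nu> c \<and> (\<forall>m. \<exists>p. \<forall>z. c (pt \<alpha> m z)
    = poly p z * (falling (\<alpha> - m - z) (nat (- \<nu> $ 1)) * falling z (nat (- \<nu> $ 3))))"
proof -
  obtain W a where W: "finite W" "u = (\<Sum>w\<in>W. scaleU (a w) (word w))"
    using ugl3_word_expansion by blast
  let ?W = "{w \<in> W. word_wt w = \<nu>}"
  have "acts \<alpha> u \<nu> (\<lambda>k. \<Sum>w\<in>?W. a w * word_fun w k)"
    using assms W by (intro weight_component) (auto simp: A_plus_wt_iff)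
  moreover have "\<exists>p. \<forall>z. (\<Sum>w\<in>?W. a w * word_fun w (pt \<alpha> m z))
    = poly p z * (falling (\<alpha> - m - z) (nat (- \<nu> $ 1)) * falling z (nat (- \<nu> $ 3)))" for m
  proof (rule poly_sum_slice)
    fix w assume "w \<in> ?W"
    then show "\<exists>p. \<forall>z. word_fun w (pt \<alpha> m z)
      = poly p z * (falling (\<alpha> - m - z) (nat (- \<nu> $ 1)) * falling z (nat (- \<nu> $ 3)))"
      using word_fun_slice[of w \<alpha> m] by (simp add: mult.assoc)
  qed
  ultimately show ?thesis by blast
qed

text \<open>
  Write \<open>c(m, n)\<close> for the coefficient at \<open>x\<^sub>2\<^sup>m
  x\<^sub>3\<^sup>n\<close>. Commuting with \<open>E\<^sub>1\<^sub>2\<close> means \<open>(m +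
  \<nu>\<^sub>2) c(m, n) = m c(m - 1, n)\<close>, which forces \<open>c = 0\<close> for
  \<open>\<nu>\<^sub>2 > 0\<close> and \<open>c(m, n) \<sim> c(a, n) (m choose a)\<close> for
  \<open>\<nu>\<^sub>2 = -a \<le> 0\<close>. If \<open>\<nu>\<^sub>1 < 0\<close>, \<open>c\<close>
  also vanishes where the exponent of \<open>x\<^sub>1\<close> is zero, and these points force it
  to be zero.
\<close>

lemma hw_classification:
  assumes v: "v \<in> A_plus_wt \<alpha> \<nu>" and \<nu>: "\<nu> \<in> root_lattice"
  shows "v = img \<alpha> 0 \<or> dominant \<nu> \<and> (\<exists>f. v = img \<alpha> (poly_E33 f * std \<nu>))"
proof -
  obtain u where u: "v = img \<alpha> u" using A_plus_wt_img[OF v] by blast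
  obtain c where c: "acts \<alpha> u \<nu> c"
    and slice: "\<And>m. \<exists>p. \<forall>z. c (pt \<alpha> m z)
      = poly p z * (falling (\<alpha> - m - z) (nat (- \<nu> $ 1)) * falling z (nat (- \<nu> $ 3)))"
    using A_plus_wt_slices v u by blast
  define cc where "cc m n = c (pt \<alpha> (of_nat m) (of_nat n))" for m n
  have rec: "(of_nat m + of_int (\<nu> $ 2)) * cc m n = of_nat m * cc (m - 1) n" if "allowed \<alpha> (m + n)" for m n
  proof -
    let ?k = "pt \<alpha> (of_nat m) (of_nat n)"
    have "adE (1, 2) u \<in> J_ideal \<alpha>" using v u A_plus_wt_iff by blast
    then have z: "(?k $ 2 + of_int (\<nu> $ 2)) * c ?k - ?k $ 2 * c (?k + axis 1 1 - axis 2 1) = 0"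
      using acts_J_iff[OF acts_adE[OF c, of 1 2]] that pt_in_S by blast
    show ?thesis
    proof (cases m)
      case 0 then show ?thesis using z by (simp add: cc_def)
    next
      case (Suc l)
      have "?k + axis 1 1 - axis 2 1 = pt \<alpha> (of_nat (m - 1)) (of_nat n)"
        by (simp add: vec_eq_iff forall_3 axis_def Suc)
      then show ?thesis using z by (simp add: cc_def)
    qed
  qed
  have zero: "v = img \<alpha> 0" if "\<And>m n. allowed \<alpha> (m + n) \<Longrightarrow> cc m n = 0"
  proof -
    have "c k = 0" if "k \<in> S_exponents \<alpha>" for k
      using that \<open>\<And>m n. allowed \<alpha> (m + n) \<Longrightarrow> cc m n = 0\<close> S_cases unfolding cc_def by metis
    then have "u \<in> J_ideal \<alpha>" using acts_J_iff[OF c] by blast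
    then show ?thesis by (simp add: u img_eq_iff)
  qed
  show ?thesis
  proof (cases "\<nu> $ 2 > 0")
    case True
    have "cc m n = 0" if "allowed \<alpha> (m + n)" for m n
      using that
    proof (induction m)
      case 0
      then show ?case using rec[of 0 n] True by simp
    next
      case (Suc m)
      have "of_nat (Suc m) + complex_of_int (\<nu> $ 2) = of_int (int (Suc m) + \<nu> $ 2)" by simp
      then have "of_nat (Suc m) + complex_of_int (\<nu> $ 2) \<noteq> 0" using True by (simp only: of_int_eq_0_iff)
      moreover have "cc m n = 0" using Suc allowed_mono by (metis add_Suc le_SucI order_refl)
      ultimately show ?case using rec[OF Suc.prems] by simp
    qed
    then show ?thesis using zero by blast
  next
    case False
    define a where "a = nat (- \<nu> $ 2)"
    have a: "complex_of_int (\<nu> $ 2) = - of_nat a" using False by (simp add: a_def)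
    have key: "cc m n * falling (of_nat a) a = cc a n * falling (of_nat m) a" if "allowed \<alpha> (m + n)" for m n
      using that
    proof (induction m)
      case 0
      show ?case using rec[OF 0] a by (cases "a = 0") (auto simp: falling_eq_0[of 0 a, simplified])
    next
      case (Suc m)
      have IH: "cc m n * falling (of_nat a) a = cc a n * falling (of_nat m) a"
        using Suc allowed_mono by (metis add_Suc le_SucI order_refl)
      show ?case
      proof (cases "Suc m = a")
        case False
        then have ne: "of_nat (Suc m) - (of_nat a :: complex) \<noteq> 0" by (metis of_nat_eq_iff right_minus_eq)
        have "(of_nat (Suc m) - of_nat a) * (cc (Suc m) n * falling (of_nat a) a)
          = of_nat (Suc m) * (cc m n * falling (of_nat a) a)"
          using rec[OF Suc.prems] a by simp
        also have "\<dots> = cc a n * (of_nat (Suc m) * falling (of_nat (Suc m) - 1) a)"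
          by (simp add: IH)
        also have "\<dots> = (of_nat (Suc m) - of_nat a) * (cc a n * falling (of_nat (Suc m)) a)"
          unfolding falling_shift by (simp only: mult_ac)
        finally show ?thesis using ne by (simp only: mult_left_cancel[OF ne])
      qed simp
    qed
    have fa: "falling (of_nat a) a \<noteq> 0" by (simp add: falling_neq_0)
    show ?thesis
    proof (cases "\<nu> $ 1 < 0")
      case True
      \<comment> \<open>On this line the exponent of \<open>x\<^sub>1\<close> is zero, where the factor coming from \<open>\<partial>\<^sub>1\<close> vanishes.\<close>
      have edge: "c (pt \<alpha> m (\<alpha> - m)) = 0" for m
        using slice[of m] falling_eq_0[of 0 "nat (- \<nu> $ 1)"] True by auto
      have "cc a n = 0" if n: "allowed \<alpha> (a + n)" for n
      proof (cases "\<alpha> \<in> \<nat>")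
        case True
        then obtain A where A: "\<alpha> = of_nat A" by (elim Nats_cases)
        have le: "a + n \<le> A" using n by (simp add: A)
        have "cc (A - n) n = 0" using edge[of "of_nat (A - n)"] le by (simp add: cc_def A of_nat_diff)
        then show ?thesis
          using key[of "A - n" n] falling_neq_0[of a "A - n"] le by (simp add: A)
      next
        case False
        have "\<exists>g. \<forall>z. c (pt \<alpha> m z) = poly g z" for m
        proof -
          obtain p where p: "\<And>z. c (pt \<alpha> m z) = poly p z * (falling (\<alpha> - m - z) (nat (- \<nu> $ 1)) * falling z (nat (- \<nu> $ 3)))"
            using slice by blast
          show ?thesis
            by (intro exI[of _ "p * ((falling_poly (nat (- \<nu> $ 1)) \<circ>\<^sub>p [:\<alpha> - m, -1:]) * falling_poly (nat (- \<nu> $ 3)))"])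
               (simp add: p poly_pcompose)
        qed
        then obtain g where g: "\<And>m z. c (pt \<alpha> m z) = poly (g m) z" by metis
        have eq: "Polynomial.smult (falling (of_nat a) a) (g (of_nat m)) = Polynomial.smult (falling (of_nat m) a) (g (of_nat a))" for m
        proof (rule poly_eq_infinite[OF infinite_shift[of 0]])
          fix z :: complex assume "z \<in> range (\<lambda>n. of_nat n + 0)"
          then obtain n where "z = of_nat n" by auto
          then show "poly (Polynomial.smult (falling (of_nat a) a) (g (of_nat m))) z = poly (Polynomial.smult (falling (of_nat m) a) (g (of_nat a))) z"
            using key[OF allowed_not_Nats[OF False], of m n] by (simp add: cc_def g mult.commute)
        qed
        have "g (of_nat a) = 0"
        proof (rule poly_eq_infinite)
          show "infinite ((\<lambda>i. \<alpha> - of_nat (a + i)) ` (UNIV :: nat set))"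
            by (rule range_inj_infinite) (simp add: inj_def)
          fix z assume "z \<in> range (\<lambda>i. \<alpha> - of_nat (a + i))"
          then obtain i where z: "z = \<alpha> - of_nat (a + i)" by blast
          have "poly (g (of_nat (a + i))) z = 0" using edge[of "of_nat (a + i)"] by (simp only: g z)
          then have "falling (of_nat (a + i)) a * poly (g (of_nat a)) z = 0"
            using arg_cong[OF eq[of "a + i"], of "\<lambda>p. poly p z"] by simp
          then show "poly (g (of_nat a)) z = poly 0 z" using falling_neq_0[of a "a + i"] by simp
        qed
        then show ?thesis by (simp add: cc_def g)
      qed
      then have "cc m n = 0" if "allowed \<alpha> (m + n)" for m n
        using key[OF that] fa falling_eq_0[of m a] allowed_mono[OF that, of "a + n"]
        by (cases "a \<le> m") auto
      then show ?thesis using zero by blast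
    next
      case pos: False
      then have dom: "dominant \<nu>" using \<nu> False by (simp add: dominant_def)
      obtain p where p: "\<And>z. c (pt \<alpha> (of_nat a) z) = poly p z * falling z (nat (- \<nu> $ 3))"
        using slice[of "of_nat a"] pos by auto
      \<comment> \<open>The slice \<open>k\<^sub>2 = a\<close> determines \<open>f\<close>; the shift by \<open>\<nu>\<^sub>3\<close> is due to \<open>E\<^sub>3\<^sub>3\<close> standing on the left.\<close>
      define f where "f = Polynomial.smult (1 / falling (of_nat a) a) (p \<circ>\<^sub>p [:- of_int (\<nu> $ 3), 1:])"
      have "acts \<alpha> (poly_E33 f * std \<nu>) \<nu> c"
      proof (rule acts_cong[OF acts_hw[OF dom] refl])
        fix k assume "k \<in> S_exponents \<alpha>"
        then obtain m n where mn: "k = pt \<alpha> (of_nat m) (of_nat n)" "allowed \<alpha> (m + n)" by (rule S_cases)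
        have "poly f (of_nat n + of_int (\<nu> $ 3)) * falling (of_nat n) (nat (- \<nu> $ 3)) = cc a n / falling (of_nat a) a"
          by (simp add: f_def poly_pcompose cc_def p)
        moreover have "poly f (k $ 3 + of_int (\<nu> $ 3)) * std_coeff \<nu> k
          = (poly f (of_nat n + of_int (\<nu> $ 3)) * falling (of_nat n) (nat (- \<nu> $ 3))) * falling (of_nat m) a"
          by (simp add: mn std_coeff_def a_def[symmetric])
        ultimately have "poly f (k $ 3 + of_int (\<nu> $ 3)) * std_coeff \<nu> k = cc a n * falling (of_nat m) a / falling (of_nat a) a"
          by simp
        also have "\<dots> = cc m n" using key[OF mn(2)] fa by (simp add: field_simps)
        finally show "poly f (k $ 3 + of_int (\<nu> $ 3)) * std_coeff \<nu> k = c k" by (simp add: cc_def mn)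
      qed
      then have "v = img \<alpha> (poly_E33 f * std \<nu>)"
        using acts_eq[OF c] by (simp add: u img_eq_iff)
      then show ?thesis using dom by blast
    qed
  qed
qed

subsection \<open>The standard filtration\<close>

lemma filtration_elim:
  assumes "v \<in> A_filtration \<alpha> d"
  obtains W a where "finite W" "\<And>w. w \<in> W \<Longrightarrow> length w \<le> d" "v = img \<alpha> (\<Sum>w\<in>W. scaleU (a w) (word w))"
proof -
  obtain u where u: "v = img \<alpha> u" "u \<in> ugl3.span {word w |w. length w \<le> d}"
    using assms by (auto simp: A_filtration_def word_def)
  then obtain S r where S: "finite S" "S \<subseteq> {word w |w. length w \<le> d}" "u = (\<Sum>x\<in>S. scaleU (r x) x)"
    unfolding ugl3.span_explicit by blast
  have "\<exists>g. \<forall>x\<in>S. word (g x) = x \<and> length (g x) \<le> d" using S(2) by (intro bchoice) blast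
  then obtain g where g: "\<And>x. x \<in> S \<Longrightarrow> word (g x) = x \<and> length (g x) \<le> d" by blast
  have inj: "inj_on g S" by (metis g inj_onI)
  have "u = (\<Sum>w\<in>g ` S. scaleU (r (word w)) (word w))"
    unfolding S(3) by (subst sum.reindex[OF inj]) (simp add: g)
  then show ?thesis using that[of "g ` S" "\<lambda>w. r (word w)"] S(1) g u(1) by auto
qed

text \<open>
  On the line \<open>k\<^sub>1 = 0\<close> the coefficient of \<open>f(E\<^sub>3\<^sub>3) std
  \<nu>\<close> has degree \<open>width \<nu> + deg f\<close>, that of an element of the
  \<open>d\<close>-th filtration step has degree at most \<open>d\<close>, and the line carries
  \<open>\<alpha> + 1\<close> exponents, enough to identify the two polynomials.
\<close>

lemma filtration_degree:
  assumes dom: "dominant \<nu>" and v: "img \<alpha> (poly_E33 f * std \<nu>) \<in> A_filtration \<alpha> d"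
    and \<alpha>: "\<alpha> = of_nat A" and deg: "width \<nu> + Polynomial.degree f \<le> A" and f: "f \<noteq> 0"
  shows "width \<nu> + Polynomial.degree f \<le> d"
proof (cases "A \<le> d")
  case False
  let ?a = "nat (- \<nu> $ 2)" and ?b = "nat (- \<nu> $ 3)"
  obtain W a where W: "finite W" "\<And>w. w \<in> W \<Longrightarrow> length w \<le> d"
    and v': "img \<alpha> (poly_E33 f * std \<nu>) = img \<alpha> (\<Sum>w\<in>W. scaleU (a w) (word w))"
    using filtration_elim[OF v] by blast
  define u where "u = (\<Sum>w\<in>W. scaleU (a w) (word w))"
  let ?W = "{w \<in> W. word_wt w = \<nu>}"
  have "img \<alpha> u \<in> A_plus_wt \<alpha> \<nu>" using hw_in_A_plus_wt[OF dom, of \<alpha> f] v' by (simp add: u_def)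
  then have act: "acts \<alpha> u \<nu> (\<lambda>k. \<Sum>w\<in>?W. a w * word_fun w k)"
    using W(1) by (intro weight_component) (auto simp: A_plus_wt_iff u_def)
  obtain p where p: "\<And>w. Polynomial.degree (p w) \<le> length w" "\<And>w z. word_fun w (pt \<alpha> (\<alpha> - z) z) = poly (p w) z"
    using word_fun_edge[of _ \<alpha>] by metis
  define q where "q = (\<Sum>w\<in>?W. Polynomial.smult (a w) (p w))"
  have q: "(\<Sum>w\<in>?W. a w * word_fun w (pt \<alpha> (\<alpha> - z) z)) = poly q z" for z
    by (simp add: q_def p poly_sum)
  have degq: "Polynomial.degree q \<le> d"
    unfolding q_def
  proof (rule degree_sum_le)
    fix w assume "w \<in> ?W"
    then have "Polynomial.degree (Polynomial.smult (a w) (p w)) \<le> length w" using p(1)[of w] degree_smult_le order_trans by blast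
    then show "Polynomial.degree (Polynomial.smult (a w) (p w)) \<le> d" using W(2) \<open>w \<in> ?W\<close> by fastforce
  qed (use W in auto)
  define L where "L = (f \<circ>\<^sub>p [:of_int (\<nu> $ 3), 1:]) * ((falling_poly ?a \<circ>\<^sub>p [:\<alpha>, -1:]) * falling_poly ?b)"
  have Lnz: "f \<circ>\<^sub>p [:of_int (\<nu> $ 3), 1:] \<noteq> 0" "falling_poly ?a \<circ>\<^sub>p [:\<alpha>, -1:] \<noteq> 0"
    using f by (auto simp: pcompose_eq_0_iff)
  have degL: "Polynomial.degree L = width \<nu> + Polynomial.degree f"
    using Lnz by (simp add: L_def degree_mult_eq degree_pcompose width_def)
  have "L = q"
  proof (rule poly_eq_card[of "of_nat ` {..A}"])
    have card: "card ((of_nat :: nat \<Rightarrow> complex) ` {..A}) = Suc A"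
      by (subst card_image) (auto simp: inj_on_def)
    show "Polynomial.degree L < card ((of_nat :: nat \<Rightarrow> complex) ` {..A})" using degL deg card by simp
    show "Polynomial.degree q < card ((of_nat :: nat \<Rightarrow> complex) ` {..A})" using degq False card by simp
    fix z :: complex assume "z \<in> of_nat ` {..A}"
    then obtain n where n: "z = of_nat n" "n \<le> A" by auto
    have k: "pt \<alpha> (\<alpha> - z) z \<in> S_exponents \<alpha>"
      using pt_in_S[of \<alpha> "A - n" n] n by (simp add: \<alpha> of_nat_diff)
    have J: "poly_E33 f * std \<nu> - u \<in> J_ideal \<alpha>" using v' by (simp add: u_def img_eq_iff)
    have "poly f (z + of_int (\<nu> $ 3)) * std_coeff \<nu> (pt \<alpha> (\<alpha> - z) z) = (\<Sum>w\<in>?W. a w * word_fun w (pt \<alpha> (\<alpha> - z) z))"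
      using J k unfolding acts_J_iff[OF acts_diff[OF acts_hw[OF dom] act]] by auto
    then show "poly L z = poly q z"
      unfolding q by (simp add: L_def poly_pcompose std_coeff_def add.commute)
  qed simp
  then show ?thesis using degL degq by simp
qed (use deg in simp)

lemma std_filtration: assumes "dominant \<nu>" shows "img \<alpha> (scaleU c (std \<nu>)) \<in> A_filtration \<alpha> (width \<nu>)"
proof -
  have pow: "E i j ^ n = word (replicate n (i, j))" for i j n
    by (induction n) simp_all
  have "\<exists>w. std \<nu> = word w \<and> length w \<le> width \<nu>"
  proof (cases "\<nu> $ 3 \<le> 0")
    case True
    then show ?thesis
      by (intro exI[of _ "replicate (nat (- \<nu> $ 2)) (1, 2) @ replicate (nat (- \<nu> $ 3)) (1, 3)"])
         (simp add: std_def pow width_def)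
  next
    case False
    then show ?thesis using dominant_nat[OF assms]
      by (intro exI[of _ "replicate (nat (\<nu> $ 1)) (1, 2) @ replicate (nat (\<nu> $ 3)) (3, 2)"])
         (simp add: std_def pow width_def dominant_def)
  qed
  then obtain w where "std \<nu> = word w" "length w \<le> width \<nu>" by blast
  then show ?thesis
    unfolding A_filtration_def word_def by (intro imageI ugl3.span_scale ugl3.span_base) auto
qed

subsection \<open>Multiples of the standard vector\<close>

text \<open>
  These elements commute with \<open>E\<^sub>1\<^sub>2\<close>, and all highest weight vectors for the
  subalgebra \<open>gl(2)\<close> on the first two indices are of this form.
\<close>

definition hw :: "complex \<Rightarrow> int ^ 3 \<Rightarrow> complex poly \<Rightarrow> ugl3 set" where
  "hw \<alpha> \<nu> f = img \<alpha> (poly_E33 f * std \<nu>)"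

lemma poly_E33_const: "poly_E33 [:c:] = scaleU c 1"
  by (simp add: poly_E33_def)

lemma poly_E33_mult: "poly_E33 f * poly_E33 g - poly_E33 (f * g) \<in> J_ideal \<alpha>"
  by (simp add: J_iff rep_diff rep_mult rep_poly_E33)

lemma poly_E33_diff: "poly_E33 (f - g) - (poly_E33 f - poly_E33 g) \<in> J_ideal \<alpha>"
  by (simp add: J_iff rep_diff rep_poly_E33 left_diff_distrib single_diff)

lemma poly_mult_hw: "poly_mult \<alpha> f (hw \<alpha> \<nu> g) = hw \<alpha> \<nu> (f * g)"
  using J_rmult[OF poly_E33_mult[of f g \<alpha>], of "std \<nu>"]
  by (simp add: hw_def poly_mult_img img_eq_iff algebra_simps)

lemma hw_const: "hw \<alpha> \<nu> [:c:] = img \<alpha> (scaleU c (std \<nu>))"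
  by (simp add: hw_def poly_E33_const scaleU_mult_left)

lemma hw_zero: "hw \<alpha> \<nu> 0 = img \<alpha> 0"
  using hw_const[of \<alpha> \<nu> 0] by simp

lemma hw_eq_iff:
  assumes "dominant \<nu>"
  shows "hw \<alpha> \<nu> f = hw \<alpha> \<nu> g \<longleftrightarrow>
    (\<forall>j. allowed \<alpha> (width \<nu> + j) \<longrightarrow> poly f (of_nat (base \<nu> + j)) = poly g (of_nat (base \<nu> + j)))"
proof -
  have e: "poly_E33 (f - g) * std \<nu> - (poly_E33 f * std \<nu> - poly_E33 g * std \<nu>) \<in> J_ideal \<alpha>"
    using J_rmult[OF poly_E33_diff[of f g \<alpha>], of "std \<nu>"] by (simp add: algebra_simps)
  have "hw \<alpha> \<nu> f = hw \<alpha> \<nu> g \<longleftrightarrow> poly_E33 (f - g) * std \<nu> \<in> J_ideal \<alpha>"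
    unfolding hw_def img_eq_iff using J_diff[OF _ e] J_add[OF e] by fastforce
  then show ?thesis by (simp only: std_multiple_in_J_iff[OF assms acts_hw[OF assms]]) simp
qed

lemma hw_eqD:
  assumes dom: "dominant \<nu>" and eq: "hw \<alpha> \<nu> f = hw \<alpha> \<nu> g"
    and f: "allowed \<alpha> (width \<nu> + Polynomial.degree f)" and g: "allowed \<alpha> (width \<nu> + Polynomial.degree g)"
  shows "f = g"
proof (cases "\<alpha> \<in> \<nat>")
  case False
  show ?thesis
    by (rule poly_eq_infinite[OF infinite_shift[of "of_nat (base \<nu>)"]])
       (use eq allowed_not_Nats[OF False] in \<open>auto simp: hw_eq_iff[OF dom] add.commute\<close>)
next
  case True
  then obtain A where A: "\<alpha> = of_nat A" by (elim Nats_cases)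
  let ?R = "(\<lambda>j. of_nat (base \<nu> + j)) ` {..A - width \<nu>} :: complex set"
  have card: "card ?R = Suc (A - width \<nu>)"
    by (subst card_image) (auto simp: inj_on_def)
  show ?thesis
  proof (rule poly_eq_card[of ?R])
    fix z assume "z \<in> ?R"
    then obtain j where "z = of_nat (base \<nu> + j)" "width \<nu> + j \<le> A" using f by (auto simp: A)
    then show "poly f z = poly g z" using eq unfolding hw_eq_iff[OF dom] by (simp add: A)
  next
    show "Polynomial.degree f < card ?R" unfolding card using f by (simp add: A)
    show "Polynomial.degree g < card ?R" unfolding card using g by (simp add: A)
  qed simp
qed

text \<open>
  Only the residue modulo the polynomial with the visible points as simple roots counts.
\<close>

lemma hw_reduce:
  assumes dom: "dominant \<nu>" and a: "allowed \<alpha> (width \<nu>)"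
  shows "\<exists>g. hw \<alpha> \<nu> f = hw \<alpha> \<nu> g \<and> allowed \<alpha> (width \<nu> + Polynomial.degree g)"
proof (cases "\<alpha> \<in> \<nat>")
  case False
  then show ?thesis using allowed_not_Nats by blast
next
  case True
  then obtain A where A: "\<alpha> = of_nat A" by (elim Nats_cases)
  define N where "N = A - width \<nu>"
  define m :: "complex poly" where "m = (\<Prod>j\<le>N. [:- of_nat (base \<nu> + j), 1:])"
  have m: "m \<noteq> 0" by (simp add: m_def)
  have degm: "Polynomial.degree m = Suc N"
    unfolding m_def by (subst degree_prod_eq_sum_degree) auto
  have root: "poly m (of_nat (base \<nu> + j)) = 0" if "j \<le> N" for j
    using that by (auto simp: m_def poly_prod)
  have "Polynomial.degree (f mod m) \<le> N"
    using degree_mod_less[OF m, of f] degm by auto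
  moreover have "hw \<alpha> \<nu> f = hw \<alpha> \<nu> (f mod m)"
    unfolding hw_eq_iff[OF dom]
  proof (intro allI impI)
    fix j assume "allowed \<alpha> (width \<nu> + j)"
    then have j: "j \<le> N" by (simp add: A N_def)
    have "poly f x = poly (f div m) x * poly m x + poly (f mod m) x" for x
      by (simp flip: poly_mult poly_add)
    then show "poly f (of_nat (base \<nu> + j)) = poly (f mod m) (of_nat (base \<nu> + j))"
      using root[OF j] by simp
  qed
  ultimately show ?thesis using a by (intro exI[of _ "f mod m"]) (auto simp: A N_def)
qed

lemma Q_plus_dominant:
  assumes "\<nu> \<in> Q_plus \<alpha>" shows "dominant \<nu>" "allowed \<alpha> (width \<nu>)"
proof -
  have lat: "\<nu> \<in> root_lattice" and ne: "A_plus_wt \<alpha> \<nu> \<noteq> {img \<alpha> 0}"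
    using assms by (auto simp: Q_plus_def A_zero)
  have "img \<alpha> 0 \<in> A_plus_wt \<alpha> \<nu>" by (simp add: A_plus_wt_iff)
  then obtain v where v: "v \<in> A_plus_wt \<alpha> \<nu>" "v \<noteq> img \<alpha> 0" using ne by blast
  then obtain f where f: "dominant \<nu>" "v = hw \<alpha> \<nu> f" using hw_classification[OF v(1) lat] by (auto simp: hw_def)
  show "dominant \<nu>" by (rule f)
  have "hw \<alpha> \<nu> f \<noteq> hw \<alpha> \<nu> 0" using v f by (simp add: hw_zero)
  then obtain j where "allowed \<alpha> (width \<nu> + j)" unfolding hw_eq_iff[OF f(1)] by blast
  then show "allowed \<alpha> (width \<nu>)" by (rule allowed_mono) simp
qed

lemma A_plus_wt_hw:
  assumes "dominant \<nu>" shows "A_plus_wt \<alpha> \<nu> = range (hw \<alpha> \<nu>)"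
proof -
  have "v \<in> range (hw \<alpha> \<nu>)" if "v \<in> A_plus_wt \<alpha> \<nu>" for v
  proof -
    have "\<nu> \<in> root_lattice" using assms by (simp add: dominant_def)
    then have "v = hw \<alpha> \<nu> 0 \<or> (\<exists>f. v = hw \<alpha> \<nu> f)" using hw_classification[OF that] by (auto simp: hw_def[symmetric] hw_zero)
    then show ?thesis by blast
  qed
  moreover have "hw \<alpha> \<nu> f \<in> A_plus_wt \<alpha> \<nu>" for f
    using hw_in_A_plus_wt[OF assms] by (simp add: hw_def)
  ultimately show ?thesis by blast
qed

lemma hw_filtration_degree:
  assumes dom: "dominant \<nu>" and v: "hw \<alpha> \<nu> f \<in> A_filtration \<alpha> d" and \<alpha>: "\<alpha> \<in> \<nat>"
    and deg: "allowed \<alpha> (width \<nu> + Polynomial.degree f)" and f: "f \<noteq> 0"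
  shows "width \<nu> + Polynomial.degree f \<le> d"
proof -
  obtain A where "\<alpha> = of_nat A" using \<alpha> by (elim Nats_cases)
  then show ?thesis using filtration_degree[OF dom v[unfolded hw_def] _ _ f] deg by simp
qed

text \<open>
  A generator divides \<open>std \<nu>\<close>. If \<open>\<alpha>\<close> is not a natural
  number, its polynomial is a unit, hence constant; otherwise the minimality of the filtration
  degree makes the reduced polynomial constant.
\<close>

lemma is_generator_iff:
  assumes "\<nu> \<in> Q_plus \<alpha>"
  shows "is_generator \<alpha> \<nu> v \<longleftrightarrow> (\<exists>c. c \<noteq> 0 \<and> v = hw \<alpha> \<nu> [:c:])"
proof
  note dom = Q_plus_dominant[OF assms]
  have hw1: "hw \<alpha> \<nu> [:c:] \<noteq> hw \<alpha> \<nu> 0" if "c \<noteq> 0" for c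
    using that dom(2) by (auto simp: hw_eq_iff[OF dom(1)] intro!: exI[of _ 0])
  {
    assume g: "is_generator \<alpha> \<nu> v"
    then have v: "v \<in> range (hw \<alpha> \<nu>)" "range (hw \<alpha> \<nu>) = range (\<lambda>f. poly_mult \<alpha> f v)"
      unfolding is_generator_def A_plus_wt_hw[OF dom(1)] by blast+
    then obtain f where f: "v = hw \<alpha> \<nu> f" "allowed \<alpha> (width \<nu> + Polynomial.degree f)"
      using hw_reduce[OF dom] by (metis rangeE)
    have "hw \<alpha> \<nu> 1 \<in> range (\<lambda>f. poly_mult \<alpha> f v)" using v(2) by blast
    then obtain h where h: "hw \<alpha> \<nu> 1 = hw \<alpha> \<nu> (h * f)" by (auto simp: f poly_mult_hw)
    have fnz: "f \<noteq> 0" using h hw1[of 1] by (metis mult_zero_right one_pCons one_neq_zero)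
    have "Polynomial.degree f = 0"
    proof (cases "\<alpha> \<in> \<nat>")
      case False
      have "1 = h * f" by (rule hw_eqD[OF dom(1) h]) (simp_all add: allowed_not_Nats[OF False])
      then have "f dvd 1" by (metis dvd_triv_right)
      then show ?thesis by (auto simp: is_unit_poly_iff)
    next
      case True
      then obtain d where d: "v \<in> A_filtration \<alpha> d" "\<forall>d'<d. A_plus_wt \<alpha> \<nu> \<inter> A_filtration \<alpha> d' \<subseteq> {img \<alpha> 0}"
        using g by (auto simp: is_generator_def A_zero)
      have "hw \<alpha> \<nu> [:1:] \<in> A_plus_wt \<alpha> \<nu> \<inter> A_filtration \<alpha> (width \<nu>)"
        using std_filtration[OF dom(1), of \<alpha> 1] by (auto simp: A_plus_wt_hw[OF dom(1)] hw_const simp del: ugl3.scale_one)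
          (metis hw_const rangeI)
      then have "\<not> width \<nu> < d" using d(2) hw1[of 1] by (auto simp: hw_zero)
      moreover have "width \<nu> + Polynomial.degree f \<le> d"
        using hw_filtration_degree[OF dom(1) _ True f(2) fnz] d(1) f(1) by simp
      ultimately show ?thesis by simp
    qed
    then obtain c where "f = [:c:]" by (rule degree_eq_zeroE)
    then show "\<exists>c. c \<noteq> 0 \<and> v = hw \<alpha> \<nu> [:c:]" using fnz f by auto
  next
    assume "\<exists>c. c \<noteq> 0 \<and> v = hw \<alpha> \<nu> [:c:]"
    then obtain c where c: "c \<noteq> 0" "v = hw \<alpha> \<nu> [:c:]" by blast
    have 1: "hw \<alpha> \<nu> f = poly_mult \<alpha> (Polynomial.smult (1 / c) f) v" for f
      using c by (simp add: poly_mult_hw)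
    have 2: "poly_mult \<alpha> f v = hw \<alpha> \<nu> (f * [:c:])" for f
      unfolding c(2) by (rule poly_mult_hw)
    have rng: "A_plus_wt \<alpha> \<nu> = range (\<lambda>f. poly_mult \<alpha> f v)"
      unfolding A_plus_wt_hw[OF dom(1)]
    proof (intro subset_antisym image_subsetI)
      show "hw \<alpha> \<nu> f \<in> range (\<lambda>f. poly_mult \<alpha> f v)" for f unfolding 1 by (rule rangeI)
      show "poly_mult \<alpha> f v \<in> range (hw \<alpha> \<nu>)" for f unfolding 2 by (rule rangeI)
    qed
    have filt: "A_plus_wt \<alpha> \<nu> \<inter> A_filtration \<alpha> d' \<subseteq> {img \<alpha> 0}" if "\<alpha> \<in> \<nat>" "d' < width \<nu>" for d'
    proof
      fix x assume x: "x \<in> A_plus_wt \<alpha> \<nu> \<inter> A_filtration \<alpha> d'"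
      then obtain f where f: "x = hw \<alpha> \<nu> f" "allowed \<alpha> (width \<nu> + Polynomial.degree f)"
        using hw_reduce[OF dom] by (auto simp: A_plus_wt_hw[OF dom(1)])
      have "f = 0"
        using hw_filtration_degree[OF dom(1) _ that(1) f(2)] x that(2) unfolding f(1) by fastforce
      then show "x \<in> {img \<alpha> 0}" using f by (simp add: hw_zero)
    qed
    have "v \<in> A_plus_wt \<alpha> \<nu>" using c by (auto simp: A_plus_wt_hw[OF dom(1)])
    moreover have "v \<in> A_filtration \<alpha> (width \<nu>)"
      using std_filtration[OF dom(1)] by (simp add: c(2) hw_const)
    ultimately show "is_generator \<alpha> \<nu> v"
      unfolding is_generator_def A_zero using rng filt by blast
  }
qed

lemma represents_iff:
  assumes dom: "dominant \<nu>" and c: "c \<noteq> 0" and h: "allowed \<alpha> (width \<nu> + Polynomial.degree h)"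
  shows "represents \<alpha> (hw \<alpha> \<nu> [:c:]) (hw \<alpha> \<nu> h) f \<longleftrightarrow> f = Polynomial.smult (1 / c) h"
proof
  have pm: "poly_mult \<alpha> g (hw \<alpha> \<nu> [:c:]) = hw \<alpha> \<nu> (Polynomial.smult c g)" for g
    by (simp add: poly_mult_hw mult.commute[of g])
  have uniq: "g = Polynomial.smult (1 / c) h"
    if "hw \<alpha> \<nu> (Polynomial.smult c g) = hw \<alpha> \<nu> h" "\<alpha> \<in> \<nat> \<Longrightarrow> Polynomial.degree g \<le> Polynomial.degree h" for g
  proof -
    have "allowed \<alpha> (width \<nu> + Polynomial.degree g)"
      using allowed_mono[OF h] that(2) allowed_not_Nats by (cases "\<alpha> \<in> \<nat>") auto
    then have "Polynomial.smult c g = h" using c by (intro hw_eqD[OF dom that(1) _ h]) simp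
    then show ?thesis using c by auto
  qed
  {
    assume r: "represents \<alpha> (hw \<alpha> \<nu> [:c:]) (hw \<alpha> \<nu> h) f"
    then have 1: "hw \<alpha> \<nu> (Polynomial.smult c f) = hw \<alpha> \<nu> h" by (simp add: represents_def pm)
    have "Polynomial.degree f \<le> Polynomial.degree h" if "\<alpha> \<in> \<nat>"
    proof -
      have "Polynomial.degree f \<le> Polynomial.degree (Polynomial.smult (1 / c) h)"
      proof -
        have "hw \<alpha> \<nu> (Polynomial.smult c (Polynomial.smult (1 / c) h)) = hw \<alpha> \<nu> h" using c by simp
        then show ?thesis using r that unfolding represents_def pm by blast
      qed
      then show ?thesis using c by simp
    qed
    with 1 show "f = Polynomial.smult (1 / c) h" by (rule uniq)
  next
    assume f: "f = Polynomial.smult (1 / c) h"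
    have "Polynomial.degree f \<le> Polynomial.degree g"
      if "hw \<alpha> \<nu> (Polynomial.smult c g) = hw \<alpha> \<nu> h" for g
      using uniq[OF that] c by (cases "Polynomial.degree g \<le> Polynomial.degree h") (auto simp: f)
    then show "represents \<alpha> (hw \<alpha> \<nu> [:c:]) (hw \<alpha> \<nu> h) f"
      unfolding represents_def pm using c by (simp add: f)
  }
qed

section \<open>The operators of the lowering elements and of the Casimir element\<close>

lemma acts_adE':
  assumes "acts \<alpha> u \<nu> c" "\<mu> = \<nu> + axis i 1 - axis j 1"
    "\<And>m n. d (pt \<alpha> m n) = (pt \<alpha> m n $ j + of_int (\<nu> $ j)) * c (pt \<alpha> m n) - pt \<alpha> m n $ j * c (pt \<alpha> m n + axis i 1 - axis j 1)"
  shows "acts \<alpha> (adE (i, j) u) \<mu> d"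
  by (rule acts_cong[OF acts_adE[OF assms(1)] assms(2)[symmetric]]) (elim S_cases, simp add: assms(3))

lemma pt_shift:
  "pt \<alpha> m n + axis 1 1 - axis 2 1 = pt \<alpha> (m - 1) n"
  "pt \<alpha> m n + axis 2 1 - axis 1 1 = pt \<alpha> (m + 1) n"
  "pt \<alpha> m n + axis 1 1 - axis 3 1 = pt \<alpha> m (n - 1)"
  "pt \<alpha> m n + axis 3 1 - axis 1 1 = pt \<alpha> m (n + 1)"
  "pt \<alpha> m n + axis 2 1 - axis 3 1 = pt \<alpha> (m + 1) (n - 1)"
  "pt \<alpha> m n + axis 3 1 - axis 2 1 = pt \<alpha> (m - 1) (n + 1)"
  by (auto simp: vec_eq_iff forall_3 axis_def)

lemma acts_adE_diag: "acts \<alpha> u \<nu> c \<Longrightarrow> acts \<alpha> (adE (i, i) u) \<nu> (\<lambda>k. of_int (\<nu> $ i) * c k)"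
  by (erule acts_cong[OF acts_adE]) (auto simp: algebra_simps)

lemma adU_z31: "adU z31 u = adE (1, 1) (adE (3, 1) u) - adE (2, 2) (adE (3, 1) u)
    + scaleU 2 (adE (3, 1) u) + adE (2, 1) (adE (3, 2) u)"
proof -
  have "adU 2 x = scaleU 2 x" for x
    using ugl3.scale_left_distrib[of 1 1 x] adU_add[of 1 1 x] by simp
  then show ?thesis
    by (simp add: z31_def adU_add adU_mult adU_diff adU_E)
qed

lemma adU_z23: "adU z23 u = adE (1, 1) (adE (2, 3) u) - adE (2, 2) (adE (2, 3) u)
    + scaleU 2 (adE (2, 3) u) - adE (2, 1) (adE (1, 3) u)"
proof -
  have "adU 2 x = scaleU 2 x" for x
    using ugl3.scale_left_distrib[of 1 1 x] adU_add[of 1 1 x] by simp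
  then show ?thesis
    by (simp add: z23_def adU_add adU_mult adU_diff adU_E)
qed

text \<open>
  Both sides are linear in \<open>F0 (z - b)\<close> and \<open>F1 (z + 1)\<close>; the expansion
  is done only after these products have been abstracted. The same holds for
  \<open>z23_identity\<close>.
\<close>

lemma z31_identity:
  fixes \<alpha> x z a b F0 F1 X' Y k :: complex
  assumes k: "k = \<alpha> - x - z"
  shows "(a + b + 1 - 1) * (X' * Y * ((k + (a + b + 1)) * F0 * (z - b) - k * F1 * (z + 1)))
    - (- a) * (X' * Y * ((k + (a + b + 1)) * F0 * (z - b) - k * F1 * (z + 1)))
    + 2 * (X' * Y * ((k + (a + b + 1)) * F0 * (z - b) - k * F1 * (z + 1)))
    + X' * (F0 * (z - b) * Y - F1 * (z + 1) * Y) * ((k + (a + b + 1)) * (x - a) - k * (x + 1))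
   = ((a + b + 1) * ((\<alpha> + a + 2 - (z - b)) * (z - b) * F0 + (z - b + a + b - \<alpha>) * (z + 1) * F1)) * (X' * Y)"
proof -
  have factor: "A * (X' * Y * (p * F0 * q - k * F1 * g)) - B * (X' * Y * (p * F0 * q - k * F1 * g))
    + 2 * (X' * Y * (p * F0 * q - k * F1 * g)) + X' * (F0 * q * Y - F1 * g * Y) * (p * r - k * e)
    = ((A - B + 2) * (p * (F0 * q) - k * (F1 * g)) + (F0 * q - F1 * g) * (p * r - k * e)) * (X' * Y)" for A B p q r e g
    by (simp add: algebra_simps)
  have core: "(a + b + 1 - 1 - (- a) + 2) * ((k + (a + b + 1)) * U - k * V) + (U - V) * ((k + (a + b + 1)) * (x - a) - k * (x + 1))
    = (a + b + 1) * ((\<alpha> + a + 2 - (z - b)) * U + (z - b + a + b - \<alpha>) * V)" for U V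
    unfolding k by (simp add: algebra_simps)
  show ?thesis unfolding factor core by (simp only: mult_ac)
qed

lemma z23_identity:
  fixes \<alpha> x z a b F0 F1 X' k :: complex
  assumes k: "k = \<alpha> - x - z"
  shows "(a + 1 - b) * (X' * ((z + b) * F0 * (x - a) - z * F1 * (x + 1)))
    - (- a - 1 + 1) * (X' * ((z + b) * F0 * (x - a) - z * F1 * (x + 1)))
    + 2 * (X' * ((z + b) * F0 * (x - a) - z * F1 * (x + 1)))
    - X' * ((z + b) * F0 - z * F1) * ((k + a + 2 - b) * (x - a) - k * (x + 1))
   = ((a + 1) * ((z + b) * (\<alpha> - z - a) * F0 - z * (\<alpha> - z - b + a + 3) * F1)) * X'"
proof -
  have factor: "A * (X' * (U * r - V * e)) - B * (X' * (U * r - V * e)) + 2 * (X' * (U * r - V * e)) - X' * (U - V) * W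
    = ((A - B + 2) * (U * r - V * e) - (U - V) * W) * X'" for A B U V W r e
    by (simp add: algebra_simps)
  have core: "(a + 1 - b - (- a - 1 + 1) + 2) * (U * (x - a) - V * (x + 1)) - (U - V) * ((k + a + 2 - b) * (x - a) - k * (x + 1))
    = (a + 1) * ((\<alpha> - z - a) * U - (\<alpha> - z - b + a + 3) * V)" for U V
    unfolding k by (simp add: algebra_simps)
  show ?thesis unfolding factor core by (simp only: mult_ac)
qed

text \<open>
  Although \<open>z\<^sub>3\<^sub>1\<close> is quadratic, the dependence on
  \<open>k\<^sub>1\<close> and \<open>k\<^sub>2\<close> cancels except through \<open>k\<^sub>1 +
  k\<^sub>2 = \<alpha> - k\<^sub>3\<close>, so that the result is again a polynomial in
  \<open>E\<^sub>3\<^sub>3\<close> times a standard vector. The relations \<open>x ff(x - 1) = (x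
  - a) ff(x)\<close> for falling factorials \<open>ff\<close> of length \<open>a\<close> absorb
  the shifts.
\<close>

lemma acts_z31:
  assumes dom: "dominant \<nu>" and n3: "\<nu> $ 3 < 0"
    and L: "\<And>t. poly L t = of_int (\<nu> $ 1) * ((\<alpha> - of_int (\<nu> $ 2) + 2 - t) * t * poly f (t - 1)
       + (t + of_int (\<nu> $ 1) - 1 - \<alpha>) * (t - of_int (\<nu> $ 3)) * poly f t)"
  shows "acts \<alpha> (adU z31 (poly_E33 f * std \<nu>)) (\<nu> + axis 3 1 - axis 1 1)
     (\<lambda>k. poly L (k $ 3 + of_int ((\<nu> + axis 3 1 - axis 1 1) $ 3)) * std_coeff (\<nu> + axis 3 1 - axis 1 1) k)"
proof -
  define a b where "a = nat (- \<nu> $ 2)" and "b = nat (- \<nu> $ 3) - 1"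
  have n2: "complex_of_int (\<nu> $ 2) = - of_nat a" using dom by (simp add: a_def dominant_def)
  have b: "nat (- \<nu> $ 3) = Suc b" using n3 by (simp add: b_def)
  have n3': "complex_of_int (\<nu> $ 3) = - of_nat b - 1" using n3 by (simp add: b_def of_nat_diff)
  have n1: "complex_of_int (\<nu> $ 1) = of_nat a + of_nat b + 1"
  proof -
    have "complex_of_int (\<nu> $ 1) = - complex_of_int (\<nu> $ 2) - complex_of_int (\<nu> $ 3)"
      using arg_cong[OF dominant_sum[OF dom], of complex_of_int] by (simp add: eq_neg_iff_add_eq_0 algebra_simps)
    then show ?thesis by (simp add: n2 n3')
  qed
  define F where "F z = poly f (z - of_nat b - 1)" for z
  define Y where "Y z = falling z b" for z
  let ?X = "\<lambda>x. falling x a"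
  define c where "c k = poly f (k $ 3 + of_int (\<nu> $ 3)) * std_coeff \<nu> k" for k
  have c: "c (pt \<alpha> x z) = F z * (?X x * falling z (Suc b))" for x z
    by (simp add: c_def F_def std_coeff_def a_def[symmetric] b n3' algebra_simps)
  have Y0: "falling z (Suc b) = (z - of_nat b) * Y z" for z by (simp add: falling_Suc Y_def)
  have Y1: "falling (z + 1) (Suc b) = (z + 1) * Y z" for z
    using falling_Suc'[of "z + 1" b] by (simp add: Y_def)
  define G where "G z = F z * (z - of_nat b) * Y z - F (z + 1) * (z + 1) * Y z" for z
  have c1: "acts \<alpha> (adE (3, 1) (poly_E33 f * std \<nu>)) (\<nu> + axis 3 1 - axis 1 1)
    (\<lambda>k. ?X (k $ 2) * Y (k $ 3) * ((k $ 1 + of_int (\<nu> $ 1)) * F (k $ 3) * (k $ 3 - of_nat b) - k $ 1 * F (k $ 3 + 1) * (k $ 3 + 1)))"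
    by (rule acts_adE'[OF acts_hw[OF dom, where f = f, folded c_def] refl])
       (simp only: pt_shift c Y1 pt_nth, simp add: Y0 algebra_simps n3')
  have c2: "acts \<alpha> (adE (3, 2) (poly_E33 f * std \<nu>)) (\<nu> + axis 3 1 - axis 2 1)
    (\<lambda>k. (k $ 2 - of_nat a) * ?X (k $ 2) * G (k $ 3))"
  proof (rule acts_adE'[OF acts_hw[OF dom, where f = f, folded c_def] refl])
    fix x z
    have "(x - of_nat a) * (F z * (?X x * ((z - of_nat b) * Y z))) - (x * ?X (x - 1)) * (F (z + 1) * ((z + 1) * Y z))
      = (x - of_nat a) * ?X x * G z"
      unfolding falling_shift G_def by (simp add: algebra_simps)
    then show "(pt \<alpha> x z $ 2 - of_nat a) * ?X (pt \<alpha> x z $ 2) * G (pt \<alpha> x z $ 3) =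
       (pt \<alpha> x z $ 2 + of_int (\<nu> $ 2)) * c (pt \<alpha> x z) - pt \<alpha> x z $ 2 * c (pt \<alpha> x z + axis 3 1 - axis 2 1)"
      by (simp only: pt_shift c Y1 pt_nth) (simp add: Y0 n2 mult_ac)
  qed
  have c3: "acts \<alpha> (adE (2, 1) (adE (3, 2) (poly_E33 f * std \<nu>))) (\<nu> + axis 3 1 - axis 1 1)
    (\<lambda>k. ?X (k $ 2) * G (k $ 3) * ((k $ 1 + of_int (\<nu> $ 1)) * (k $ 2 - of_nat a) - k $ 1 * (k $ 2 + 1)))"
  proof (rule acts_adE'[OF c2])
    fix x z
    have "(\<alpha> - x - z + of_int (\<nu> $ 1)) * ((x - of_nat a) * ?X x * G z) - (\<alpha> - x - z) * (((x + 1 - of_nat a) * ?X (x + 1)) * G z)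
      = ?X x * G z * ((\<alpha> - x - z + of_int (\<nu> $ 1)) * (x - of_nat a) - (\<alpha> - x - z) * (x + 1))"
      unfolding falling_shift' by (simp add: algebra_simps)
    then show "?X (pt \<alpha> x z $ 2) * G (pt \<alpha> x z $ 3) * ((pt \<alpha> x z $ 1 + of_int (\<nu> $ 1)) * (pt \<alpha> x z $ 2 - of_nat a) - pt \<alpha> x z $ 1 * (pt \<alpha> x z $ 2 + 1))
     = (pt \<alpha> x z $ 1 + of_int ((\<nu> + axis 3 1 - axis 2 1) $ 1)) * ((pt \<alpha> x z $ 2 - of_nat a) * ?X (pt \<alpha> x z $ 2) * G (pt \<alpha> x z $ 3))
     - pt \<alpha> x z $ 1 * (((pt \<alpha> x z + axis 2 1 - axis 1 1) $ 2 - of_nat a) * ?X ((pt \<alpha> x z + axis 2 1 - axis 1 1) $ 2) * G ((pt \<alpha> x z + axis 2 1 - axis 1 1) $ 3))"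
      unfolding pt_shift by (simp add: axis_def)
  qed simp
  have comp: "(\<nu> + axis 3 1 - axis 1 1) $ 1 = \<nu> $ 1 - 1" "(\<nu> + axis 3 1 - axis 1 1) $ 2 = \<nu> $ 2"
    "(\<nu> + axis 3 1 - axis 1 1) $ 3 = \<nu> $ 3 + 1" by (simp_all add: axis_def)
  note all = acts_add[OF acts_add[OF acts_diff[OF acts_adE_diag[OF c1, of 1] acts_adE_diag[OF c1, of 2]] acts_scale[OF c1, of 2]] c3]
  show ?thesis unfolding adU_z31
  proof (rule acts_cong[OF all refl])
    fix k assume "k \<in> S_exponents \<alpha>"
    then obtain m n where k: "k = pt \<alpha> (of_nat m) (of_nat n)" by (rule S_cases)
    define x z where "x = (of_nat m :: complex)" and "z = (of_nat n :: complex)"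
    have k': "k = pt \<alpha> x z" by (simp add: k x_def z_def)
    have nb: "nat (- (\<nu> $ 3 + 1)) = b" using n3 by (simp add: b_def)
    have Lz: "poly L (z - of_nat b) = (of_nat a + of_nat b + 1) * ((\<alpha> + of_nat a + 2 - (z - of_nat b)) * (z - of_nat b) * F z
       + (z - of_nat b + of_nat a + of_nat b - \<alpha>) * (z + 1) * F (z + 1))"
      unfolding L by (simp add: n1 n2 n3' F_def algebra_simps)
    show "of_int ((\<nu> + axis 3 1 - axis 1 1) $ 1) * (?X (k $ 2) * Y (k $ 3) * ((k $ 1 + of_int (\<nu> $ 1)) * F (k $ 3) * (k $ 3 - of_nat b) - k $ 1 * F (k $ 3 + 1) * (k $ 3 + 1)))
       - of_int ((\<nu> + axis 3 1 - axis 1 1) $ 2) * (?X (k $ 2) * Y (k $ 3) * ((k $ 1 + of_int (\<nu> $ 1)) * F (k $ 3) * (k $ 3 - of_nat b) - k $ 1 * F (k $ 3 + 1) * (k $ 3 + 1)))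
       + 2 * (?X (k $ 2) * Y (k $ 3) * ((k $ 1 + of_int (\<nu> $ 1)) * F (k $ 3) * (k $ 3 - of_nat b) - k $ 1 * F (k $ 3 + 1) * (k $ 3 + 1)))
       + ?X (k $ 2) * G (k $ 3) * ((k $ 1 + of_int (\<nu> $ 1)) * (k $ 2 - of_nat a) - k $ 1 * (k $ 2 + 1))
      = poly L (k $ 3 + of_int ((\<nu> + axis 3 1 - axis 1 1) $ 3)) * std_coeff (\<nu> + axis 3 1 - axis 1 1) k"
    proof -
      have "poly L (z + of_int (\<nu> $ 3 + 1)) = poly L (z - of_nat b)" by (simp add: n3' algebra_simps)
      then show ?thesis
        using z31_identity[OF refl, where \<alpha> = \<alpha> and x = x and z = z and a = "of_nat a" and b = "of_nat b"
            and X' = "?X x" and Y = "Y z" and ?F0.0 = "F z" and ?F1.0 = "F (z + 1)"]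
        unfolding comp k' pt_nth std_coeff_def nb a_def[symmetric] Y_def[symmetric] G_def of_int_diff of_int_1 n1 n2
        by (simp only: Lz)
    qed
  qed
qed

lemma acts_z23:
  assumes dom: "dominant \<nu>" and n3: "\<nu> $ 3 > 0"
    and L: "\<And>t. poly L t = - of_int (\<nu> $ 2) * ((t + 1) * (\<alpha> - t + of_int (\<nu> $ 3) + of_int (\<nu> $ 2)) * poly f (t + 1)
       - (t - of_int (\<nu> $ 3) + 1) * (\<alpha> - t - of_int (\<nu> $ 2) + 1) * poly f t)"
  shows "acts \<alpha> (adU z23 (poly_E33 f * std \<nu>)) (\<nu> + axis 2 1 - axis 3 1)
     (\<lambda>k. poly L (k $ 3 + of_int ((\<nu> + axis 2 1 - axis 3 1) $ 3)) * std_coeff (\<nu> + axis 2 1 - axis 3 1) k)"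
proof -
  define a where "a = nat (- \<nu> $ 2) - 1"
  define b where "b = complex_of_int (\<nu> $ 3)"
  have lt: "\<nu> $ 2 < 0" using dom n3 dominant_sum[OF dom] by (simp add: dominant_def)
  have n2: "complex_of_int (\<nu> $ 2) = - of_nat a - 1" using lt by (simp add: a_def of_nat_diff)
  have a: "nat (- \<nu> $ 2) = Suc a" using lt by (simp add: a_def)
  have n1: "complex_of_int (\<nu> $ 1) = of_nat a + 1 - b"
  proof -
    have "complex_of_int (\<nu> $ 1) = - complex_of_int (\<nu> $ 2) - complex_of_int (\<nu> $ 3)"
      using arg_cong[OF dominant_sum[OF dom], of complex_of_int] by (simp add: eq_neg_iff_add_eq_0 algebra_simps)
    then show ?thesis by (simp add: n2 b_def)
  qed
  define F where "F z = poly f (z + b)" for z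
  define X' where "X' x = falling x a" for x
  define c where "c k = poly f (k $ 3 + of_int (\<nu> $ 3)) * std_coeff \<nu> k" for k
  have X0: "falling x (Suc a) = (x - of_nat a) * X' x" for x by (simp add: falling_Suc X'_def)
  have X1: "falling (x + 1) (Suc a) = (x + 1) * X' x" for x
    using falling_Suc'[of "x + 1" a] by (simp add: X'_def)
  have c: "c (pt \<alpha> x z) = F z * falling x (Suc a)" for x z
    using n3 by (simp add: c_def F_def std_coeff_def a b_def[symmetric])
  define G where "G z = (z + b) * F z - z * F (z - 1)" for z
  have c1: "acts \<alpha> (adE (2, 3) (poly_E33 f * std \<nu>)) (\<nu> + axis 2 1 - axis 3 1)
    (\<lambda>k. X' (k $ 2) * ((k $ 3 + b) * F (k $ 3) * (k $ 2 - of_nat a) - k $ 3 * F (k $ 3 - 1) * (k $ 2 + 1)))"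
    by (rule acts_adE'[OF acts_hw[OF dom, where f = f, folded c_def] refl])
       (simp only: pt_shift c X1 pt_nth, simp add: X0 b_def[symmetric] algebra_simps)
  have c2: "acts \<alpha> (adE (1, 3) (poly_E33 f * std \<nu>)) (\<nu> + axis 1 1 - axis 3 1)
    (\<lambda>k. falling (k $ 2) (Suc a) * G (k $ 3))"
    by (rule acts_adE'[OF acts_hw[OF dom, where f = f, folded c_def] refl])
       (simp only: pt_shift c pt_nth, simp add: G_def b_def[symmetric] algebra_simps)
  have c3: "acts \<alpha> (adE (2, 1) (adE (1, 3) (poly_E33 f * std \<nu>))) (\<nu> + axis 2 1 - axis 3 1)
    (\<lambda>k. X' (k $ 2) * G (k $ 3) * ((k $ 1 + of_nat a + 2 - b) * (k $ 2 - of_nat a) - k $ 1 * (k $ 2 + 1)))"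
    by (rule acts_adE'[OF c2])
       (simp, simp only: pt_shift X1 pt_nth, simp add: X0 n1 axis_def algebra_simps)
  have comp: "(\<nu> + axis 2 1 - axis 3 1) $ 1 = \<nu> $ 1" "(\<nu> + axis 2 1 - axis 3 1) $ 2 = \<nu> $ 2 + 1"
    "(\<nu> + axis 2 1 - axis 3 1) $ 3 = \<nu> $ 3 - 1" by (simp_all add: axis_def)
  note all = acts_diff[OF acts_add[OF acts_diff[OF acts_adE_diag[OF c1, of 1] acts_adE_diag[OF c1, of 2]] acts_scale[OF c1, of 2]] c3]
  show ?thesis unfolding adU_z23
  proof (rule acts_cong[OF all refl])
    fix k assume "k \<in> S_exponents \<alpha>"
    then obtain m n where k: "k = pt \<alpha> (of_nat m) (of_nat n)" by (rule S_cases)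
    define x z where "x = (of_nat m :: complex)" and "z = (of_nat n :: complex)"
    have k': "k = pt \<alpha> x z" by (simp add: k x_def z_def)
    have na: "nat (- (\<nu> $ 2 + 1)) = a" using lt by (simp add: a_def)
    have nb: "nat (- (\<nu> $ 3 - 1)) = 0" using n3 by simp
    have Lz: "poly L (z + b - 1) = (of_nat a + 1) * ((z + b) * (\<alpha> - z - of_nat a) * F z
       - z * (\<alpha> - z - b + of_nat a + 3) * F (z - 1))"
      unfolding L by (simp add: n2 b_def[symmetric] F_def algebra_simps)
    show "of_int ((\<nu> + axis 2 1 - axis 3 1) $ 1) * (X' (k $ 2) * ((k $ 3 + b) * F (k $ 3) * (k $ 2 - of_nat a) - k $ 3 * F (k $ 3 - 1) * (k $ 2 + 1)))
       - of_int ((\<nu> + axis 2 1 - axis 3 1) $ 2) * (X' (k $ 2) * ((k $ 3 + b) * F (k $ 3) * (k $ 2 - of_nat a) - k $ 3 * F (k $ 3 - 1) * (k $ 2 + 1)))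
       + 2 * (X' (k $ 2) * ((k $ 3 + b) * F (k $ 3) * (k $ 2 - of_nat a) - k $ 3 * F (k $ 3 - 1) * (k $ 2 + 1)))
       - X' (k $ 2) * G (k $ 3) * ((k $ 1 + of_nat a + 2 - b) * (k $ 2 - of_nat a) - k $ 1 * (k $ 2 + 1))
      = poly L (k $ 3 + of_int ((\<nu> + axis 2 1 - axis 3 1) $ 3)) * std_coeff (\<nu> + axis 2 1 - axis 3 1) k"
    proof -
      have "poly L (z + of_int (\<nu> $ 3 - 1)) = poly L (z + b - 1)" by (simp add: b_def algebra_simps)
      then show ?thesis
        using z23_identity[OF refl, where \<alpha> = \<alpha> and x = x and z = z and a = "of_nat a" and b = b
            and X' = "X' x" and ?F0.0 = "F z" and ?F1.0 = "F (z - 1)"]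
        unfolding comp k' pt_nth std_coeff_def na nb falling_0 X'_def[symmetric] G_def of_int_add of_int_1 n1 n2
        by (simp only: Lz mult_1_right)
    qed
  qed
qed

lemma acts_pair:
  assumes "acts \<alpha> u \<nu> c" "i \<noteq> j"
  shows "acts \<alpha> (adE (i, j) (adE (j, i) u)) \<nu>
    (\<lambda>k. (k $ j + of_int (\<nu> $ j) + 1) * ((k $ i + of_int (\<nu> $ i)) * c k - k $ i * c (k + axis j 1 - axis i 1))
       - k $ j * ((k $ i + 1 + of_int (\<nu> $ i)) * c (k + axis i 1 - axis j 1) - (k $ i + 1) * c k))"
  by (rule acts_cong[OF acts_adE[OF acts_adE[OF assms(1)]]]) (use assms(2) in \<open>auto simp: axis_def\<close>)

text \<open>
  The coefficient of the unshifted term. Here \<open>b = max 0 (-\<nu>\<^sub>3)\<close>, which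
  explains the case distinction, and \<open>b - N2\<close> is the width.
\<close>

lemma casimir_identity:
  fixes \<alpha> x z b N1 N2 N3 k t :: complex
  assumes k: "k = \<alpha> - x - z" and t: "t = z + N3" and N1: "N1 = - N2 - N3" and b: "b = 0 \<or> b = - N3"
  shows "N1 * N1 + N2 * N2 + N3 * N3
     + ((x + N2 + 1) * (k + N1) + x * (k + 1) + (k + N1 + 1) * (x + N2) + k * (x + 1))
     + ((z + N3 + 1) * (k + N1) + z * (k + 1) + (k + N1 + 1) * (z + N3) + k * (z + 1))
     + ((z + N3 + 1) * (x + N2) + z * (x + 1) + (x + N2 + 1) * (z + N3) + x * (z + 1))
     - 2 * k * (x + 1) - 2 * (k + N1 + 1) * (x + N2)
     = 2 * (b - N2) * (b - N2 + 2) - 2 * (t + 1 + b) * (t + N1 - \<alpha>) - 2 * (t - N3 - b) * (t + N2 - \<alpha> - 2)"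
  using b by (elim disjE) (simp_all add: k t N1 algebra_simps)

text \<open>
  The nine terms are grouped into the diagonal ones and three pairs \<open>(i, j), (j, i)\<close>.
  The shifts that change \<open>k\<^sub>2\<close> alone are absorbed by the falling factorial, and
  the remaining ones shift \<open>k\<^sub>3\<close> by one in either direction, with coefficients
  that depend on \<open>k\<^sub>1 + k\<^sub>2\<close> only.
\<close>

lemma acts_casimir:
  assumes dom: "dominant \<nu>"
  shows "acts \<alpha> (adU casimir (poly_E33 f * std \<nu>)) \<nu>
    (\<lambda>k. (2 * ((k $ 3 + of_int (\<nu> $ 3) + 1 + of_nat (nat (- \<nu> $ 3))) * (k $ 3 + of_int (\<nu> $ 3) + of_int (\<nu> $ 1) - \<alpha>) * fdiff f (k $ 3 + of_int (\<nu> $ 3))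
        - (k $ 3 + of_int (\<nu> $ 3) - of_nat (base \<nu>)) * (k $ 3 + of_int (\<nu> $ 3) + of_int (\<nu> $ 2) - \<alpha> - 2) * bdiff f (k $ 3 + of_int (\<nu> $ 3)))
        + 2 * of_nat (width \<nu>) * (of_nat (width \<nu>) + 2) * poly f (k $ 3 + of_int (\<nu> $ 3))) * std_coeff \<nu> k)"
proof -
  let ?u = "poly_E33 f * std \<nu>"
  define N1 N2 N3 where N: "N1 = complex_of_int (\<nu> $ 1)" "N2 = complex_of_int (\<nu> $ 2)" "N3 = complex_of_int (\<nu> $ 3)"
  define a b' where "a = nat (- \<nu> $ 2)" and "b' = nat (- \<nu> $ 3)"
  define b where "b = complex_of_nat b'"
  have a: "of_nat a = - N2" using dom by (simp add: a_def N dominant_def)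
  have N1: "N1 = - N2 - N3"
    using arg_cong[OF dominant_sum[OF dom], of complex_of_int] by (simp add: N eq_neg_iff_add_eq_0 algebra_simps)
  have b: "b = 0 \<or> b = - N3" by (cases "\<nu> $ 3 \<ge> 0") (auto simp: b_def b'_def N)
  have base: "of_nat (base \<nu>) = N3 + b" by (cases "\<nu> $ 3 \<ge> 0") (auto simp: base_def b_def b'_def N)
  have width: "of_nat (width \<nu>) = b - N2" using a by (simp add: width_def a_def b_def b'_def)
  define c where "c k = poly f (k $ 3 + of_int (\<nu> $ 3)) * std_coeff \<nu> k" for k
  have act: "acts \<alpha> ?u \<nu> c" unfolding c_def by (rule acts_hw[OF dom])
  have cas: "adU casimir ?u = adE (1, 1) (adE (1, 1) ?u) + adE (2, 2) (adE (2, 2) ?u) + adE (3, 3) (adE (3, 3) ?u)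
     + adE (1, 2) (adE (2, 1) ?u) + adE (2, 1) (adE (1, 2) ?u)
     + adE (1, 3) (adE (3, 1) ?u) + adE (3, 1) (adE (1, 3) ?u)
     + adE (2, 3) (adE (3, 2) ?u) + adE (3, 2) (adE (2, 3) ?u)"
    by (simp add: adU_casimir prod_UNIV_3 sum_3 add_ac)
  have ne: "(1::3) \<noteq> 2" "(2::3) \<noteq> 1" "(1::3) \<noteq> 3" "(3::3) \<noteq> 1" "(2::3) \<noteq> 3" "(3::3) \<noteq> 2" by auto
  note diag = acts_adE_diag[OF acts_adE_diag[OF act]]
  note all = acts_add[OF acts_add[OF acts_add[OF acts_add[OF acts_add[OF acts_add[OF acts_add[OF acts_add[OF
      diag[of 1] diag[of 2]] diag[of 3]]
      acts_pair[OF act ne(1)]] acts_pair[OF act ne(2)]] acts_pair[OF act ne(3)]] acts_pair[OF act ne(4)]]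
      acts_pair[OF act ne(5)]] acts_pair[OF act ne(6)]]
  show ?thesis unfolding cas
  proof (rule acts_cong[OF all refl], elim S_cases)
    fix k0 m0 n0
    assume k0: "k0 = pt \<alpha> (of_nat m0) (of_nat n0)"
    define x z where "x = (of_nat m0 :: complex)" and "z = (of_nat n0 :: complex)"
    define k where "k = \<alpha> - x - z"
    define t where "t = z + N3"
    define Xf Y where "Xf y = falling y a" and "Y y = falling y b'" for y
    define M where "M = Xf x * Y z"
    have c: "c (pt \<alpha> y s) = poly f (s + N3) * (Xf y * Y s)" for y s
      by (simp add: c_def std_coeff_def Xf_def Y_def N a_def b'_def)
    have X1: "(x + N2 + 1) * Xf (x + 1) = (x + 1) * Xf x" and X2: "x * Xf (x - 1) = (x + N2) * Xf x"
      using falling_shift'[of x a] falling_shift[of x a] by (simp_all add: Xf_def a algebra_simps)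
    have Y1: "(z + N3 + 1) * Y (z + 1) = (t + 1 + b) * Y z"
    proof (cases "\<nu> $ 3 \<le> 0")
      case True
      then have "b = - N3" by (simp add: b_def b'_def N)
      then show ?thesis using falling_shift'[of z b'] by (simp add: Y_def t_def b_def algebra_simps)
    next
      case False
      then have "b' = 0" by (simp add: b'_def)
      then show ?thesis by (simp add: Y_def t_def b_def algebra_simps)
    qed
    have Y2: "z * Y (z - 1) = (t - N3 - b) * Y z"
      using falling_shift[of z b'] by (simp add: Y_def t_def b_def)
    define F Fp Fm where F: "F = poly f t" "Fp = poly f (t + 1)" "Fm = poly f (t - 1)"
    define c0 c12 c21 c13 c31 c23 c32 where cs: "c0 = c (pt \<alpha> x z)" "c12 = c (pt \<alpha> (x + 1) z)" "c21 = c (pt \<alpha> (x - 1) z)"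
      "c13 = c (pt \<alpha> x (z + 1))" "c31 = c (pt \<alpha> x (z - 1))" "c23 = c (pt \<alpha> (x - 1) (z + 1))" "c32 = c (pt \<alpha> (x + 1) (z - 1))"
    have tt: "z + 1 + N3 = t + 1" "z - 1 + N3 = t - 1" "z + N3 = t" by (simp_all add: t_def)
    have C0: "c0 = F * M" by (simp add: cs c tt F M_def)
    have C12: "(x + N2 + 1) * c12 = (x + 1) * (F * M)"
    proof -
      have "(x + N2 + 1) * c12 = F * Y z * ((x + N2 + 1) * Xf (x + 1))" by (simp add: cs c tt F)
      then show ?thesis unfolding X1 by (simp add: M_def)
    qed
    have C21: "x * c21 = (x + N2) * (F * M)"
    proof -
      have "x * c21 = F * Y z * (x * Xf (x - 1))" by (simp add: cs c tt F)
      then show ?thesis unfolding X2 by (simp add: M_def)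
    qed
    have C13: "(z + N3 + 1) * c13 = (t + 1 + b) * (Fp * M)"
    proof -
      have "(z + N3 + 1) * c13 = Fp * Xf x * ((z + N3 + 1) * Y (z + 1))" by (simp only: cs c tt F mult_ac)
      then show ?thesis unfolding Y1 by (simp only: M_def mult_ac)
    qed
    have C31: "z * c31 = (t - N3 - b) * (Fm * M)"
    proof -
      have "z * c31 = Fm * Xf x * (z * Y (z - 1))" by (simp only: cs c tt F mult_ac)
      then show ?thesis unfolding Y2 by (simp only: M_def mult_ac)
    qed
    have C23: "x * ((z + N3 + 1) * c23) = (x + N2) * (t + 1 + b) * (Fp * M)"
    proof -
      have "x * ((z + N3 + 1) * c23) = Fp * (x * Xf (x - 1)) * ((z + N3 + 1) * Y (z + 1))" by (simp only: cs c tt F mult_ac)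
      then show ?thesis unfolding X2 Y1 by (simp only: M_def mult_ac)
    qed
    have C32: "z * ((x + N2 + 1) * c32) = (x + 1) * (t - N3 - b) * (Fm * M)"
    proof -
      have "z * ((x + N2 + 1) * c32) = Fm * ((x + N2 + 1) * Xf (x + 1)) * (z * Y (z - 1))" by (simp only: cs c tt F mult_ac)
      then show ?thesis unfolding X1 Y2 by (simp only: M_def mult_ac)
    qed
    have pair: "(kj + Nj + 1) * ((ki + Ni) * C - ki * Cij) - kj * ((ki + 1 + Ni) * Cji - (ki + 1) * C)
       + ((ki + Ni + 1) * ((kj + Nj) * C - kj * Cji) - ki * ((kj + 1 + Nj) * Cij - (kj + 1) * C))
      = ((kj + Nj + 1) * (ki + Ni) + kj * (ki + 1) + (ki + Ni + 1) * (kj + Nj) + ki * (kj + 1)) * C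
        - 2 * ki * ((kj + Nj + 1) * Cij) - 2 * (ki + Ni + 1) * (kj * Cji)" for ki kj Ni Nj C Cij Cji :: complex
      by (simp add: algebra_simps)
    let ?T = "\<lambda>ki kj Ni Nj Cij Cji. (kj + Nj + 1) * ((ki + Ni) * c0 - ki * Cij) - kj * ((ki + 1 + Ni) * Cji - (ki + 1) * c0)"
    have 12: "?T k x N1 N2 c12 c21 + ?T x k N2 N1 c21 c12
       = ((x + N2 + 1) * (k + N1) + x * (k + 1) + (k + N1 + 1) * (x + N2) + k * (x + 1)) * (F * M)
         - 2 * k * (x + 1) * (F * M) - 2 * (k + N1 + 1) * (x + N2) * (F * M)"
      unfolding pair unfolding C12 C21 C0 by (simp only: mult.assoc)
    have 13: "?T k z N1 N3 c13 c31 + ?T z k N3 N1 c31 c13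
       = ((z + N3 + 1) * (k + N1) + z * (k + 1) + (k + N1 + 1) * (z + N3) + k * (z + 1)) * (F * M)
         - 2 * k * ((t + 1 + b) * (Fp * M)) - 2 * (k + N1 + 1) * ((t - N3 - b) * (Fm * M))"
      unfolding pair unfolding C13 C31 C0 by (simp only: mult.assoc)
    have 23: "?T x z N2 N3 c23 c32 + ?T z x N3 N2 c32 c23
       = ((z + N3 + 1) * (x + N2) + z * (x + 1) + (x + N2 + 1) * (z + N3) + x * (z + 1)) * (F * M)
         - 2 * ((x + N2) * (t + 1 + b) * (Fp * M)) - 2 * ((x + 1) * (t - N3 - b) * (Fm * M))"
    proof -
      have C32': "(x + N2 + 1) * (z * c32) = (x + 1) * (t - N3 - b) * (Fm * M)"
        using C32 by (simp only: mult.left_commute)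
      show ?thesis unfolding pair unfolding C0 by (simp only: mult.assoc C23 C32')
    qed
    have total: "N1 * (N1 * c0) + N2 * (N2 * c0) + N3 * (N3 * c0) + ?T k x N1 N2 c12 c21 + ?T x k N2 N1 c21 c12
       + ?T k z N1 N3 c13 c31 + ?T z k N3 N1 c31 c13 + ?T x z N2 N3 c23 c32 + ?T z x N3 N2 c32 c23
       = (2 * ((t + 1 + b) * (t + N1 - \<alpha>) * (Fp - F) - (t - (N3 + b)) * (t + N2 - \<alpha> - 2) * (F - Fm))
         + 2 * (b - N2) * (b - N2 + 2) * F) * M"
    proof -
      have "N1 * (N1 * c0) + N2 * (N2 * c0) + N3 * (N3 * c0) + ?T k x N1 N2 c12 c21 + ?T x k N2 N1 c21 c12
         + ?T k z N1 N3 c13 c31 + ?T z k N3 N1 c31 c13 + ?T x z N2 N3 c23 c32 + ?T z x N3 N2 c32 c23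
        = N1 * (N1 * c0) + N2 * (N2 * c0) + N3 * (N3 * c0) + (?T k x N1 N2 c12 c21 + ?T x k N2 N1 c21 c12)
         + (?T k z N1 N3 c13 c31 + ?T z k N3 N1 c31 c13) + (?T x z N2 N3 c23 c32 + ?T z x N3 N2 c32 c23)"
        by (simp only: add.assoc)
      also have "\<dots> = (N1 * N1 + N2 * N2 + N3 * N3
         + ((x + N2 + 1) * (k + N1) + x * (k + 1) + (k + N1 + 1) * (x + N2) + k * (x + 1))
         + ((z + N3 + 1) * (k + N1) + z * (k + 1) + (k + N1 + 1) * (z + N3) + k * (z + 1))
         + ((z + N3 + 1) * (x + N2) + z * (x + 1) + (x + N2 + 1) * (z + N3) + x * (z + 1))
         - 2 * k * (x + 1) - 2 * (k + N1 + 1) * (x + N2)) * (F * M)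
         - 2 * (k + x + N2) * ((t + 1 + b) * (Fp * M)) - 2 * (k + N1 + 1 + x + 1) * ((t - N3 - b) * (Fm * M))"
      proof -
        have gen: "N1 * (N1 * C) + N2 * (N2 * C) + N3 * (N3 * C) + (P * C - 2 * k * q * C - 2 * r * s * C)
          + (P' * C - 2 * k * (g * D) - 2 * r * (h * D')) + (P'' * C - 2 * (v * g * D) - 2 * (w * h * D'))
          = (N1 * N1 + N2 * N2 + N3 * N3 + P + P' + P'' - 2 * k * q - 2 * r * s) * C
            - 2 * (k + v) * (g * D) - 2 * (r + w) * (h * D')" for C P P' P'' q r s g h D D' v w
          by (simp add: algebra_simps)
        show ?thesis unfolding 12 13 23 unfolding C0 gen by (simp only: add.assoc)
      qed
      also have "\<dots> = (2 * (b - N2) * (b - N2 + 2) - 2 * (t + 1 + b) * (t + N1 - \<alpha>) - 2 * (t - N3 - b) * (t + N2 - \<alpha> - 2)) * (F * M)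
         - 2 * (k + x + N2) * ((t + 1 + b) * (Fp * M)) - 2 * (k + N1 + 1 + x + 1) * ((t - N3 - b) * (Fm * M))"
        unfolding casimir_identity[OF k_def t_def N1 b] ..
      also have "k + x + N2 = - (t + N1 - \<alpha>)" by (simp add: k_def t_def N1)
      also have "k + N1 + 1 + x + 1 = - (t + N2 - \<alpha> - 2)" by (simp add: k_def t_def N1)
      also have "(2 * (b - N2) * (b - N2 + 2) - 2 * (t + 1 + b) * (t + N1 - \<alpha>) - 2 * (t - N3 - b) * (t + N2 - \<alpha> - 2)) * (F * M)
         - 2 * - (t + N1 - \<alpha>) * ((t + 1 + b) * (Fp * M)) - 2 * - (t + N2 - \<alpha> - 2) * ((t - N3 - b) * (Fm * M))
         = (2 * ((t + 1 + b) * (t + N1 - \<alpha>) * (Fp - F) - (t - (N3 + b)) * (t + N2 - \<alpha> - 2) * (F - Fm))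
         + 2 * (b - N2) * (b - N2 + 2) * F) * M"
      proof -
        have "(w - 2 * p * q - 2 * r * s) * (F * M) - 2 * - q * (p * (Fp * M)) - 2 * - s * (r * (Fm * M))
          = (2 * (p * q * (Fp - F) - r * s * (F - Fm)) + w * F) * M" for w p q r s
          by (simp add: algebra_simps)
        then show ?thesis by (simp only: diff_diff_eq)
      qed
      finally show ?thesis .
    qed
    have k1: "k0 = pt \<alpha> x z" by (simp add: k0 x_def z_def)
    have M: "std_coeff \<nu> k0 = M" by (simp add: k1 std_coeff_def M_def Xf_def Y_def a_def b'_def)
    show "of_int (\<nu> $ 1) * (of_int (\<nu> $ 1) * c k0) + of_int (\<nu> $ 2) * (of_int (\<nu> $ 2) * c k0) + of_int (\<nu> $ 3) * (of_int (\<nu> $ 3) * c k0)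
      + ((k0 $ 2 + of_int (\<nu> $ 2) + 1) * ((k0 $ 1 + of_int (\<nu> $ 1)) * c k0 - k0 $ 1 * c (k0 + axis 2 1 - axis 1 1))
         - k0 $ 2 * ((k0 $ 1 + 1 + of_int (\<nu> $ 1)) * c (k0 + axis 1 1 - axis 2 1) - (k0 $ 1 + 1) * c k0))
      + ((k0 $ 1 + of_int (\<nu> $ 1) + 1) * ((k0 $ 2 + of_int (\<nu> $ 2)) * c k0 - k0 $ 2 * c (k0 + axis 1 1 - axis 2 1))
         - k0 $ 1 * ((k0 $ 2 + 1 + of_int (\<nu> $ 2)) * c (k0 + axis 2 1 - axis 1 1) - (k0 $ 2 + 1) * c k0))
      + ((k0 $ 3 + of_int (\<nu> $ 3) + 1) * ((k0 $ 1 + of_int (\<nu> $ 1)) * c k0 - k0 $ 1 * c (k0 + axis 3 1 - axis 1 1))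
         - k0 $ 3 * ((k0 $ 1 + 1 + of_int (\<nu> $ 1)) * c (k0 + axis 1 1 - axis 3 1) - (k0 $ 1 + 1) * c k0))
      + ((k0 $ 1 + of_int (\<nu> $ 1) + 1) * ((k0 $ 3 + of_int (\<nu> $ 3)) * c k0 - k0 $ 3 * c (k0 + axis 1 1 - axis 3 1))
         - k0 $ 1 * ((k0 $ 3 + 1 + of_int (\<nu> $ 3)) * c (k0 + axis 3 1 - axis 1 1) - (k0 $ 3 + 1) * c k0))
      + ((k0 $ 3 + of_int (\<nu> $ 3) + 1) * ((k0 $ 2 + of_int (\<nu> $ 2)) * c k0 - k0 $ 2 * c (k0 + axis 3 1 - axis 2 1))
         - k0 $ 3 * ((k0 $ 2 + 1 + of_int (\<nu> $ 2)) * c (k0 + axis 2 1 - axis 3 1) - (k0 $ 2 + 1) * c k0))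
      + ((k0 $ 2 + of_int (\<nu> $ 2) + 1) * ((k0 $ 3 + of_int (\<nu> $ 3)) * c k0 - k0 $ 3 * c (k0 + axis 2 1 - axis 3 1))
         - k0 $ 2 * ((k0 $ 3 + 1 + of_int (\<nu> $ 3)) * c (k0 + axis 3 1 - axis 2 1) - (k0 $ 3 + 1) * c k0))
      = (2 * ((k0 $ 3 + of_int (\<nu> $ 3) + 1 + of_nat (nat (- \<nu> $ 3))) * (k0 $ 3 + of_int (\<nu> $ 3) + of_int (\<nu> $ 1) - \<alpha>) * fdiff f (k0 $ 3 + of_int (\<nu> $ 3))
        - (k0 $ 3 + of_int (\<nu> $ 3) - of_nat (base \<nu>)) * (k0 $ 3 + of_int (\<nu> $ 3) + of_int (\<nu> $ 2) - \<alpha> - 2) * bdiff f (k0 $ 3 + of_int (\<nu> $ 3)))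
        + 2 * of_nat (width \<nu>) * (of_nat (width \<nu>) + 2) * poly f (k0 $ 3 + of_int (\<nu> $ 3))) * std_coeff \<nu> k0"
      using total
      unfolding M base width fdiff_def bdiff_def b'_def[symmetric] b_def[symmetric]
      unfolding k1 pt_nth pt_shift N[symmetric] cs[symmetric] k_def[symmetric] t_def[symmetric] F[symmetric] .
  qed
qed

section \<open>Polynomial solutions of the difference equation\<close>

text \<open>
  The rising factorial \<open>(b - t)\<^sub>i\<close> as a polynomial in \<open>t\<close>.
\<close>

definition newton_poly :: "complex \<Rightarrow> nat \<Rightarrow> complex poly" where
  "newton_poly b i = (\<Prod>l<i. [:b + of_nat l, -1:])"

lemma poly_newton_poly [simp]: "poly (newton_poly b i) t = pochhammer (b - t) i"
  by (simp add: newton_poly_def poly_prod pochhammer_prod atLeast0LessThan algebra_simps)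

lemma degree_newton_poly [simp]: "Polynomial.degree (newton_poly b i) = i"
  unfolding newton_poly_def by (subst degree_prod_eq_sum_degree) auto

lemma newton_poly_neq_0 [simp]: "newton_poly b i \<noteq> 0"
  by (simp add: newton_poly_def)

lemma newton_expansion:
  "Polynomial.degree f \<le> k \<Longrightarrow> \<exists>c. f = (\<Sum>i\<le>k. Polynomial.smult (c i) (newton_poly b i))"
proof (induction k arbitrary: f)
  case 0
  then obtain a where "f = [:a:]" by (auto elim: degree_eq_zeroE)
  then show ?case by (intro exI[of _ "\<lambda>_. a"]) (simp add: newton_poly_def)
next
  case (Suc k)
  let ?e = "newton_poly b (Suc k)"
  define a where "a = poly.coeff f (Suc k) / poly.coeff ?e (Suc k)"
  have e: "poly.coeff ?e (Suc k) \<noteq> 0"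
    using newton_poly_neq_0[of b "Suc k"] degree_newton_poly[of b "Suc k"] by (metis leading_coeff_0_iff)
  have "Polynomial.degree (f - Polynomial.smult a ?e) \<le> Suc k"
    using Suc.prems by (intro degree_diff_le) (auto intro: order_trans[OF degree_smult_le])
  moreover have "poly.coeff (f - Polynomial.smult a ?e) (Suc k) = 0" using e by (simp add: a_def)
  ultimately have "Polynomial.degree (f - Polynomial.smult a ?e) \<le> k"
    by (metis degree_0 le_Suc_eq leading_coeff_0_iff zero_le)
  then obtain c where c: "f - Polynomial.smult a ?e = (\<Sum>i\<le>k. Polynomial.smult (c i) (newton_poly b i))"
    using Suc.IH by blast
  have "f = (\<Sum>i\<le>k. Polynomial.smult (c i) (newton_poly b i)) + Polynomial.smult a ?e"
    by (simp flip: c)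
  also have "\<dots> = (\<Sum>i\<le>Suc k. Polynomial.smult ((c(Suc k := a)) i) (newton_poly b i))"
    unfolding sum.atMost_Suc by (intro arg_cong2[where f = "(+)"] sum.cong) auto
  finally show ?case by (rule exI[of _ "c(Suc k := a)"])
qed

text \<open>
  Bidiagonality: \<open>\<Delta>\<close> lowers the rising factorial \<open>(b -
  t)\<^sub>i\<close> to \<open>-i (b - t)\<^bsub>i-1\<^esub>\<close>, while \<open>(t -
  b)\<nabla>\<close> multiplies it by \<open>i\<close>. Here \<open>w\<close> is the width and
  \<open>r\<close> the absolute value of \<open>\<nu>(E\<^sub>3\<^sub>3)\<close>.
\<close>

lemma difference_newton:
  fixes \<alpha> b r w t :: complex and i :: nat
  defines "p \<equiv> \<lambda>i t. pochhammer (b - t) i"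
  shows "(t - b + 1 + r) * (t - b + w - \<alpha>) * (p i (t + 1) - p i t)
     - (t - b) * (t - b + r - w - \<alpha> - 2) * (p i t - p i (t - 1))
   = of_nat i * (of_nat i + 2 * w + 2) * p i t
     - of_nat i * (of_nat i + r) * (of_nat i - 1 + w - \<alpha>) * p (i - 1) t"
proof (cases i)
  case 0
  then show ?thesis by (simp add: p_def)
next
  case (Suc m)
  define y where "y = b - t"
  define P P1 where "P = pochhammer y m" and "P1 = pochhammer (y + 1) m"
  have t: "t - b = - y" "b - (t + 1) = y - 1" "b - (t - 1) = y + 1" "b - t = y" by (simp_all add: y_def)
  have 1: "y * P1 = P * (y + of_nat m)"
    unfolding P_def P1_def by (simp only: pochhammer_rec[symmetric] pochhammer_Suc[symmetric])
  have up: "p i (t + 1) - p i t = - of_nat (Suc m) * P"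
    unfolding p_def t Suc pochhammer_Suc[of y] pochhammer_rec[of "y - 1"]
    by (simp add: P_def algebra_simps)
  have down: "p i t - p i (t - 1) = - of_nat (Suc m) * P1"
    unfolding p_def t Suc pochhammer_rec[of y] pochhammer_Suc[of "y + 1"]
    by (simp add: P1_def algebra_simps)
  have pi: "p i t = P * (y + of_nat m)" "p (i - 1) t = P"
    unfolding p_def t Suc pochhammer_Suc[of y] by (simp_all add: P_def)
  have "(t - b + 1 + r) * (t - b + w - \<alpha>) * (p i (t + 1) - p i t)
     - (t - b) * (t - b + r - w - \<alpha> - 2) * (p i t - p i (t - 1))
    = of_nat (Suc m) * (- ((1 + r - y) * (w - \<alpha> - y)) * P - (- y + r - w - \<alpha> - 2) * (y * P1))"
  proof -
    have "(- y + 1 + r) * (- y + w - \<alpha>) * (- M * P) - - y * R * (- M * P1)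
      = M * (- ((1 + r - y) * (w - \<alpha> - y)) * P - R * (y * P1))" for M R
      by (simp add: algebra_simps)
    then show ?thesis unfolding up down t(1) .
  qed
  also have "\<dots> = of_nat (Suc m) * (of_nat (Suc m) + 2 * w + 2) * (P * (y + of_nat m))
     - of_nat (Suc m) * (of_nat (Suc m) + r) * (of_nat (Suc m) - 1 + w - \<alpha>) * P"
  proof -
    have inner: "- ((1 + r - y) * (w - \<alpha> - y)) - (- y + r - w - \<alpha> - 2) * (y + M)
      = (M + 1 + 2 * w + 2) * (y + M) - (M + 1 + r) * (M + 1 - 1 + w - \<alpha>)" for M
      by (simp add: algebra_simps)
    have "of_nat (Suc m) * (- ((1 + r - y) * (w - \<alpha> - y)) * P - (- y + r - w - \<alpha> - 2) * (y * P1))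
      = of_nat (Suc m) * P * (- ((1 + r - y) * (w - \<alpha> - y)) - (- y + r - w - \<alpha> - 2) * (y + of_nat m))"
      unfolding 1 by (simp only: right_diff_distrib mult_ac)
    also have "\<dots> = of_nat (Suc m) * (of_nat (Suc m) + 2 * w + 2) * (P * (y + of_nat m))
     - of_nat (Suc m) * (of_nat (Suc m) + r) * (of_nat (Suc m) - 1 + w - \<alpha>) * P"
      unfolding inner of_nat_Suc add.commute[of 1 "of_nat m"] by (simp only: right_diff_distrib mult_ac)
    finally show ?thesis .
  qed
  also have "\<dots> = of_nat i * (of_nat i + 2 * w + 2) * p i t
     - of_nat i * (of_nat i + r) * (of_nat i - 1 + w - \<alpha>) * p (i - 1) t"
    unfolding pi by (simp only: Suc)
  finally show ?thesis .
qed

text \<open>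
  At \<open>b + j\<close> the Newton polynomials of index above \<open>j\<close> vanish, so the
  equation at the first \<open>k + 1\<close> points is a triangular system which forces every
  coefficient of the defect to be zero. This yields the equation at all points and a two-term
  recursion, whose solution is the term ratio of the hypergeometric series. The condition on
  \<open>\<alpha>\<close> keeps the denominators from vanishing.
\<close>

lemma hypergeometric_solution:
  fixes \<alpha> :: complex and \<beta> r w k :: nat
  assumes deg: "Polynomial.degree f \<le> k"
    and eq: "\<And>j. j \<le> k \<Longrightarrow> let t = of_nat (\<beta> + j) in
       (t - of_nat \<beta> + 1 + of_nat r) * (t - of_nat \<beta> + of_nat w - \<alpha>) * fdiff f t
       - (t - of_nat \<beta>) * (t - of_nat \<beta> + of_nat r - of_nat w - \<alpha> - 2) * bdiff f t
       = of_nat k * (of_nat k + 2 * of_nat w + 2) * poly f t"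
    and \<alpha>: "\<And>i. i < k \<Longrightarrow> \<alpha> \<noteq> of_nat (w + i)"
  shows "(t - of_nat \<beta> + 1 + of_nat r) * (t - of_nat \<beta> + of_nat w - \<alpha>) * fdiff f t
       - (t - of_nat \<beta>) * (t - of_nat \<beta> + of_nat r - of_nat w - \<alpha> - 2) * bdiff f t
       = of_nat k * (of_nat k + 2 * of_nat w + 2) * poly f t" (is "?eq t")
    and "poly f t = poly f (of_nat \<beta>) *
       F32 (- of_nat k) (of_nat k + 2 * of_nat w + 2) (of_nat \<beta> - t) (1 + of_nat r) (of_nat w - \<alpha>) 1"
proof -
  let ?b = "of_nat \<beta> :: complex" and ?r = "of_nat r :: complex" and ?w = "of_nat w :: complex"
  define P where "P i t = pochhammer (?b - t) i" for i t
  obtain c where c: "f = (\<Sum>i\<le>k. Polynomial.smult (c i) (newton_poly ?b i))"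
    using newton_expansion[OF deg] by blast
  have f: "poly f t = (\<Sum>i\<le>k. c i * P i t)" for t
    by (simp add: c poly_sum P_def)
  define ev where "ev i = of_nat i * (of_nat i + 2 * ?w + 2)" for i :: nat
  \<comment> \<open>The Newton coefficients of the defect of the equation, after shifting the index of the lowering part.\<close>
  define d where "d i = c i * (ev i - ev k) -
     (if i < k then c (Suc i) * (of_nat (Suc i) * (of_nat (Suc i) + ?r) * (of_nat i + ?w - \<alpha>)) else 0)" for i
  have expand: "(t - ?b + 1 + ?r) * (t - ?b + ?w - \<alpha>) * fdiff f t
       - (t - ?b) * (t - ?b + ?r - ?w - \<alpha> - 2) * bdiff f t - ev k * poly f t = (\<Sum>i\<le>k. d i * P i t)" for t
  proof -
    define A B where "A = (t - ?b + 1 + ?r) * (t - ?b + ?w - \<alpha>)" and "B = (t - ?b) * (t - ?b + ?r - ?w - \<alpha> - 2)"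
    let ?g = "\<lambda>i. of_nat i * (of_nat i + ?r) * (of_nat i - 1 + ?w - \<alpha>) * P (i - 1) t"
    have "A * fdiff f t - B * bdiff f t - ev k * poly f t
      = (\<Sum>i\<le>k. c i * (A * (P i (t + 1) - P i t) - B * (P i t - P i (t - 1))) - ev k * (c i * P i t))"
      unfolding fdiff_def bdiff_def f sum_distrib_left sum_subtractf[symmetric]
      by (intro sum.cong refl) (simp add: algebra_simps)
    also have "\<dots> = (\<Sum>i\<le>k. c i * (ev i * P i t - ?g i) - ev k * (c i * P i t))"
      unfolding A_def B_def P_def difference_newton ev_def ..
    also have "\<dots> = (\<Sum>i\<le>k. c i * (ev i - ev k) * P i t - c i * ?g i)"
      by (intro sum.cong refl) (simp only: algebra_simps)
    also have "\<dots> = (\<Sum>i\<le>k. c i * (ev i - ev k) * P i t) - (\<Sum>i\<le>k. c i * ?g i)"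
      by (rule sum_subtractf)
    also have "(\<Sum>i\<le>k. c i * ?g i) = (\<Sum>i<k. c (Suc i) * ?g (Suc i))"
      by (cases k) (simp_all add: sum.atMost_Suc_shift lessThan_Suc_atMost del: sum.atMost_Suc)
    also have "\<dots> = (\<Sum>i\<le>k. (if i < k then c (Suc i) * ?g (Suc i) else 0))"
      by (rule sum.mono_neutral_cong_left) auto
    also have "(\<Sum>i\<le>k. c i * (ev i - ev k) * P i t) - \<dots> = (\<Sum>i\<le>k. d i * P i t)"
      unfolding sum_subtractf[symmetric] by (intro sum.cong refl) (simp add: d_def algebra_simps)
    finally show ?thesis by (simp only: A_def B_def)
  qed
  have d: "d i = 0" if "i \<le> k" for i
    using that
  proof (induction i rule: less_induct)
    case (less j)
    have "0 = (\<Sum>i\<le>k. d i * P i (of_nat (\<beta> + j)))"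
      using eq[OF less.prems] unfolding expand[symmetric] by (simp add: Let_def ev_def)
    also have "\<dots> = (\<Sum>i\<in>{j}. d i * P i (of_nat (\<beta> + j)))"
    proof (rule sum.mono_neutral_right)
      show "\<forall>i\<in>{..k} - {j}. d i * P i (of_nat (\<beta> + j)) = 0"
      proof
        fix i assume i: "i \<in> {..k} - {j}"
        show "d i * P i (of_nat (\<beta> + j)) = 0"
        proof (cases "i < j")
          case True then show ?thesis using less.IH i by simp
        next
          case False
          then have "j < i" using i by auto
          then show ?thesis by (simp add: P_def pochhammer_of_nat_eq_0_iff)
        qed
      qed
    qed (use less.prems in auto)
    finally have "d j * pochhammer (- of_nat j) j = 0" by (simp add: P_def)
    then show ?case by (simp add: pochhammer_of_nat_eq_0_iff)
  qed
  show "?eq t" for t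
    using expand[of t] d by (simp add: ev_def)
  define q where "q i = pochhammer (- of_nat k) i * pochhammer (of_nat k + 2 * ?w + 2) i
     / (pochhammer (1 + ?r) i * pochhammer (?w - \<alpha>) i) / fact i" for i
  have "c i = c 0 * q i" if "i \<le> k" for i
    using that
  proof (induction i)
    case 0 show ?case by (simp add: q_def)
  next
    case (Suc i)
    have nz: "of_nat i + ?w - \<alpha> \<noteq> 0" using \<alpha>[of i] Suc.prems by (auto simp: add.commute)
    have nz2: "1 + ?r + of_nat i \<noteq> 0" by (metis of_nat_Suc of_nat_add of_nat_eq_0_iff add.assoc add.commute nat.distinct(1) plus_nat.simps(2))
    have nz3: "(of_nat i + 1 :: complex) \<noteq> 0" by (metis of_nat_Suc of_nat_eq_0_iff add.commute nat.distinct(1))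
    have "c (Suc i) * (of_nat (Suc i) * (of_nat (Suc i) + ?r) * (of_nat i + ?w - \<alpha>)) = c i * (ev i - ev k)"
      using d[of i] Suc.prems by (simp add: d_def)
    also have "ev i - ev k = (- of_nat k + of_nat i) * (of_nat k + 2 * ?w + 2 + of_nat i)"
      by (simp add: ev_def algebra_simps)
    finally have "c (Suc i) = c i * ((- of_nat k + of_nat i) * (of_nat k + 2 * ?w + 2 + of_nat i))
        / ((of_nat i + 1) * (1 + ?r + of_nat i) * (of_nat i + ?w - \<alpha>))"
      using nz nz2 nz3 by (simp add: divide_simps) (simp add: algebra_simps)
    also have "c i = c 0 * q i" using Suc by simp
    also have "c 0 * q i * ((- of_nat k + of_nat i) * (of_nat k + 2 * ?w + 2 + of_nat i))
        / ((of_nat i + 1) * (1 + ?r + of_nat i) * (of_nat i + ?w - \<alpha>)) = c 0 * q (Suc i)"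
      by (simp add: q_def pochhammer_Suc mult_ac add.commute[of "of_nat i"] add_diff_eq)
    finally show ?case .
  qed
  moreover have "c 0 = poly f ?b"
  proof -
    have "poly f ?b = (\<Sum>i\<le>k. if i = 0 then c i else 0)"
      unfolding f by (intro sum.cong) (auto simp: P_def pochhammer_0_left)
    then show ?thesis by simp
  qed
  ultimately have "poly f t = poly f ?b * (\<Sum>i\<le>k. q i * P i t)"
    unfolding f[of t] by (simp add: sum_distrib_left mult.assoc)
  also have "(\<Sum>i\<le>k. q i * P i t)
    = F32 (- of_nat k) (of_nat k + 2 * of_nat w + 2) (of_nat \<beta> - t) (1 + of_nat r) (of_nat w - \<alpha>) 1"
    unfolding F32_def
  proof (subst suminf_finite[of "{..k}"])
    show "(\<Sum>i\<le>k. q i * P i t) = (\<Sum>i\<le>k. pochhammer (- of_nat k) i * pochhammer (of_nat k + 2 * ?w + 2) i * pochhammer (?b - t) i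
         / (pochhammer (1 + ?r) i * pochhammer (?w - \<alpha>) i) * (1 ^ i / fact i))"
      by (intro sum.cong refl) (simp add: q_def P_def)
  qed (auto simp: pochhammer_of_nat_eq_0_iff)
  finally show "poly f t = poly f (of_nat \<beta>) *
       F32 (- of_nat k) (of_nat k + 2 * of_nat w + 2) (of_nat \<beta> - t) (1 + of_nat r) (of_nat w - \<alpha>) 1" .
qed

section \<open>The ladder of eigenvectors\<close>

lemma degree_shift_diff:
  fixes f :: "complex poly"
  shows "Polynomial.degree f = 0 \<Longrightarrow> f \<circ>\<^sub>p [:s, 1:] - f = 0"
    and "Polynomial.degree (f \<circ>\<^sub>p [:s, 1:] - f) \<le> Polynomial.degree f - 1"
proof -
  show 0: "f \<circ>\<^sub>p [:s, 1:] - f = 0" if "Polynomial.degree f = 0"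
    using that by (auto elim!: degree_eq_zeroE)
  show "Polynomial.degree (f \<circ>\<^sub>p [:s, 1:] - f) \<le> Polynomial.degree f - 1"
  proof (cases "Polynomial.degree f = 0")
    case True then show ?thesis using 0 by simp
  next
    case False
    have d: "Polynomial.degree (f \<circ>\<^sub>p [:s, 1:]) = Polynomial.degree f" by (simp add: degree_pcompose)
    have "poly.coeff (f \<circ>\<^sub>p [:s, 1:]) (Polynomial.degree f) = poly.coeff f (Polynomial.degree f)"
      using lead_coeff_comp[of "[:s, 1:]" f] by (simp add: d)
    then have z: "poly.coeff (f \<circ>\<^sub>p [:s, 1:] - f) (Polynomial.degree f) = 0" by simp
    have le: "Polynomial.degree (f \<circ>\<^sub>p [:s, 1:] - f) \<le> Polynomial.degree f"
      by (intro degree_diff_le) (simp_all add: d)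
    have "Polynomial.degree (f \<circ>\<^sub>p [:s, 1:] - f) \<noteq> Polynomial.degree f"
      using z False by (metis degree_0 leading_coeff_0_iff)
    then show ?thesis using le by simp
  qed
qed

text \<open>
  The leading terms of \<open>q\<close> and \<open>q\<^sup>\<prime>\<close> cancel, and a
  difference \<open>f(t + s) - f(t)\<close> loses one degree.
\<close>

lemma degree_quadratic_shift:
  fixes f :: "complex poly"
  assumes q: "Polynomial.degree q \<le> 2" and l: "Polynomial.degree (q + q') \<le> 1"
  shows "Polynomial.degree (Polynomial.smult a (q * (f \<circ>\<^sub>p [:s, 1:]) + q' * f)) \<le> Suc (Polynomial.degree f)"
proof -
  have e: "q * (f \<circ>\<^sub>p [:s, 1:]) + q' * f = q * (f \<circ>\<^sub>p [:s, 1:] - f) + (q + q') * f"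
    by (simp add: algebra_simps)
  have "Polynomial.degree (q * (f \<circ>\<^sub>p [:s, 1:] - f)) \<le> Suc (Polynomial.degree f)"
  proof (cases "Polynomial.degree f = 0")
    case True then show ?thesis using degree_shift_diff(1)[OF True] by simp
  next
    case False
    then show ?thesis using degree_mult_le[of q "f \<circ>\<^sub>p [:s, 1:] - f"] degree_shift_diff(2)[of f s] q by linarith
  qed
  moreover have "Polynomial.degree ((q + q') * f) \<le> Suc (Polynomial.degree f)"
    using degree_mult_le[of "q + q'" f] l by linarith
  ultimately show ?thesis unfolding e by (intro order_trans[OF degree_smult_le] degree_add_le)
qed

lemma nat_diff_nonpos: "x \<le> 0 \<Longrightarrow> nat (int k - x) = nat (- x) + k"
  and nat_1_diff_nonpos: "x \<le> 0 \<Longrightarrow> nat (1 - x) = Suc (nat (- x))"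
  by arith+

lemma dominant_nat_nonpos: "dominant \<nu> \<Longrightarrow> \<nu> $ 3 \<le> 0 \<Longrightarrow> nat (- \<nu> $ 2) + nat (- \<nu> $ 3) = nat (\<nu> $ 1)"
  using dominant_sum[of \<nu>] by (simp add: dominant_def flip: nat_add_distrib)

text \<open>
  At the first visible point \<open>t = 0\<close> one of the two terms vanishes, and the other one
  multiplies the value of \<open>f\<close> by a non-zero constant, since \<open>\<alpha> =
  \<nu>\<^sub>1\<close> would mean that the source vector is zero.
\<close>

lemma z31_step:
  assumes dom: "dominant \<nu>" and n3: "\<nu> $ 3 \<le> 0" and al: "allowed \<alpha> (width (\<nu> + (axis 1 1 - axis 3 1)))"
  shows "\<exists>g. adU z31 (poly_E33 f * std (\<nu> + (axis 1 1 - axis 3 1))) - poly_E33 g * std \<nu> \<in> J_ideal \<alpha>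
    \<and> Polynomial.degree g \<le> Suc (Polynomial.degree f)
    \<and> (poly f (of_nat (base (\<nu> + (axis 1 1 - axis 3 1)))) \<noteq> 0 \<longrightarrow> poly g (of_nat (base \<nu>)) \<noteq> 0)"
proof -
  define \<mu> where "\<mu> = \<nu> + (axis 1 1 - axis 3 1)"
  have \<mu>: "\<mu> $ 1 = \<nu> $ 1 + 1" "\<mu> $ 2 = \<nu> $ 2" "\<mu> $ 3 = \<nu> $ 3 - 1" by (simp_all add: \<mu>_def axis_def)
  have dom\<mu>: "dominant \<mu>" using dom \<mu> by (simp add: dominant_def root_lattice_def sum_3)
  have neg: "\<mu> $ 3 < 0" using n3 \<mu> by simp
  have ret: "\<mu> + axis 3 1 - axis 1 1 = \<nu>" by (simp add: \<mu>_def)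
  define q where "q = [:0, \<alpha> - of_int (\<mu> $ 2) + 2, -1:]"
  define q' where "q' = [:of_int (\<mu> $ 1) - 1 - \<alpha>, 1:] * [:- of_int (\<mu> $ 3), 1:]"
  define g where "g = Polynomial.smult (of_int (\<mu> $ 1)) (q * (f \<circ>\<^sub>p [:-1, 1:]) + q' * f)"
  have g: "poly g t = of_int (\<mu> $ 1) * ((\<alpha> - of_int (\<mu> $ 2) + 2 - t) * t * poly f (t - 1)
       + (t + of_int (\<mu> $ 1) - 1 - \<alpha>) * (t - of_int (\<mu> $ 3)) * poly f t)" for t
    by (simp add: g_def q_def q'_def poly_pcompose algebra_simps)
  have J: "adU z31 (poly_E33 f * std \<mu>) - poly_E33 g * std \<nu> \<in> J_ideal \<alpha>"
    using acts_eq[OF acts_z31[OF dom\<mu> neg g, unfolded ret] acts_hw[OF dom]] .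
  have deg: "Polynomial.degree g \<le> Suc (Polynomial.degree f)"
    unfolding g_def by (rule degree_quadratic_shift) (simp_all add: q_def q'_def)
  have w: "width \<mu> = nat (\<nu> $ 1) + 1" "of_nat (nat (\<nu> $ 1)) = complex_of_int (\<nu> $ 1)"
    using dominant_nat_nonpos[OF dom n3] n3 dom
    by (simp_all add: width_def \<mu> nat_1_diff_nonpos dominant_def)
  have "\<alpha> \<noteq> of_int (\<nu> $ 1)" using al w by (auto simp: allowed_def \<mu>_def[symmetric] dest: spec[of _ "nat (\<nu> $ 1)"])
  moreover have "complex_of_int (\<nu> $ 1 + 1) \<noteq> 0" using dom unfolding of_int_eq_0_iff by (simp add: dominant_def)
  moreover have "complex_of_int (\<nu> $ 3 - 1) \<noteq> 0" using n3 unfolding of_int_eq_0_iff by simp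
  moreover have "base \<nu> = 0" "base \<mu> = 0" using n3 neg by (simp_all add: base_def)
  ultimately have "poly f (of_nat (base \<mu>)) \<noteq> 0 \<longrightarrow> poly g (of_nat (base \<nu>)) \<noteq> 0"
    unfolding g \<mu> by simp
  then show ?thesis using J deg unfolding \<mu>_def by blast
qed

text \<open>
  The mirror image of \<open>z31_step\<close>; the first visible point moves from
  \<open>\<nu>\<^sub>3 + 1\<close> to \<open>\<nu>\<^sub>3\<close>.
\<close>

lemma z23_step:
  assumes dom: "dominant \<nu>" and n3: "\<nu> $ 3 \<ge> 0" and al: "allowed \<alpha> (width (\<nu> + (axis 3 1 - axis 2 1)))"
  shows "\<exists>g. adU z23 (poly_E33 f * std (\<nu> + (axis 3 1 - axis 2 1))) - poly_E33 g * std \<nu> \<in> J_ideal \<alpha>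
    \<and> Polynomial.degree g \<le> Suc (Polynomial.degree f)
    \<and> (poly f (of_nat (base (\<nu> + (axis 3 1 - axis 2 1)))) \<noteq> 0 \<longrightarrow> poly g (of_nat (base \<nu>)) \<noteq> 0)"
proof -
  define \<mu> where "\<mu> = \<nu> + (axis 3 1 - axis 2 1)"
  have \<mu>: "\<mu> $ 1 = \<nu> $ 1" "\<mu> $ 2 = \<nu> $ 2 - 1" "\<mu> $ 3 = \<nu> $ 3 + 1" by (simp_all add: \<mu>_def axis_def)
  have dom\<mu>: "dominant \<mu>" using dom \<mu> by (simp add: dominant_def root_lattice_def sum_3)
  have pos: "\<mu> $ 3 > 0" using n3 \<mu> by simp
  have ret: "\<mu> + axis 2 1 - axis 3 1 = \<nu>" by (simp add: \<mu>_def)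
  define q where "q = [:1, 1:] * [:\<alpha> + of_int (\<mu> $ 3) + of_int (\<mu> $ 2), -1:]"
  define q' where "q' = - ([:1 - of_int (\<mu> $ 3), 1:] * [:\<alpha> - of_int (\<mu> $ 2) + 1, -1:])"
  define g where "g = Polynomial.smult (- of_int (\<mu> $ 2)) (q * (f \<circ>\<^sub>p [:1, 1:]) + q' * f)"
  have g: "poly g t = - of_int (\<mu> $ 2) * ((t + 1) * (\<alpha> - t + of_int (\<mu> $ 3) + of_int (\<mu> $ 2)) * poly f (t + 1)
       - (t - of_int (\<mu> $ 3) + 1) * (\<alpha> - t - of_int (\<mu> $ 2) + 1) * poly f t)" for t
    by (simp add: g_def q_def q'_def poly_pcompose algebra_simps)
  have J: "adU z23 (poly_E33 f * std \<mu>) - poly_E33 g * std \<nu> \<in> J_ideal \<alpha>"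
    using acts_eq[OF acts_z23[OF dom\<mu> pos g, unfolded ret] acts_hw[OF dom]] .
  have deg: "Polynomial.degree g \<le> Suc (Polynomial.degree f)"
    unfolding g_def by (rule degree_quadratic_shift) (simp_all add: q_def q'_def)
  have w: "width \<mu> = nat (- \<nu> $ 2) + 1" "of_nat (nat (- \<nu> $ 2)) = - complex_of_int (\<nu> $ 2)"
    using pos \<mu> dom by (simp_all add: width_def dominant_def nat_1_diff_nonpos)
  have "\<alpha> \<noteq> - of_int (\<nu> $ 2)" using al w by (auto simp: allowed_def \<mu>_def[symmetric] dest: spec[of _ "nat (- \<nu> $ 2)"])
  then have "\<alpha> + of_int (\<nu> $ 2) \<noteq> 0" by (simp add: eq_neg_iff_add_eq_0)
  moreover have "complex_of_int (\<nu> $ 2 - 1) \<noteq> 0" using dom unfolding of_int_eq_0_iff by (simp add: dominant_def)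
  moreover have "complex_of_int (\<nu> $ 3 + 1) \<noteq> 0" using n3 unfolding of_int_eq_0_iff by simp
  moreover have b: "of_nat (base \<nu>) = complex_of_int (\<nu> $ 3)" "of_nat (base \<mu>) = complex_of_int (\<nu> $ 3 + 1)"
    using n3 \<mu> by (simp_all add: base_def)
  moreover have "poly g (of_nat (base \<nu>))
      = - of_int (\<nu> $ 2 - 1) * (of_int (\<nu> $ 3 + 1) * (\<alpha> + of_int (\<nu> $ 2)) * poly f (of_nat (base \<mu>)))"
    unfolding g \<mu> b by simp
  ultimately have "poly f (of_nat (base \<mu>)) \<noteq> 0 \<longrightarrow> poly g (of_nat (base \<nu>)) \<noteq> 0"
    by (simp only: mult_eq_0_iff neg_equal_0_iff_equal) simp
  then show ?thesis using J deg unfolding \<mu>_def by blast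
qed

lemma adU_arg_diff: "adU z (u - v) = adU z u - adU z v"
  using adU_arg_add[of z "u - v" v] by simp

lemma adU_pow_diff: "(adU z ^^ k) (u - v) = (adU z ^^ k) u - (adU z ^^ k) v"
  by (induction k) (simp_all add: adU_arg_diff)

lemma adU_pow_scale: "(adU z ^^ k) (scaleU c u) = scaleU c ((adU z ^^ k) u)"
  by (induction k) (simp_all add: adU_arg_scale)

lemma adU_pow_J: "u \<in> J_ideal \<alpha> \<Longrightarrow> (adU z ^^ k) u \<in> J_ideal \<alpha>"
  by (induction k) (simp_all add: adU_J)

text \<open>
  The common induction for \<open>z\<^sub>3\<^sub>1\<close> and \<open>z\<^sub>2\<^sub>3\<close>;
  \<open>C\<close> singles out the dominant weights with the relevant sign of
  \<open>\<nu>(E\<^sub>3\<^sub>3)\<close>.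
\<close>

lemma ladder:
  fixes \<delta> :: "int ^ 3"
  assumes C: "\<And>\<nu>. C \<nu> \<Longrightarrow> C (\<nu> + \<delta>)" and w: "\<And>\<nu>. C \<nu> \<Longrightarrow> width (\<nu> + \<delta>) = Suc (width \<nu>)"
    and step: "\<And>\<nu> f. C \<nu> \<Longrightarrow> allowed \<alpha> (width (\<nu> + \<delta>)) \<Longrightarrow>
      \<exists>g. adU z (poly_E33 f * std (\<nu> + \<delta>)) - poly_E33 g * std \<nu> \<in> J_ideal \<alpha>
        \<and> Polynomial.degree g \<le> Suc (Polynomial.degree f)
        \<and> (poly f (of_nat (base (\<nu> + \<delta>))) \<noteq> 0 \<longrightarrow> poly g (of_nat (base \<nu>)) \<noteq> 0)"
  shows "C \<nu> \<Longrightarrow> allowed \<alpha> (width \<nu> + k) \<Longrightarrow>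
    \<exists>h. (adU z ^^ k) (std (\<nu> + int k *s \<delta>)) - poly_E33 h * std \<nu> \<in> J_ideal \<alpha>
      \<and> Polynomial.degree h \<le> k \<and> poly h (of_nat (base \<nu>)) \<noteq> 0 \<and> width (\<nu> + int k *s \<delta>) = width \<nu> + k"
proof (induction k arbitrary: \<nu>)
  case 0
  have "\<nu> + int 0 *s \<delta> = \<nu>" by (simp add: vec_eq_iff)
  moreover have "poly_E33 1 = 1" using poly_E33_const[of 1] by (simp add: one_pCons)
  ultimately show ?case by (intro exI[of _ 1]) simp
next
  case (Suc k)
  let ?\<mu> = "\<nu> + \<delta>"
  have e: "\<nu> + int (Suc k) *s \<delta> = ?\<mu> + int k *s \<delta>" by (simp add: vec_eq_iff algebra_simps)
  have wm: "width ?\<mu> = Suc (width \<nu>)" by (rule w[OF Suc.prems(1)])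
  then have "allowed \<alpha> (width ?\<mu> + k)" using Suc.prems(2) by simp
  then obtain h where h: "(adU z ^^ k) (std (?\<mu> + int k *s \<delta>)) - poly_E33 h * std ?\<mu> \<in> J_ideal \<alpha>"
    "Polynomial.degree h \<le> k" "poly h (of_nat (base ?\<mu>)) \<noteq> 0" "width (?\<mu> + int k *s \<delta>) = width ?\<mu> + k"
    using Suc.IH[OF C[OF Suc.prems(1)]] by blast
  have "allowed \<alpha> (width ?\<mu>)" using Suc.prems(2) by (rule allowed_mono) (simp add: wm)
  then obtain g where g: "adU z (poly_E33 h * std ?\<mu>) - poly_E33 g * std \<nu> \<in> J_ideal \<alpha>"
    "Polynomial.degree g \<le> Suc (Polynomial.degree h)" "poly g (of_nat (base \<nu>)) \<noteq> 0"
    using step[OF Suc.prems(1), of h] h(3) by blast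
  have "adU z ((adU z ^^ k) (std (?\<mu> + int k *s \<delta>)) - poly_E33 h * std ?\<mu>) \<in> J_ideal \<alpha>"
    by (rule adU_J[OF h(1)])
  then have "adU z ((adU z ^^ k) (std (?\<mu> + int k *s \<delta>))) - adU z (poly_E33 h * std ?\<mu>) \<in> J_ideal \<alpha>"
    by (simp only: adU_arg_diff)
  from J_add[OF this g(1)] have "(adU z ^^ Suc k) (std (\<nu> + int (Suc k) *s \<delta>)) - poly_E33 g * std \<nu> \<in> J_ideal \<alpha>"
    by (simp only: e funpow.simps comp_apply diff_add_cancel add_diff_eq)
  then show ?case using g h(2,4) e wm by (intro exI[of _ g]) (auto simp: add.assoc)
qed

definition casimir_value :: "nat \<Rightarrow> complex" where
  "casimir_value d = 2 * of_nat d * (of_nat d + 2)"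

lemma casimir_value_inject: "casimir_value d = casimir_value e \<longleftrightarrow> d = e"
proof
  assume "casimir_value d = casimir_value e"
  then have "of_nat d * (of_nat d + 2) = of_nat e * (of_nat e + 2 :: complex)"
    by (simp add: casimir_value_def mult.assoc)
  then have "(of_nat (d * (d + 2)) :: complex) = of_nat (e * (e + 2))"
    by (simp only: of_nat_mult of_nat_add of_nat_numeral)
  then have "d * (d + 2) = e * (e + 2)" by (simp only: of_nat_eq_iff)
  then have "(d + 1)\<^sup>2 = (e + 1)\<^sup>2" by (simp add: power2_eq_square)
  then show "d = e" by (metis add_right_cancel power2_eq_iff_nonneg zero_le)
qed simp

lemma casimir_std:
  assumes "dominant \<nu>"
  shows "adU casimir (std \<nu>) - scaleU (casimir_value (width \<nu>)) (std \<nu>) \<in> J_ideal \<alpha>"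
proof -
  have one: "poly_E33 1 = 1" using poly_E33_const[of 1] by (simp add: one_pCons)
  show ?thesis
    by (rule acts_eq[OF acts_cong[OF acts_casimir[OF assms, where f = 1, unfolded one mult_1]] acts_scale[OF acts_std[OF assms]]])
       (simp_all add: fdiff_def bdiff_def casimir_value_def)
qed

lemma adU_casimir_pow_commute: "adU casimir ((adU z ^^ k) u) = (adU z ^^ k) (adU casimir u)"
  by (induction k) (simp_all add: adU_casimir_commute)

lemma casimir_ladder:
  assumes dom: "dominant \<mu>" and x: "(adU z ^^ k) (std \<mu>) - x \<in> J_ideal \<alpha>"
  shows "adU casimir x - scaleU (casimir_value (width \<mu>)) x \<in> J_ideal \<alpha>"
proof -
  let ?y = "(adU z ^^ k) (std \<mu>)" and ?c = "casimir_value (width \<mu>)"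
  have 1: "adU casimir ?y - scaleU ?c ?y \<in> J_ideal \<alpha>"
    using adU_pow_J[OF casimir_std[OF dom], of k z] by (simp add: adU_pow_diff adU_pow_scale adU_casimir_pow_commute)
  have 2: "adU casimir (?y - x) - scaleU ?c (?y - x) \<in> J_ideal \<alpha>"
    by (intro J_diff adU_J J_scale x)
  have "adU casimir (?y - x) = adU casimir ?y - adU casimir x" by (rule adU_arg_diff)
  then have "adU casimir x - scaleU ?c x = (adU casimir ?y - scaleU ?c ?y) - (adU casimir (?y - x) - scaleU ?c (?y - x))"
    by (simp add: ugl3.scale_right_diff_distrib)
  then show ?thesis using J_diff[OF 1 2] by simp
qed

text \<open>
  In terms of the width \<open>w\<close>, the base point and \<open>r =
  \<bar>\<nu>\<^sub>3\<bar>\<close> both cases of the difference equation are the same equation,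
  and \<open>(w + k)(w + k + 2) - w(w + 2) = k(k + 2w + 2)\<close> is its eigenvalue.
\<close>

lemma ladder_poly_equation:
  assumes dom: "dominant \<nu>" and deg: "Polynomial.degree h \<le> k" and al: "allowed \<alpha> (width \<nu> + k)"
    and cas: "adU casimir (poly_E33 h * std \<nu>) - scaleU (casimir_value (width \<nu> + k)) (poly_E33 h * std \<nu>) \<in> J_ideal \<alpha>"
  shows "(t + 1 + of_nat (nat (- \<nu> $ 3))) * (t + of_int (\<nu> $ 1) - \<alpha>) * fdiff h t
       - (t - of_nat (base \<nu>)) * (t + of_int (\<nu> $ 2) - \<alpha> - 2) * bdiff h t
       = of_nat k * (of_nat k + 2 * of_nat (width \<nu>) + 2) * poly h t"
    and "poly h t = poly h (of_nat (base \<nu>)) * F32 (- of_nat k) (of_nat k + 2 * of_nat (width \<nu>) + 2) (of_nat (base \<nu>) - t)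
       (1 + of_nat (nat \<bar>\<nu> $ 3\<bar>)) (of_nat (width \<nu>) - \<alpha>) 1"
proof -
  let ?w = "width \<nu>" and ?\<beta> = "base \<nu>" and ?r = "nat \<bar>\<nu> $ 3\<bar>"
  let ?D = "\<lambda>t. (t + 1 + of_nat (nat (- \<nu> $ 3))) * (t + of_int (\<nu> $ 1) - \<alpha>) * fdiff h t
       - (t - of_nat ?\<beta>) * (t + of_int (\<nu> $ 2) - \<alpha> - 2) * bdiff h t"
  have s: "\<nu> $ 1 = - \<nu> $ 2 - \<nu> $ 3" using dominant_sum[OF dom] by simp
  have r: "of_nat ?r = complex_of_int \<bar>\<nu> $ 3\<bar>" by simp
  have w: "complex_of_nat ?w = of_int (- \<nu> $ 2 + max 0 (- \<nu> $ 3))"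
    using dom by (simp add: width_def dominant_def max_def)
  have \<beta>: "complex_of_nat ?\<beta> = of_int (max 0 (\<nu> $ 3))" by (simp add: base_def max_def)
  have p1: "t + 1 + of_nat (nat (- \<nu> $ 3)) = t - of_nat ?\<beta> + 1 + of_nat ?r" for t :: complex
    by (cases "\<nu> $ 3 \<le> 0") (simp_all add: base_def)
  have p2: "t + of_int (\<nu> $ 1) - \<alpha> = t - of_nat ?\<beta> + of_nat ?w - \<alpha>" for t
    unfolding w \<beta> s by (cases "\<nu> $ 3 \<le> 0") simp_all
  have p3: "t + of_int (\<nu> $ 2) - \<alpha> - 2 = t - of_nat ?\<beta> + of_nat ?r - of_nat ?w - \<alpha> - 2" for t
    unfolding w \<beta> r by (cases "\<nu> $ 3 \<le> 0") simp_all
  define \<phi> where "\<phi> t = (2 * ?D t + 2 * of_nat ?w * (of_nat ?w + 2) * poly h t) - casimir_value (?w + k) * poly h t" for t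
  have act: "acts \<alpha> (adU casimir (poly_E33 h * std \<nu>) - scaleU (casimir_value (?w + k)) (poly_E33 h * std \<nu>)) \<nu>
    (\<lambda>k. \<phi> (k $ 3 + of_int (\<nu> $ 3)) * std_coeff \<nu> k)"
    by (rule acts_cong[OF acts_diff[OF acts_casimir[OF dom] acts_scale[OF acts_hw[OF dom]]] refl])
       (simp add: \<phi>_def left_diff_distrib mult.assoc)
  have eq: "?D t = of_nat k * (of_nat k + 2 * of_nat ?w + 2) * poly h t" if j: "j \<le> k" and t: "t = of_nat (?\<beta> + j)" for j t
  proof -
    have "allowed \<alpha> (?w + j)" using al by (rule allowed_mono) (simp add: j)
    then have "\<phi> t = 0" using cas unfolding std_multiple_in_J_iff[OF dom act] t by blast
    then have "2 * ?D t = 2 * (of_nat k * (of_nat k + 2 * of_nat ?w + 2) * poly h t)"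
      unfolding \<phi>_def casimir_value_def by (simp add: algebra_simps)
    then show ?thesis by (metis mult_left_cancel zero_neq_numeral)
  qed
  have ne: "\<alpha> \<noteq> of_nat (?w + i)" if "i < k" for i using al that by (auto simp: allowed_def dest: spec[of _ "width \<nu> + i"])
  have eq': "let t = of_nat (?\<beta> + j) in
       (t - of_nat ?\<beta> + 1 + of_nat ?r) * (t - of_nat ?\<beta> + of_nat ?w - \<alpha>) * fdiff h t
       - (t - of_nat ?\<beta>) * (t - of_nat ?\<beta> + of_nat ?r - of_nat ?w - \<alpha> - 2) * bdiff h t
       = of_nat k * (of_nat k + 2 * of_nat ?w + 2) * poly h t" if "j \<le> k" for j
    using eq[OF that refl] unfolding p1 p2 p3 Let_def .
  show "?D t = of_nat k * (of_nat k + 2 * of_nat (width \<nu>) + 2) * poly h t"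
    unfolding p1 p2 p3 by (rule hypergeometric_solution(1)[OF deg eq' ne])
  show "poly h t = poly h (of_nat ?\<beta>) * F32 (- of_nat k) (of_nat k + 2 * of_nat ?w + 2) (of_nat ?\<beta> - t)
       (1 + of_nat ?r) (of_nat ?w - \<alpha>) 1"
    by (rule hypergeometric_solution(2)[OF deg eq' ne])
qed

text \<open>
  For \<open>\<nu>(E\<^sub>3\<^sub>3) = 0\<close> both ladders lead to this weight; the width of
  the starting weight is \<open>width \<nu> + k\<close> for either of them, so they give
  eigenvectors with the same eigenvalue.
\<close>

lemma f_elements_hw:
  assumes gen: "\<And>\<mu>. \<mu> \<in> Q_plus \<alpha> \<Longrightarrow> is_generator \<alpha> \<mu> (u \<mu>)" and \<nu>: "\<nu> \<in> Q_plus \<alpha>"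
    and w: "w \<in> f_elements \<alpha> u k \<nu>"
  obtains h where "w = hw \<alpha> \<nu> h" "Polynomial.degree h \<le> k" "poly h (of_nat (base \<nu>)) \<noteq> 0" "allowed \<alpha> (width \<nu> + k)"
    "adU casimir (poly_E33 h * std \<nu>) - scaleU (casimir_value (width \<nu> + k)) (poly_E33 h * std \<nu>) \<in> J_ideal \<alpha>"
proof -
  note dom = Q_plus_dominant(1)[OF \<nu>]
  have "\<exists>z \<mu> h. w = (adA \<alpha> z ^^ k) (u \<mu>) \<and> \<mu> \<in> Q_plus \<alpha> \<and> allowed \<alpha> (width \<nu> + k) \<and> width \<mu> = width \<nu> + k \<and>
    (adU z ^^ k) (std \<mu>) - poly_E33 h * std \<nu> \<in> J_ideal \<alpha> \<and> Polynomial.degree h \<le> k \<and> poly h (of_nat (base \<nu>)) \<noteq> 0"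
  proof -
    consider (1) \<mu> where "w = (adA \<alpha> z31 ^^ k) (u \<mu>)" "\<mu> = \<nu> + int k *s (axis 1 1 - axis 3 1)" "\<mu> \<in> Q_plus \<alpha>" "\<nu> $ 3 \<le> 0"
      | (2) \<mu> where "w = (adA \<alpha> z23 ^^ k) (u \<mu>)" "\<mu> = \<nu> + int k *s (axis 3 1 - axis 2 1)" "\<mu> \<in> Q_plus \<alpha>" "\<nu> $ 3 \<ge> 0"
      using w unfolding f_elements_def by blast
    then show ?thesis
    proof cases
      case 1
      define C where "C \<nu> \<longleftrightarrow> dominant \<nu> \<and> \<nu> $ 3 \<le> 0" for \<nu> :: "int ^ 3"
      have comp: "\<mu> $ 2 = \<nu> $ 2" "\<mu> $ 3 = \<nu> $ 3 - int k" by (simp_all add: 1(2) axis_def)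
      have "width \<mu> = width \<nu> + k" using 1(4) by (simp add: width_def comp nat_diff_nonpos)
      then have al: "allowed \<alpha> (width \<nu> + k)" using Q_plus_dominant(2)[OF 1(3)] by simp
      have "\<exists>h. (adU z31 ^^ k) (std (\<nu> + int k *s (axis 1 1 - axis 3 1))) - poly_E33 h * std \<nu> \<in> J_ideal \<alpha>
        \<and> Polynomial.degree h \<le> k \<and> poly h (of_nat (base \<nu>)) \<noteq> 0 \<and> width (\<nu> + int k *s (axis 1 1 - axis 3 1)) = width \<nu> + k"
      proof (rule ladder[where C = C])
        show "C \<nu>" using dom 1(4) by (simp add: C_def)
        show "C (\<nu> + (axis 1 1 - axis 3 1))" if "C \<nu>" for \<nu>
          using that by (simp add: C_def dominant_def root_lattice_def sum_3 axis_def)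
        show "width (\<nu> + (axis 1 1 - axis 3 1)) = Suc (width \<nu>)" if "C \<nu>" for \<nu>
          using that by (simp add: C_def width_def axis_def nat_1_diff_nonpos)
        show "\<exists>g. adU z31 (poly_E33 f * std (\<nu> + (axis 1 1 - axis 3 1))) - poly_E33 g * std \<nu> \<in> J_ideal \<alpha>
          \<and> Polynomial.degree g \<le> Suc (Polynomial.degree f)
          \<and> (poly f (of_nat (base (\<nu> + (axis 1 1 - axis 3 1)))) \<noteq> 0 \<longrightarrow> poly g (of_nat (base \<nu>)) \<noteq> 0)"
          if "C \<nu>" "allowed \<alpha> (width (\<nu> + (axis 1 1 - axis 3 1)))" for \<nu> f
          using that z31_step by (simp add: C_def)
      qed (rule al)
      then show ?thesis using 1 al by blast
    next
      case 2
      define C where "C \<nu> \<longleftrightarrow> dominant \<nu> \<and> \<nu> $ 3 \<ge> 0" for \<nu> :: "int ^ 3"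
      have comp: "\<mu> $ 2 = \<nu> $ 2 - int k" "\<mu> $ 3 = \<nu> $ 3 + int k" by (simp_all add: 2(2) axis_def)
      have "width \<mu> = width \<nu> + k" using 2(4) dom by (simp add: width_def comp dominant_def nat_diff_nonpos)
      then have al: "allowed \<alpha> (width \<nu> + k)" using Q_plus_dominant(2)[OF 2(3)] by simp
      have "\<exists>h. (adU z23 ^^ k) (std (\<nu> + int k *s (axis 3 1 - axis 2 1))) - poly_E33 h * std \<nu> \<in> J_ideal \<alpha>
        \<and> Polynomial.degree h \<le> k \<and> poly h (of_nat (base \<nu>)) \<noteq> 0 \<and> width (\<nu> + int k *s (axis 3 1 - axis 2 1)) = width \<nu> + k"
      proof (rule ladder[where C = C])
        show "C \<nu>" using dom 2(4) by (simp add: C_def)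
        show "C (\<nu> + (axis 3 1 - axis 2 1))" if "C \<nu>" for \<nu>
          using that by (simp add: C_def dominant_def root_lattice_def sum_3 axis_def)
        show "width (\<nu> + (axis 3 1 - axis 2 1)) = Suc (width \<nu>)" if "C \<nu>" for \<nu>
          using that by (simp add: C_def width_def axis_def dominant_def nat_1_diff_nonpos)
        show "\<exists>g. adU z23 (poly_E33 f * std (\<nu> + (axis 3 1 - axis 2 1))) - poly_E33 g * std \<nu> \<in> J_ideal \<alpha>
          \<and> Polynomial.degree g \<le> Suc (Polynomial.degree f)
          \<and> (poly f (of_nat (base (\<nu> + (axis 3 1 - axis 2 1)))) \<noteq> 0 \<longrightarrow> poly g (of_nat (base \<nu>)) \<noteq> 0)"
          if "C \<nu>" "allowed \<alpha> (width (\<nu> + (axis 3 1 - axis 2 1)))" for \<nu> f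
          using that z23_step by (simp add: C_def)
      qed (rule al)
      then show ?thesis using 2 al by blast
    qed
  qed
  then obtain z \<mu> h0 where wz: "w = (adA \<alpha> z ^^ k) (u \<mu>)" and \<mu>: "\<mu> \<in> Q_plus \<alpha>" and al: "allowed \<alpha> (width \<nu> + k)"
    and width: "width \<mu> = width \<nu> + k"
    and h0: "(adU z ^^ k) (std \<mu>) - poly_E33 h0 * std \<nu> \<in> J_ideal \<alpha>" "Polynomial.degree h0 \<le> k" "poly h0 (of_nat (base \<nu>)) \<noteq> 0"
    by blast
  obtain c where c: "c \<noteq> 0" "u \<mu> = img \<alpha> (scaleU c (std \<mu>))"
    using gen[OF \<mu>] unfolding is_generator_iff[OF \<mu>] hw_const by blast
  let ?h = "[:c:] * h0"
  have prod: "poly_E33 [:c:] * poly_E33 h0 - poly_E33 ?h \<in> J_ideal \<alpha>" by (rule poly_E33_mult)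
  have diff: "scaleU c (poly_E33 h0 * std \<nu>) - poly_E33 ?h * std \<nu> \<in> J_ideal \<alpha>"
    using J_rmult[OF prod, of "std \<nu>"] by (simp add: poly_E33_const scaleU_mult_left left_diff_distrib)
  have sc: "scaleU c ((adU z ^^ k) (std \<mu>)) - scaleU c (poly_E33 h0 * std \<nu>) \<in> J_ideal \<alpha>"
    using J_scale[OF h0(1), of c] by (simp add: ugl3.scale_right_diff_distrib)
  have total: "scaleU c ((adU z ^^ k) (std \<mu>)) - poly_E33 ?h * std \<nu> \<in> J_ideal \<alpha>"
    using J_add[OF sc diff] by simp
  have 1: "w = hw \<alpha> \<nu> ?h"
    unfolding wz c adA_pow_img hw_def img_eq_iff adU_pow_scale by (rule total)
  have "scaleU (1 / c) (scaleU c ((adU z ^^ k) (std \<mu>)) - poly_E33 ?h * std \<nu>) \<in> J_ideal \<alpha>"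
    by (rule J_scale[OF total])
  then have "(adU z ^^ k) (std \<mu>) - scaleU (1 / c) (poly_E33 ?h * std \<nu>) \<in> J_ideal \<alpha>"
    using c(1) by (simp add: ugl3.scale_right_diff_distrib)
  from casimir_ladder[OF Q_plus_dominant(1)[OF \<mu>] this]
  have "scaleU c (adU casimir (scaleU (1 / c) (poly_E33 ?h * std \<nu>)) - scaleU (casimir_value (width \<mu>)) (scaleU (1 / c) (poly_E33 ?h * std \<nu>))) \<in> J_ideal \<alpha>"
    by (rule J_scale)
  then have 2: "adU casimir (poly_E33 ?h * std \<nu>) - scaleU (casimir_value (width \<nu> + k)) (poly_E33 ?h * std \<nu>) \<in> J_ideal \<alpha>"
    using c(1) by (simp add: adU_arg_scale ugl3.scale_right_diff_distrib width)
  show ?thesis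
    by (rule that[OF 1 _ _ al 2]) (use h0 c(1) in \<open>auto intro: order_trans[OF degree_smult_le]\<close>)
qed

section \<open>Uniqueness, orthogonality and explicit form\<close>

lemma generator_exists: "\<nu> \<in> Q_plus \<alpha> \<Longrightarrow> \<exists>v. is_generator \<alpha> \<nu> v"
  unfolding is_generator_iff by (intro exI[of _ "hw \<alpha> \<nu> [:1:]"] exI[of _ 1]) simp

lemma generator_unique:
  assumes "\<nu> \<in> Q_plus \<alpha>" "is_generator \<alpha> \<nu> v" "is_generator \<alpha> \<nu> w"
  shows "\<exists>c. c \<noteq> 0 \<and> w = scaleA \<alpha> c v"
proof -
  obtain c d where c: "c \<noteq> 0" "v = hw \<alpha> \<nu> [:c:]" and d: "d \<noteq> 0" "w = hw \<alpha> \<nu> [:d:]"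
    using assms(2,3) unfolding is_generator_iff[OF assms(1)] by blast
  have "w = scaleA \<alpha> (d / c) v" using c d by (simp only: hw_const scaleA_img) simp
  then show ?thesis using c d by (intro exI[of _ "d / c"]) simp
qed

text \<open>
  The diagonal matrix units are self-adjoint and separate weights.
\<close>

lemma A_plus_wt_orthogonal:
  assumes ne: "\<nu> \<noteq> \<mu>" and v: "v \<in> A_plus_wt \<alpha> \<nu>" and w: "w \<in> A_plus_wt \<alpha> \<mu>"
  shows "formA \<alpha> v w = 0"
proof -
  obtain a b where ab: "v = img \<alpha> a" "w = img \<alpha> b" using A_plus_wt_img v w by metis
  obtain i where i: "\<nu> $ i \<noteq> \<mu> $ i" using ne by (auto simp: vec_eq_iff)
  show ?thesis unfolding ab
    by (rule formA_orthogonal[where T = "adE (i, i)" and c = "of_int (\<nu> $ i)" and d = "of_int (\<mu> $ i)"])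
       (use v w i in \<open>simp_all add: ab A_plus_wt_iff trace_functional_adE\<close>)
qed

lemma width_eq:
  assumes "dominant \<nu>"
  shows "\<nu> $ 3 \<le> 0 \<Longrightarrow> of_nat (width \<nu>) = complex_of_int (\<nu> $ 1)"
    and "\<nu> $ 3 \<ge> 0 \<Longrightarrow> of_nat (width \<nu>) = - complex_of_int (\<nu> $ 2)"
  using assms dominant_nat_nonpos[OF assms] by (simp_all add: width_def dominant_def)


lemma generator_hw:
  assumes "\<And>\<mu>. \<mu> \<in> Q_plus \<alpha> \<Longrightarrow> is_generator \<alpha> \<mu> (u \<mu>)" "\<nu> \<in> Q_plus \<alpha>"
  obtains c where "c \<noteq> 0" "u \<nu> = hw \<alpha> \<nu> [:c:]"
  using assms is_generator_iff by blast

lemma f_elements_represents: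
  assumes gen: "\<And>\<mu>. \<mu> \<in> Q_plus \<alpha> \<Longrightarrow> is_generator \<alpha> \<mu> (u \<mu>)" and \<nu>: "\<nu> \<in> Q_plus \<alpha>"
    and w: "w \<in> f_elements \<alpha> u k \<nu>"
  obtains c h where "c \<noteq> 0" "u \<nu> = hw \<alpha> \<nu> [:c:]" "w = hw \<alpha> \<nu> h" "Polynomial.degree h \<le> k" "poly h (of_nat (base \<nu>)) \<noteq> 0"
    "allowed \<alpha> (width \<nu> + k)"
    "adU casimir (poly_E33 h * std \<nu>) - scaleU (casimir_value (width \<nu> + k)) (poly_E33 h * std \<nu>) \<in> J_ideal \<alpha>"
    "\<And>f. represents \<alpha> (u \<nu>) w f \<longleftrightarrow> f = Polynomial.smult (1 / c) h"
proof -
  obtain h where h: "w = hw \<alpha> \<nu> h" "Polynomial.degree h \<le> k" "poly h (of_nat (base \<nu>)) \<noteq> 0" "allowed \<alpha> (width \<nu> + k)"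
    "adU casimir (poly_E33 h * std \<nu>) - scaleU (casimir_value (width \<nu> + k)) (poly_E33 h * std \<nu>) \<in> J_ideal \<alpha>"
    using f_elements_hw[OF gen \<nu> w] by blast
  obtain c where c: "c \<noteq> 0" "u \<nu> = hw \<alpha> \<nu> [:c:]" using generator_hw[OF gen \<nu>] by blast
  have "allowed \<alpha> (width \<nu> + Polynomial.degree h)" using h(4) by (rule allowed_mono) (simp add: h(2))
  from represents_iff[OF Q_plus_dominant(1)[OF \<nu>] c(1) this]
  show ?thesis using that[OF c h] unfolding c(2) h(1) by blast
qed

text \<open>
  The Casimir operator is self-adjoint, and its eigenvalue determines \<open>k\<close>.
\<close>

lemma f_polys_orthogonal:
  assumes gen: "\<And>\<mu>. \<mu> \<in> Q_plus \<alpha> \<Longrightarrow> is_generator \<alpha> \<mu> (u \<mu>)" and \<nu>: "\<nu> \<in> Q_plus \<alpha>"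
    and f: "f \<in> f_polys \<alpha> u k \<nu>" and g: "g \<in> f_polys \<alpha> u l \<nu>" and ne: "k \<noteq> l"
  shows "form_plus \<alpha> (u \<nu>) f g = 0"
proof -
  have eigen: "\<exists>x. poly_mult \<alpha> f (u \<nu>) = img \<alpha> x \<and> adU casimir x - scaleU (casimir_value (width \<nu> + k)) x \<in> J_ideal \<alpha>"
    if "f \<in> f_polys \<alpha> u k \<nu>" for f k
  proof -
    obtain w where w: "w \<in> f_elements \<alpha> u k \<nu>" "represents \<alpha> (u \<nu>) w f" using \<open>f \<in> f_polys \<alpha> u k \<nu>\<close> by (auto simp: f_polys_def)
    obtain h where "w = hw \<alpha> \<nu> h" "adU casimir (poly_E33 h * std \<nu>) - scaleU (casimir_value (width \<nu> + k)) (poly_E33 h * std \<nu>) \<in> J_ideal \<alpha>"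
      using f_elements_hw[OF gen \<nu> w(1)] by blast
    moreover have "poly_mult \<alpha> f (u \<nu>) = w" using w(2) by (simp add: represents_def)
    ultimately show ?thesis unfolding hw_def by blast
  qed
  obtain x y where x: "poly_mult \<alpha> f (u \<nu>) = img \<alpha> x" "adU casimir x - scaleU (casimir_value (width \<nu> + k)) x \<in> J_ideal \<alpha>"
    and y: "poly_mult \<alpha> g (u \<nu>) = img \<alpha> y" "adU casimir y - scaleU (casimir_value (width \<nu> + l)) y \<in> J_ideal \<alpha>"
    using eigen[OF f] eigen[OF g] by blast
  show ?thesis
    unfolding form_plus_def x(1) y(1)
    by (rule formA_orthogonal[OF trace_functional_casimir x(2) y(2)]) (simp add: casimir_value_inject ne)
qed

lemma f_polys_equations:
  assumes gen: "\<And>\<mu>. \<mu> \<in> Q_plus \<alpha> \<Longrightarrow> is_generator \<alpha> \<mu> (u \<mu>)" and \<nu>: "\<nu> \<in> Q_plus \<alpha>"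
    and f: "f \<in> f_polys \<alpha> u k \<nu>"
  shows "(t + 1 + of_nat (nat (- \<nu> $ 3))) * (t + of_int (\<nu> $ 1) - \<alpha>) * fdiff f t
       - (t - of_nat (base \<nu>)) * (t + of_int (\<nu> $ 2) - \<alpha> - 2) * bdiff f t
       = of_nat k * (of_nat k + 2 * of_nat (width \<nu>) + 2) * poly f t"
    and "\<exists>c. c \<noteq> 0 \<and> (\<forall>t. poly f t = c * F32 (- of_nat k) (of_nat k + 2 * of_nat (width \<nu>) + 2) (of_nat (base \<nu>) - t)
       (1 + of_nat (nat \<bar>\<nu> $ 3\<bar>)) (of_nat (width \<nu>) - \<alpha>) 1)"
proof -
  obtain w where w: "w \<in> f_elements \<alpha> u k \<nu>" "represents \<alpha> (u \<nu>) w f" using f by (auto simp: f_polys_def)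
  obtain c h where c: "c \<noteq> 0" and h: "Polynomial.degree h \<le> k" "poly h (of_nat (base \<nu>)) \<noteq> 0" "allowed \<alpha> (width \<nu> + k)"
    "adU casimir (poly_E33 h * std \<nu>) - scaleU (casimir_value (width \<nu> + k)) (poly_E33 h * std \<nu>) \<in> J_ideal \<alpha>"
    and fh: "f = Polynomial.smult (1 / c) h"
    using f_elements_represents[OF gen \<nu> w(1)] w(2) by metis
  note eqs = ladder_poly_equation[OF Q_plus_dominant(1)[OF \<nu>] h(1,3,4)]
  have d: "fdiff f t = 1 / c * fdiff h t" "bdiff f t = 1 / c * bdiff h t" "poly f t = 1 / c * poly h t" for t
    by (simp_all add: fh fdiff_def bdiff_def diff_divide_distrib)
  show "(t + 1 + of_nat (nat (- \<nu> $ 3))) * (t + of_int (\<nu> $ 1) - \<alpha>) * fdiff f t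
       - (t - of_nat (base \<nu>)) * (t + of_int (\<nu> $ 2) - \<alpha> - 2) * bdiff f t
       = of_nat k * (of_nat k + 2 * of_nat (width \<nu>) + 2) * poly f t"
  proof -
    have "A * (s * D) - B * (s * D') = R * (s * p)" if "A * D - B * D' = R * p" for A B D D' R p s :: complex
      using arg_cong[OF that, of "(*) s"] by (simp only: right_diff_distrib mult.left_commute)
    from this[OF eqs(1)[of t]] show ?thesis unfolding d .
  qed
  show "\<exists>c. c \<noteq> 0 \<and> (\<forall>t. poly f t = c * F32 (- of_nat k) (of_nat k + 2 * of_nat (width \<nu>) + 2) (of_nat (base \<nu>) - t)
       (1 + of_nat (nat \<bar>\<nu> $ 3\<bar>)) (of_nat (width \<nu>) - \<alpha>) 1)"
  proof (intro exI[of _ "1 / c * poly h (of_nat (base \<nu>))"] conjI allI)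
    show "1 / c * poly h (of_nat (base \<nu>)) \<noteq> 0" using c h(2) by simp
    show "poly f t = 1 / c * poly h (of_nat (base \<nu>)) * F32 (- of_nat k) (of_nat k + 2 * of_nat (width \<nu>) + 2) (of_nat (base \<nu>) - t)
       (1 + of_nat (nat \<bar>\<nu> $ 3\<bar>)) (of_nat (width \<nu>) - \<alpha>) 1" for t
      unfolding d(3) mult.assoc using eqs(2)[of t] by (rule arg_cong)
  qed
qed

lemma nonpos_weight:
  assumes "dominant \<nu>" "\<nu> $ 3 \<le> 0"
  shows "of_nat (nat (- \<nu> $ 3)) = - complex_of_int (\<nu> $ 3)" "of_nat (nat \<bar>\<nu> $ 3\<bar>) = - complex_of_int (\<nu> $ 3)"
    "base \<nu> = 0" "of_nat (width \<nu>) = complex_of_int (\<nu> $ 1)"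
  using assms(2) width_eq[OF assms(1)] by (simp_all add: base_def)

lemma nonneg_weight:
  assumes "dominant \<nu>" "\<nu> $ 3 \<ge> 0"
  shows "of_nat (nat (- \<nu> $ 3)) = (0 :: complex)" "of_nat (nat \<bar>\<nu> $ 3\<bar>) = complex_of_int (\<nu> $ 3)"
    "of_nat (base \<nu>) = complex_of_int (\<nu> $ 3)" "of_nat (width \<nu>) = - complex_of_int (\<nu> $ 2)"
  using assms(2) width_eq[OF assms(1)] by (simp_all add: base_def)

theorem theorem2p4:
  fixes \<alpha> :: complex
  shows
    "(\<forall>\<nu>\<in>Q_plus \<alpha>. (\<exists>v. is_generator \<alpha> \<nu> v) \<and>
        (\<forall>v w. is_generator \<alpha> \<nu> v \<and> is_generator \<alpha> \<nu> w \<longrightarrow> (\<exists>c. c \<noteq> 0 \<and> w = scaleA \<alpha> c v)))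
     \<and> (\<forall>\<nu>\<in>root_lattice. \<forall>\<mu>\<in>root_lattice. \<nu> \<noteq> \<mu> \<longrightarrow>
          (\<forall>v\<in>A_plus_wt \<alpha> \<nu>. \<forall>w\<in>A_plus_wt \<alpha> \<mu>. formA \<alpha> v w = 0))
     \<and> (\<forall>u. (\<forall>\<nu>\<in>Q_plus \<alpha>. is_generator \<alpha> \<nu> (u \<nu>)) \<longrightarrow>
         (\<forall>\<nu>\<in>Q_plus \<alpha>.
            (\<forall>k. \<forall>w\<in>f_elements \<alpha> u k \<nu>. \<exists>!f. represents \<alpha> (u \<nu>) w f)
          \<and> (\<forall>k l. \<forall>f\<in>f_polys \<alpha> u k \<nu>. \<forall>g\<in>f_polys \<alpha> u l \<nu>.
               k \<noteq> l \<longrightarrow> form_plus \<alpha> (u \<nu>) f g = 0)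
          \<and> (\<forall>k. \<forall>f\<in>f_polys \<alpha> u k \<nu>. \<forall>t.
               (vec_nth \<nu> 3 < 0 \<longrightarrow>
                  (t - of_int (vec_nth \<nu> 3) + 1) * (t + of_int (vec_nth \<nu> 1) - \<alpha>) * fdiff f t
                  - t * (t + of_int (vec_nth \<nu> 2) - \<alpha> - 2) * bdiff f t
                  = of_nat k * (of_nat k + 2 * of_int (vec_nth \<nu> 1) + 2) * poly f t) \<and>
               (vec_nth \<nu> 3 \<ge> 0 \<longrightarrow>
                  (t + 1) * (t + of_int (vec_nth \<nu> 1) - \<alpha>) * fdiff f t
                  - (t - of_int (vec_nth \<nu> 3)) * (t + of_int (vec_nth \<nu> 2) - \<alpha> - 2) * bdiff f t
                  = of_nat k * (of_nat k - 2 * of_int (vec_nth \<nu> 2) + 2) * poly f t))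
          \<and> (\<forall>k. \<forall>f\<in>f_polys \<alpha> u k \<nu>.
               (vec_nth \<nu> 3 \<le> 0 \<longrightarrow> (\<exists>c. c \<noteq> 0 \<and> (\<forall>t. poly f t =
                  c * F32 (- of_nat k) (of_nat k + 2 * of_int (vec_nth \<nu> 1) + 2) (- t)
                        (1 - of_int (vec_nth \<nu> 3)) (of_int (vec_nth \<nu> 1) - \<alpha>) 1))) \<and>
               (vec_nth \<nu> 3 \<ge> 0 \<longrightarrow> (\<exists>c. c \<noteq> 0 \<and> (\<forall>t. poly f t =
                  c * F32 (- of_nat k) (of_nat k - 2 * of_int (vec_nth \<nu> 2) + 2) (of_int (vec_nth \<nu> 3) - t)
                        (1 + of_int (vec_nth \<nu> 3)) (- of_int (vec_nth \<nu> 2) - \<alpha>) 1))))))"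
proof (intro conjI ballI allI impI)
  show "\<exists>v. is_generator \<alpha> \<nu> v" if "\<nu> \<in> Q_plus \<alpha>" for \<nu>
    using that by (rule generator_exists)
  show "\<exists>c. c \<noteq> 0 \<and> w = scaleA \<alpha> c v"
    if "\<nu> \<in> Q_plus \<alpha>" "is_generator \<alpha> \<nu> v \<and> is_generator \<alpha> \<nu> w" for \<nu> v w
    using that generator_unique by blast
  show "formA \<alpha> v w = 0" if "\<nu> \<noteq> \<mu>" "v \<in> A_plus_wt \<alpha> \<nu>" "w \<in> A_plus_wt \<alpha> \<mu>" for \<nu> \<mu> v w
    using that by (rule A_plus_wt_orthogonal)
next
  fix u \<nu> k w
  assume g: "\<forall>\<nu>\<in>Q_plus \<alpha>. is_generator \<alpha> \<nu> (u \<nu>)" and \<nu>: "\<nu> \<in> Q_plus \<alpha>" and w: "w \<in> f_elements \<alpha> u k \<nu>"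
  show "\<exists>!f. represents \<alpha> (u \<nu>) w f"
    using f_elements_represents[OF bspec[OF g] \<nu> w] by metis
next
  fix u \<nu> k l f f'
  assume g: "\<forall>\<nu>\<in>Q_plus \<alpha>. is_generator \<alpha> \<nu> (u \<nu>)" and \<nu>: "\<nu> \<in> Q_plus \<alpha>" and f: "f \<in> f_polys \<alpha> u k \<nu>" "f' \<in> f_polys \<alpha> u l \<nu>" "k \<noteq> l"
  show "form_plus \<alpha> (u \<nu>) f f' = 0" by (rule f_polys_orthogonal[OF bspec[OF g] \<nu> f])
next
  fix u \<nu> k f t
  assume g: "\<forall>\<nu>\<in>Q_plus \<alpha>. is_generator \<alpha> \<nu> (u \<nu>)" and \<nu>: "\<nu> \<in> Q_plus \<alpha>" and f: "f \<in> f_polys \<alpha> u k \<nu>" and n: "vec_nth \<nu> 3 < 0"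
  have "\<nu> $ 3 \<le> 0" using n by simp
  from f_polys_equations(1)[OF bspec[OF g] \<nu> f, of t, unfolded nonpos_weight[OF Q_plus_dominant(1)[OF \<nu>] this]]
  show "(t - of_int (vec_nth \<nu> 3) + 1) * (t + of_int (vec_nth \<nu> 1) - \<alpha>) * fdiff f t
      - t * (t + of_int (vec_nth \<nu> 2) - \<alpha> - 2) * bdiff f t
      = of_nat k * (of_nat k + 2 * of_int (vec_nth \<nu> 1) + 2) * poly f t"
    by (simp add: algebra_simps)
next
  fix u \<nu> k f t
  assume g: "\<forall>\<nu>\<in>Q_plus \<alpha>. is_generator \<alpha> \<nu> (u \<nu>)" and \<nu>: "\<nu> \<in> Q_plus \<alpha>" and f: "f \<in> f_polys \<alpha> u k \<nu>" and n: "vec_nth \<nu> 3 \<ge> 0"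
  from f_polys_equations(1)[OF bspec[OF g] \<nu> f, of t, unfolded nonneg_weight[OF Q_plus_dominant(1)[OF \<nu>] n]]
  show "(t + 1) * (t + of_int (vec_nth \<nu> 1) - \<alpha>) * fdiff f t
      - (t - of_int (vec_nth \<nu> 3)) * (t + of_int (vec_nth \<nu> 2) - \<alpha> - 2) * bdiff f t
      = of_nat k * (of_nat k - 2 * of_int (vec_nth \<nu> 2) + 2) * poly f t"
    by simp
next
  fix u \<nu> k f
  assume g: "\<forall>\<nu>\<in>Q_plus \<alpha>. is_generator \<alpha> \<nu> (u \<nu>)" and \<nu>: "\<nu> \<in> Q_plus \<alpha>" and f: "f \<in> f_polys \<alpha> u k \<nu>" and n: "vec_nth \<nu> 3 \<le> 0"
  from f_polys_equations(2)[OF bspec[OF g] \<nu> f, unfolded nonpos_weight[OF Q_plus_dominant(1)[OF \<nu>] n]]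
  show "\<exists>c. c \<noteq> 0 \<and> (\<forall>t. poly f t =
      c * F32 (- of_nat k) (of_nat k + 2 * of_int (vec_nth \<nu> 1) + 2) (- t)
            (1 - of_int (vec_nth \<nu> 3)) (of_int (vec_nth \<nu> 1) - \<alpha>) 1)"
    by simp
next
  fix u \<nu> k f
  assume g: "\<forall>\<nu>\<in>Q_plus \<alpha>. is_generator \<alpha> \<nu> (u \<nu>)" and \<nu>: "\<nu> \<in> Q_plus \<alpha>" and f: "f \<in> f_polys \<alpha> u k \<nu>" and n: "vec_nth \<nu> 3 \<ge> 0"
  from f_polys_equations(2)[OF bspec[OF g] \<nu> f, unfolded nonneg_weight[OF Q_plus_dominant(1)[OF \<nu>] n]]
  show "\<exists>c. c \<noteq> 0 \<and> (\<forall>t. poly f t =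
      c * F32 (- of_nat k) (of_nat k - 2 * of_int (vec_nth \<nu> 2) + 2) (of_int (vec_nth \<nu> 3) - t)
            (1 + of_int (vec_nth \<nu> 3)) (- of_int (vec_nth \<nu> 2) - \<alpha>) 1)"
    by simp
qed

end
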